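(* Let $a>0$ and $T\in\mathbb{C}$. The operator $$\mathcal{L}:H_{a,T}\rightarrow S_{a,T},\qquad \mathcal{L}\{F\}(\zeta)=\zeta\int_0^{+\infty}e^{-\zeta t}F(t)\,dt,$$ is a bijection from the linear space $H_{a,T}$ onto the linear space $S_{a,T}$.
   Context: Fix $a>0$ and $T\in\mathbb{C}$. **The space $S_{a,T}$.** It is the linear space of all functions $P(\zeta)$ such that: 1. $P$ is analytic in the $\zeta$-plane punctured at $\zeta=0$ and $\zeta=\infty$. $P$ may be multi-valued: it is a holomorphic function on the Riemann surface of the logarithm, $0<|\zeta|<\infty$, $-\infty<\arg\zeta<\infty$, and $\zeta e^{\pm\pi i}$ denotes the point of this surface obtained from $\zeta$ by changing the argument by $\pm\pi$. 2. There is a positive decreasing function $M_P(r)$ such that, for every $0<r<\infty$, $|P(\zeta)|\le M_P(r)$ whenever $|\arg\zeta|\le\pi$ and $|\zeta|\ge r$. 3. $P(\zeta e^{\pi i})=P(\zeta e^{-\pi i})+Te^{-a\zeta}P(\zeta)$ for all $\zeta$ on the surface. **The space $H_{a,T}$.** It is the linear space of all functions $F(t)$ such that: (i) $F$ is a (possibly multi-valued) analytic function in the complex $t$-plane punctured at the two finite points $t=0$ and $t=-a$ (it can be continued analytically along any path avoiding these points), and $F$ has exponential growth of minimal type at $\infty$ in any sectorial region $\{t:-\infty<\alpha<\arg t<\beta<+\infty\}$; that is, for every $\varepsilon>0$ there is a constant $K$ such that $|F(t)|\le Ke^{\varepsilon|t|}$ for all $t$ in the region with $|t|$ sufficiently large.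 (ii) There is a branch of $F$ which is analytic in the $t$-plane cut along $(-\infty,-a]$ (in particular it is analytic at $t=0$). This branch is again denoted $F$. (iii) The branch in (ii) satisfies $F(t)=O(\log(t+a))$ as $t\to-a$, $|t+a|<a$, $|\arg(t+a)|<\pi$. (iv) The branch in (ii) satisfies, for $-a<t<+\infty$, $$F\left((t+a)e^{\pi i}-a\right)=F\left((t+a)e^{-\pi i}-a\right)-TF\left(-(t+a)e^{\pi i}\right);$$ equivalently, for $s>0$, $F(se^{\pi i}-a)=F(se^{-\pi i}-a)-TF(s)$, where $se^{\pi i}-a$ and $se^{-\pi i}-a$ denote the points $-a-s$ on the upper and lower banks of the cut $(-\infty,-a]$, respectively. **The operator $\mathcal{L}$.** In the formula for $\mathcal{L}\{F\}$, $F$ is the branch from (ii). The integral defines $\mathcal{L}\{F\}(\zeta)$ for $|\arg\zeta|<\pi/2$, and $\mathcal{L}\{F\}$ is then understood as the analytic continuation of this function to the Riemann surface of the logarithm. *)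

theory Defs
  imports "HOL-Complex_Analysis.Complex_Analysis"
begin

text \<open>
  Functions on the Riemann surface of the logarithm are written in the global coordinate
  \<open>w = log \<zeta>\<close>: the point \<open>\<zeta> = exp w\<close> of the surface has
  \<open>\<bar>\<zeta>\<bar> = norm (exp w)\<close> and \<open>arg \<zeta> = Im w\<close>, and \<open>\<zeta> e\<^sup>\<plusminus>\<^sup>\<pi>\<^sup>i\<close> is the point
  \<open>w \<plusminus> pi * \<i>\<close>.  A holomorphic function on the surface is thus an entire function of \<open>w\<close>.
\<close>

definition S_space :: "real \<Rightarrow> complex \<Rightarrow> (complex \<Rightarrow> complex) set" where
  "S_space a T = {P.
     P holomorphic_on UNIV \<and>
     (\<exists>M :: real \<Rightarrow> real.
        (\<forall>r>0. M r > 0) \<and> antimono_on {0<..} M \<and>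
        (\<forall>r>0. \<forall>w. \<bar>Im w\<bar> \<le> pi \<and> norm (exp w) \<ge> r \<longrightarrow> norm (P w) \<le> M r)) \<and>
     (\<forall>w. P (w + pi * \<i>) = P (w - pi * \<i>) + T * exp (- a * exp w) * P w)}"

text \<open>
  \<open>g s\<close> represents the germ at \<open>\<gamma> s\<close> obtained from the germ of \<open>f\<close> at \<open>\<gamma> 0\<close> by analytic
  continuation along \<open>\<gamma>\<close>.
\<close>

definition continuation_along ::
  "(real \<Rightarrow> complex) \<Rightarrow> (complex \<Rightarrow> complex) \<Rightarrow> (real \<Rightarrow> complex \<Rightarrow> complex) \<Rightarrow> bool" where
  "continuation_along \<gamma> f g \<longleftrightarrow>
     (\<forall>s\<in>{0..1}. g s analytic_on {\<gamma> s}) \<and>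
     (\<forall>s\<in>{0..1}. \<forall>\<^sub>F s' in at s within {0..1}. \<forall>\<^sub>F t in nhds (\<gamma> s'). g s' t = g s t) \<and>
     (\<forall>\<^sub>F t in nhds (\<gamma> 0). g 0 t = f t)"

definition cut_plane :: "real \<Rightarrow> complex set" where
  "cut_plane a = - (complex_of_real ` {..- a})"

text \<open>
  Paths along which the branch on the cut plane has to be continued.  They may start
  anywhere in the cut plane except at \<open>0\<close>.
\<close>

definition admissible_path :: "real \<Rightarrow> (real \<Rightarrow> complex) \<Rightarrow> bool" where
  "admissible_path a \<gamma> \<longleftrightarrow>
     path \<gamma> \<and> path_image \<gamma> \<subseteq> - {0, - of_real a} \<and> pathstart \<gamma> \<in> cut_plane a"

text \<open>
  The part in \<open>\<bar>t\<bar> > a\<close> of the sectorial region \<open>\<alpha> < arg t < \<beta>\<close>, in the coordinate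
  \<open>w = log t\<close>; the opening may exceed \<open>2\<pi>\<close>.
\<close>

definition sector :: "real \<Rightarrow> real \<Rightarrow> real \<Rightarrow> complex set" where
  "sector a \<alpha> \<beta> = {w. a < norm (exp w) \<and> \<alpha> < Im w \<and> Im w < \<beta>}"

definition minimal_type_on :: "complex set \<Rightarrow> (complex \<Rightarrow> complex) \<Rightarrow> bool" where
  "minimal_type_on W G \<longleftrightarrow>
     (\<forall>\<epsilon>>0. \<exists>K R. \<forall>w\<in>W. R \<le> norm (exp w) \<longrightarrow> norm (G w) \<le> K * exp (\<epsilon> * norm (exp w)))"

text \<open>
  A multi-valued function is identified with its branch on the cut plane, which determines
  all the others.  As HOL functions are total, the branch is normalised to be \<open>0\<close> on the cut.

  In the third condition \<open>G\<close> is the branch of the multi-valued function over the sectorial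
  region which extends the germ obtained at the end of \<open>\<gamma>\<close>; the condition therefore concerns
  every branch of the function over every sectorial region.  In the last condition \<open>u\<close> and
  \<open>l\<close> are the values of the branch at the point \<open>- a - s\<close> of the upper and lower bank of
  the cut.
\<close>

definition H_space :: "real \<Rightarrow> complex \<Rightarrow> (complex \<Rightarrow> complex) set" where
  "H_space a T = {F.
     (\<forall>t. t \<notin> cut_plane a \<longrightarrow> F t = 0) \<and>
     (\<forall>\<gamma>. admissible_path a \<gamma> \<longrightarrow> (\<exists>g. continuation_along \<gamma> F g)) \<and>
     (\<forall>\<gamma> \<alpha> \<beta> w. admissible_path a \<gamma> \<and> w \<in> sector a \<alpha> \<beta> \<and> exp w = pathfinish \<gamma> \<longrightarrow>
        (\<exists>g G. continuation_along \<gamma> F g \<and>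
               G holomorphic_on sector a \<alpha> \<beta> \<and>
               (\<forall>\<^sub>F z in nhds w. G z = g 1 (exp z)) \<and>
               minimal_type_on (sector a \<alpha> \<beta>) G)) \<and>
     F holomorphic_on cut_plane a \<and>
     F \<in> O[at (- of_real a) within (cut_plane a \<inter> ball (- of_real a) a)](\<lambda>t. Ln (t + of_real a)) \<and>
     (\<forall>s>0. \<exists>u l.
        (F \<longlongrightarrow> u) (at (of_real (- a - s)) within {t. Im t > 0}) \<and>
        (F \<longlongrightarrow> l) (at (of_real (- a - s)) within {t. Im t < 0}) \<and>
        u = l - T * F (of_real s))}"

definition is_laplace :: "(complex \<Rightarrow> complex) \<Rightarrow> (complex \<Rightarrow> complex) \<Rightarrow> bool" where
  "is_laplace F P \<longleftrightarrow>
     P holomorphic_on UNIV \<and>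
     (\<forall>w. \<bar>Im w\<bar> < pi / 2 \<longrightarrow>
        set_integrable lborel {0..} (\<lambda>t::real. exp (- exp w * of_real t) * F (of_real t)) \<and>
        P w = exp w * (LBINT t:{0..}. exp (- exp w * of_real t) * F (of_real t)))"

definition laplace_op :: "(complex \<Rightarrow> complex) \<Rightarrow> (complex \<Rightarrow> complex)" where
  "laplace_op F = (THE P. is_laplace F P)"

lemma is_laplace_unique:
  assumes P: "is_laplace F P" and Q: "is_laplace F Q"
  shows "P = Q"
proof
  fix w
  have op: "open {w::complex. \<bar>Im w\<bar> < pi / 2}"
    by (intro open_Collect_less continuous_intros)
  have "P w - Q w = 0"
  proof (rule analytic_continuation_open[of "{w. \<bar>Im w\<bar> < pi / 2}" UNIV "\<lambda>w. P w - Q w" "\<lambda>_. 0"])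
    show "{w. \<bar>Im w\<bar> < pi / 2} \<noteq> {}" by (auto intro: exI[of _ 0])
    show "(\<lambda>w. P w - Q w) holomorphic_on UNIV"
      using P Q unfolding is_laplace_def by (intro holomorphic_intros) auto
    show "P z - Q z = 0" if "z \<in> {w. \<bar>Im w\<bar> < pi / 2}" for z
      using P Q that unfolding is_laplace_def by simp
  qed (use op in auto)
  then show "P w = Q w" by simp
qed

lemma laplace_op_eq: "is_laplace F P \<Longrightarrow> laplace_op F = P"
  unfolding laplace_op_def using is_laplace_unique by blast

text \<open>Both sets are linear spaces under the pointwise operations.\<close>

lemma S_space_zero: "(\<lambda>_. 0) \<in> S_space a T"
  unfolding S_space_def by (auto intro!: exI[of _ "\<lambda>_. 1"] simp: monotone_on_def)

lemma S_space_add_scale: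
  assumes P: "P \<in> S_space a T" and Q: "Q \<in> S_space a T"
  shows "(\<lambda>w. P w + c * Q w) \<in> S_space a T"
proof -
  obtain M where M: "\<forall>r>0. M r > (0::real)" "antimono_on {0<..} M"
    "\<forall>r>0. \<forall>w. \<bar>Im w\<bar> \<le> pi \<and> norm (exp w) \<ge> r \<longrightarrow> norm (P w) \<le> M r"
    using P unfolding S_space_def by blast
  obtain N where N: "\<forall>r>0. N r > (0::real)" "antimono_on {0<..} N"
    "\<forall>r>0. \<forall>w. \<bar>Im w\<bar> \<le> pi \<and> norm (exp w) \<ge> r \<longrightarrow> norm (Q w) \<le> N r"
    using Q unfolding S_space_def by blast
  have "\<forall>r>0. M r + norm c * N r > 0"
    using M(1) N(1) by (simp add: add_pos_nonneg less_imp_le)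
  moreover have "antimono_on {0<..} (\<lambda>r. M r + norm c * N r)"
    using M(2) N(2) by (auto simp: monotone_on_def intro!: add_mono mult_left_mono)
  moreover have "norm (P w + c * Q w) \<le> M r + norm c * N r"
    if "r > 0" "\<bar>Im w\<bar> \<le> pi" "norm (exp w) \<ge> r" for r w
    using M(3) N(3) that
    by (intro order_trans[OF norm_triangle_ineq] add_mono) (auto simp: norm_mult intro!: mult_left_mono)
  ultimately have "\<exists>M :: real \<Rightarrow> real.
        (\<forall>r>0. M r > 0) \<and> antimono_on {0<..} M \<and>
        (\<forall>r>0. \<forall>w. \<bar>Im w\<bar> \<le> pi \<and> norm (exp w) \<ge> r \<longrightarrow> norm (P w + c * Q w) \<le> M r)"
    by (intro exI[of _ "\<lambda>r. M r + norm c * N r"]) auto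
  moreover have "(\<lambda>w. P w + c * Q w) holomorphic_on UNIV"
    using P Q unfolding S_space_def by (auto intro!: holomorphic_intros)
  moreover have "P (w + pi * \<i>) + c * Q (w + pi * \<i>) =
      P (w - pi * \<i>) + c * Q (w - pi * \<i>) + T * exp (- a * exp w) * (P w + c * Q w)" for w :: complex
    using P Q unfolding S_space_def by (simp add: algebra_simps)
  ultimately show ?thesis unfolding S_space_def by simp
qed

lemma continuation_along_add_scale:
  assumes "continuation_along \<gamma> f g" "continuation_along \<gamma> f' g'"
  shows "continuation_along \<gamma> (\<lambda>t. f t + c * f' t) (\<lambda>s t. g s t + c * g' s t)"
  unfolding continuation_along_def
proof (intro conjI ballI)
  fix s :: real assume s: "s \<in> {0..1}"
  show "(\<lambda>t. g s t + c * g' s t) analytic_on {\<gamma> s}"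
    using assms s unfolding continuation_along_def by (auto intro!: analytic_intros)
  have "\<forall>\<^sub>F s' in at s within {0..1}. \<forall>\<^sub>F t in nhds (\<gamma> s'). g s' t = g s t"
    "\<forall>\<^sub>F s' in at s within {0..1}. \<forall>\<^sub>F t in nhds (\<gamma> s'). g' s' t = g' s t"
    using assms s unfolding continuation_along_def by auto
  then show "\<forall>\<^sub>F s' in at s within {0..1}. \<forall>\<^sub>F t in nhds (\<gamma> s').
      g s' t + c * g' s' t = g s t + c * g' s t"
  proof eventually_elim
    case (elim s')
    then show ?case by eventually_elim simp
  qed
next
  have "\<forall>\<^sub>F t in nhds (\<gamma> 0). g 0 t = f t" "\<forall>\<^sub>F t in nhds (\<gamma> 0). g' 0 t = f' t"
    using assms unfolding continuation_along_def by auto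
  then show "\<forall>\<^sub>F t in nhds (\<gamma> 0). g 0 t + c * g' 0 t = f t + c * f' t"
    by eventually_elim simp
qed

lemma minimal_type_on_add_scale:
  assumes "minimal_type_on W G" "minimal_type_on W G'"
  shows "minimal_type_on W (\<lambda>w. G w + c * G' w)"
  unfolding minimal_type_on_def
proof (intro allI impI)
  fix \<epsilon> :: real assume "\<epsilon> > 0"
  then obtain K R K' R' where
    1: "\<forall>w\<in>W. R \<le> norm (exp w) \<longrightarrow> norm (G w) \<le> K * exp (\<epsilon> * norm (exp w))" and
    2: "\<forall>w\<in>W. R' \<le> norm (exp w) \<longrightarrow> norm (G' w) \<le> K' * exp (\<epsilon> * norm (exp w))"
    using assms unfolding minimal_type_on_def by metis
  have "norm (G w + c * G' w) \<le> (K + norm c * K') * exp (\<epsilon> * norm (exp w))"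
    if "w \<in> W" "max R R' \<le> norm (exp w)" for w
  proof -
    have "norm (G w + c * G' w) \<le> norm (G w) + norm c * norm (G' w)"
      by (metis norm_triangle_ineq norm_mult)
    also have "\<dots> \<le> K * exp (\<epsilon> * norm (exp w)) + norm c * (K' * exp (\<epsilon> * norm (exp w)))"
      using 1 2 that by (intro add_mono mult_left_mono) auto
    finally show ?thesis by (simp add: algebra_simps)
  qed
  then show "\<exists>K R. \<forall>w\<in>W. R \<le> norm (exp w) \<longrightarrow>
      norm (G w + c * G' w) \<le> K * exp (\<epsilon> * norm (exp w))"
    by blast
qed

lemma H_space_zero: "(\<lambda>_. 0) \<in> H_space a T"
proof -
  have c: "continuation_along \<gamma> (\<lambda>_. 0) (\<lambda>_ _. 0)" for \<gamma>
    unfolding continuation_along_def by (simp add: analytic_on_const)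
  have m: "minimal_type_on W (\<lambda>_. 0)" for W
    unfolding minimal_type_on_def by (auto intro: exI[of _ 0])
  have "\<exists>g G. continuation_along \<gamma> (\<lambda>_. 0) g \<and> G holomorphic_on sector a \<alpha> \<beta> \<and>
      (\<forall>\<^sub>F z in nhds w. G z = g 1 (exp z)) \<and> minimal_type_on (sector a \<alpha> \<beta>) G"
    for \<gamma> \<alpha> \<beta> w
    using c m by (intro exI[of _ "\<lambda>_ _. 0"] exI[of _ "\<lambda>_. 0"]) auto
  then show ?thesis
    unfolding H_space_def using c by (auto intro!: exI[of _ 0] exI[of _ "\<lambda>_ _. 0"])
qed

lemma H_space_add_scale:
  assumes F: "F \<in> H_space a T" and F': "F' \<in> H_space a T"
  shows "(\<lambda>t. F t + c * F' t) \<in> H_space a T"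
proof -
  let ?H = "\<lambda>t. F t + c * F' t"
  have "\<exists>g. continuation_along \<gamma> ?H g" if "admissible_path a \<gamma>" for \<gamma>
  proof -
    obtain g g' where "continuation_along \<gamma> F g" "continuation_along \<gamma> F' g'"
      using F F' \<open>admissible_path a \<gamma>\<close> unfolding H_space_def by blast
    from continuation_along_add_scale[OF this] show ?thesis by blast
  qed
  moreover have "\<exists>g G. continuation_along \<gamma> ?H g \<and> G holomorphic_on sector a \<alpha> \<beta> \<and>
      (\<forall>\<^sub>F z in nhds w. G z = g 1 (exp z)) \<and> minimal_type_on (sector a \<alpha> \<beta>) G"
    if A: "admissible_path a \<gamma> \<and> w \<in> sector a \<alpha> \<beta> \<and> exp w = pathfinish \<gamma>" for \<gamma> \<alpha> \<beta> w
  proof -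
    obtain g G where 1: "continuation_along \<gamma> F g" "G holomorphic_on sector a \<alpha> \<beta>"
      "\<forall>\<^sub>F z in nhds w. G z = g 1 (exp z)" "minimal_type_on (sector a \<alpha> \<beta>) G"
      using F A unfolding H_space_def by blast
    obtain g' G' where 2: "continuation_along \<gamma> F' g'" "G' holomorphic_on sector a \<alpha> \<beta>"
      "\<forall>\<^sub>F z in nhds w. G' z = g' 1 (exp z)" "minimal_type_on (sector a \<alpha> \<beta>) G'"
      using F' A unfolding H_space_def by blast
    have "\<forall>\<^sub>F z in nhds w. G z + c * G' z = g 1 (exp z) + c * g' 1 (exp z)"
      using 1(3) 2(3) by eventually_elim simp
    moreover have "(\<lambda>z. G z + c * G' z) holomorphic_on sector a \<alpha> \<beta>"
      using 1(2) 2(2) by (intro holomorphic_intros)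
    ultimately show ?thesis
      using continuation_along_add_scale[OF 1(1) 2(1), of c]
        minimal_type_on_add_scale[OF 1(4) 2(4), of c]
      by (intro exI[of _ "\<lambda>s t. g s t + c * g' s t"] exI[of _ "\<lambda>z. G z + c * G' z"]) simp
  qed
  moreover have "?H holomorphic_on cut_plane a"
    using F F' unfolding H_space_def by (auto intro!: holomorphic_intros)
  moreover have "?H \<in> O[at (- of_real a) within (cut_plane a \<inter> ball (- of_real a) a)](\<lambda>t.
      Ln (t + of_real a))"
    using F F' unfolding H_space_def
    by (intro sum_in_bigo(1)) auto
  moreover have "\<exists>u l. (?H \<longlongrightarrow> u) (at (of_real (- a - s)) within {t. Im t > 0}) \<and>
        (?H \<longlongrightarrow> l) (at (of_real (- a - s)) within {t. Im t < 0}) \<and>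
        u = l - T * ?H (of_real s)" if "s > 0" for s
  proof -
    obtain u l where 1: "(F \<longlongrightarrow> u) (at (of_real (- a - s)) within {t. Im t > 0})"
      "(F \<longlongrightarrow> l) (at (of_real (- a - s)) within {t. Im t < 0})" "u = l - T * F (of_real s)"
      using F \<open>s > 0\<close> unfolding H_space_def by blast
    obtain u' l' where 2: "(F' \<longlongrightarrow> u') (at (of_real (- a - s)) within {t. Im t > 0})"
      "(F' \<longlongrightarrow> l') (at (of_real (- a - s)) within {t. Im t < 0})" "u' = l' - T * F' (of_real s)"
      using F' \<open>s > 0\<close> unfolding H_space_def by blast
    have "u + c * u' = l + c * l' - T * ?H (of_real s)"
      by (simp add: 1(3) 2(3) algebra_simps)
    then show ?thesis
      using tendsto_add[OF 1(1) tendsto_mult_left[OF 2(1), of c]]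
        tendsto_add[OF 1(2) tendsto_mult_left[OF 2(2), of c]] by blast
  qed
  moreover have "\<forall>t. t \<notin> cut_plane a \<longrightarrow> ?H t = 0"
    using F F' unfolding H_space_def by simp
  ultimately show ?thesis
    unfolding H_space_def by simp
qed

end

theory Submission
  imports Defs
begin

text \<open>
  Everything happens in the coordinate \<open>w = log \<zeta>\<close>, in which the surface of the logarithm is the
  plane, rays are horizontal lines and circles are vertical segments.

  \<^emph>\<open>From \<open>H\<close> to \<open>S\<close>.\<close>  For \<open>\<zeta> > 0\<close> the substitution \<open>x = \<zeta> t\<close> turns \<open>\<L>{F}(\<zeta>)\<close> into the integral of
  \<open>e\<^sup>-\<^sup>x F(x / \<zeta>)\<close> over \<open>x > 0\<close>.  This formula is holomorphic for \<open>\<bar>arg \<zeta>\<bar> < \<pi>\<close>, and over the ray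
  \<open>arg x = \<phi>\<close> it is holomorphic for \<open>\<bar>arg \<zeta> - \<phi>\<bar> < \<pi>\<close>.  On the line \<open>arg \<zeta> = \<phi>\<close> the rotated integral
  is the Laplace integral again, so the identity theorem makes all of them agree
  (\<open>Q_eq_Lap\<close>, \<open>Q_eq_Q\<close>) without any deformation of contours; this gives \<open>\<L>{F}\<close> on
  \<open>\<bar>arg \<zeta>\<bar> < 5\<pi>/4\<close> with the bounds required in \<open>S\<close>.  When \<open>arg \<zeta>\<close> tends to \<open>\<plusminus>\<pi>\<close>, the points \<open>x / \<zeta>\<close> tend
  to the two banks of the cut, and the jump of \<open>F\<close> there becomes the functional equation of \<open>S\<close>
  (\<open>p_jump\<close>); the logarithmic bound at \<open>- a\<close> provides the integrable majorant.  The functional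
  equation then continues \<open>\<L>{F}\<close> strip by strip to an entire function of \<open>w\<close>
  (\<open>extension_to_entire\<close>).

  \<^emph>\<open>From \<open>S\<close> to \<open>H\<close>.\<close>  The inverse is the Borel transform: \<open>2\<pi>i F(t)\<close> is the integral of
  \<open>e\<^sup>\<zeta>\<^sup>t P(\<zeta>) d\<zeta>/\<zeta>\<close> over a Hankel contour around the negative axis, that is a circle \<open>\<bar>\<zeta>\<bar> = r\<close> and the two
  banks.  By the functional equation the banks combine into one integral of
  \<open>T e\<^sup>-\<^sup>\<zeta>\<^sup>(\<^sup>t\<^sup>+\<^sup>a\<^sup>) P(\<zeta>) d\<zeta>/\<zeta>\<close> over \<open>\<zeta> > r\<close>.  The circle part is entire in \<open>t\<close>, and the other part is a function
  \<open>J\<close> of \<open>log (t + a)\<close> holomorphic for \<open>\<bar>arg (t + a)\<bar> < 3\<pi>/2\<close>, hence it reaches across the cut on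
  both sides.  The radius is arbitrary, which yields growth of minimal type (\<open>K_indep\<close>,
  \<open>K_growth\<close>), and the difference of \<open>J\<close> on the two banks closes up to the whole Hankel integral,
  which is the jump condition (\<open>J_jump\<close>).

  \<^emph>\<open>All other branches.\<close>  The jump condition says that \<open>F(t)\<close> and \<open>F(- a - t)\<close> span a space which is
  invariant under continuation across each of the three intervals of the real line.  So every
  branch is locally a combination of these two functions, which gives both continuation along all
  paths and growth of minimal type in all sectors (locale \<open>two_branches\<close>).

  \<^emph>\<open>Bijectivity.\<close>  Applying the Laplace integral to the Hankel integral and exchanging the integrals
  leaves a Cauchy integral of \<open>P\<close>, evaluated by the residue at \<open>\<zeta>\<close> (\<open>residue_at_pole\<close>); hence the
  operator is onto.  It is one-to-one by a Liouville argument
  (\<open>truncated_laplace_integrals_vanish\<close>).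
\<close>

section \<open>Integrals that depend holomorphically on a parameter\<close>

text \<open>
  A local majorant of the integrand also bounds its difference quotients, by the Cauchy
  inequality on a slightly smaller disc, so dominated convergence applies to them.
\<close>

lemma holomorphic_on_integral:
  fixes f :: "complex \<Rightarrow> 'x \<Rightarrow> complex"
  assumes S: "open S"
    and meas: "\<And>z. z \<in> S \<Longrightarrow> f z \<in> borel_measurable M"
    and hol: "\<And>x. x \<in> space M \<Longrightarrow> (\<lambda>z. f z x) holomorphic_on S"
    and dom: "\<And>z. z \<in> S \<Longrightarrow> \<exists>e>0. \<exists>D. integrable M D \<and>
       (\<forall>y\<in>S. dist z y < e \<longrightarrow> (\<forall>x\<in>space M. norm (f y x) \<le> D x))"
  shows "(\<lambda>z. integral\<^sup>L M (f z)) holomorphic_on S"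
proof -
  have "\<exists>D. ((\<lambda>z. integral\<^sup>L M (f z)) has_field_derivative D) (at z0)" if z0: "z0 \<in> S" for z0
  proof -
    obtain e D where e: "e > 0" and D: "integrable M D"
      and bd: "\<And>y x. y \<in> S \<Longrightarrow> dist z0 y < e \<Longrightarrow> x \<in> space M \<Longrightarrow> norm (f y x) \<le> D x"
      using dom[OF z0] by blast
    obtain e' where e': "e' > 0" "ball z0 e' \<subseteq> S" using S z0 by (auto simp: open_contains_ball)
    define r where "r = min e e' / 3"
    have r: "r > 0" "2 * r < e" "2 * r < e'" using e e' by (auto simp: r_def min_def)
    have inS: "y \<in> S \<and> dist z0 y < e" if "dist z0 y \<le> 2 * r" for y
      using that r e'(2) by (auto simp: subset_iff)
    have int: "integrable M (f y)" if "dist z0 y \<le> 2 * r" for y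
    proof (rule Bochner_Integration.integrable_bound[OF D])
      show "AE x in M. norm (f y x) \<le> norm (D x)"
        using bd[of y] inS[OF that] by (intro AE_I2) (auto intro: order_trans[OF _ abs_ge_self])
    qed (use meas inS that in auto)
    have df: "((\<lambda>z. f z x) has_field_derivative deriv (\<lambda>z. f z x) y) (at y)"
      if "y \<in> S" "x \<in> space M" for x y
      using holomorphic_derivI[OF hol S] that by blast
    have dbd: "norm (deriv (\<lambda>z. f z x) y) \<le> D x / r" if "x \<in> space M" "y \<in> ball z0 r" for x y
    proof -
      have sub: "cball y r \<subseteq> S"
      proof
        fix u assume "u \<in> cball y r"
        then have "dist z0 u \<le> 2 * r" using dist_triangle[of z0 u y] that by auto
        then show "u \<in> S" using inS by auto
      qed
      have "norm ((deriv ^^ 1) (\<lambda>z. f z x) y) \<le> fact 1 * D x / r ^ 1"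
      proof (rule Cauchy_inequality)
        show "(\<lambda>z. f z x) holomorphic_on ball y r"
          using hol[OF that(1)] sub by (meson ball_subset_cball holomorphic_on_subset order_trans)
        show "continuous_on (cball y r) (\<lambda>z. f z x)"
          using hol[OF that(1)] sub by (meson holomorphic_on_imp_continuous_on holomorphic_on_subset)
        fix u assume "norm (y - u) = r"
        then have "dist z0 u \<le> 2 * r" using dist_triangle[of z0 u y] that by (auto simp: dist_norm)
        then show "norm (f u x) \<le> D x" using bd inS that by auto
      qed (use r in auto)
      then show ?thesis by simp
    qed
    have quot: "norm ((f y x - f z0 x) / (y - z0)) \<le> D x / r"
      if "x \<in> space M" "y \<in> ball z0 r" "y \<noteq> z0" for x y
    proof -
      have "norm (f y x - f z0 x) \<le> D x / r * norm (y - z0)"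
      proof (rule field_differentiable_bound[of "ball z0 r" "\<lambda>z. f z x" "\<lambda>y. deriv (\<lambda>z. f z x) y"])
        fix u assume "u \<in> ball z0 r"
        then show "((\<lambda>z. f z x) has_field_derivative deriv (\<lambda>z. f z x) u) (at u within ball z0 r)"
          using df[of u x] inS[of u] that r by (auto intro: has_field_derivative_at_within)
      qed (use that r dbd in auto)
      then show ?thesis using that by (simp add: norm_divide field_simps)
    qed
    have "((\<lambda>y. (integral\<^sup>L M (f y) - integral\<^sup>L M (f z0)) / (y - z0))
        \<longlongrightarrow> integral\<^sup>L M (\<lambda>x. deriv (\<lambda>z. f z x) z0)) (at z0)"
      unfolding tendsto_at_iff_sequentially comp_def
    proof (intro allI impI)
      fix X :: "nat \<Rightarrow> complex" assume X: "\<forall>i. X i \<in> UNIV - {z0}" "X \<longlonglongrightarrow> z0"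
      obtain N where N: "\<And>n. n \<ge> N \<Longrightarrow> dist (X n) z0 < r"
        using X(2) r(1) unfolding lim_sequentially by blast
      define Y where "Y n = X (n + N)" for n
      have Y: "Y n \<noteq> z0" "Y n \<in> ball z0 r" for n
        using X(1) N[of "n + N"] by (auto simp: Y_def dist_commute)
      have Yl: "Y \<longlonglongrightarrow> z0" unfolding Y_def by (rule LIMSEQ_ignore_initial_segment[OF X(2)])
      have Ym: "f (Y n) \<in> borel_measurable M" "f z0 \<in> borel_measurable M" for n
        using meas inS[of "Y n"] Y(2)[of n] r z0 by auto
      have lim: "(\<lambda>n. (f (Y n) x - f z0 x) / (Y n - z0)) \<longlonglongrightarrow> deriv (\<lambda>z. f z x) z0"
        if "x \<in> space M" for x
        using df[OF z0 that] Y Yl unfolding has_field_derivative_iff tendsto_at_iff_sequentially comp_def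
        by blast
      have m: "(\<lambda>x. deriv (\<lambda>z. f z x) z0) \<in> borel_measurable M"
        by (rule borel_measurable_LIMSEQ_metric[OF _ lim]) (use Ym in measurable)
      have "(\<lambda>n. integral\<^sup>L M (\<lambda>x. (f (Y n) x - f z0 x) / (Y n - z0)))
          \<longlonglongrightarrow> integral\<^sup>L M (\<lambda>x. deriv (\<lambda>z. f z x) z0)"
      proof (rule integral_dominated_convergence[where w = "\<lambda>x. D x / r"])
        show "AE x in M. norm ((f (Y n) x - f z0 x) / (Y n - z0)) \<le> D x / r" for n
          using quot Y by (intro AE_I2) blast
        show "(\<lambda>x. (f (Y n) x - f z0 x) / (Y n - z0)) \<in> borel_measurable M" for n
          using Ym by measurable
      qed (use m D lim in auto)
      moreover have "integral\<^sup>L M (\<lambda>x. (f (Y n) x - f z0 x) / (Y n - z0)) =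
          (integral\<^sup>L M (f (Y n)) - integral\<^sup>L M (f z0)) / (Y n - z0)" for n
        using int[of "Y n"] int[of z0] Y(2)[of n] r by simp
      ultimately have "(\<lambda>n. (integral\<^sup>L M (f (Y n)) - integral\<^sup>L M (f z0)) / (Y n - z0))
          \<longlonglongrightarrow> integral\<^sup>L M (\<lambda>x. deriv (\<lambda>z. f z x) z0)" by (simp only:)
      then show "(\<lambda>i. (integral\<^sup>L M (f (X i)) - integral\<^sup>L M (f z0)) / (X i - z0))
          \<longlonglongrightarrow> integral\<^sup>L M (\<lambda>x. deriv (\<lambda>z. f z x) z0)"
        unfolding Y_def by (rule LIMSEQ_offset)
    qed
    then show ?thesis unfolding has_field_derivative_iff by blast
  qed
  then show ?thesis
    using S by (auto simp: holomorphic_on_open)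
qed

abbreviation Im_strip :: "real \<Rightarrow> real \<Rightarrow> complex set" where
  "Im_strip l u \<equiv> {w. l < Im w \<and> Im w < u}"

lemma convex_Im_strip: "convex (Im_strip l u)"
proof -
  have "(Im_strip l u) = {w. \<i> \<bullet> w > l} \<inter> {w. \<i> \<bullet> w < u}"
    by (auto simp: inner_complex_def)
  then show ?thesis by (simp only: convex_Int convex_halfspace_gt convex_halfspace_lt)
qed

lemma open_Im_strip: "open (Im_strip l u)"
  by (intro open_Collect_conj open_Collect_less continuous_intros)

text \<open>
  The form of the identity theorem used throughout: formulas are compared on a short horizontal
  segment, which in the logarithmic coordinate is a piece of a ray.
\<close>

lemma holomorphic_eq_from_line:
  assumes "f holomorphic_on S" "g holomorphic_on S" "open S" "connected S"
    and z0: "z0 \<in> S" and e: "e > 0"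
    and eq: "\<And>w. w \<in> S \<Longrightarrow> Im w = Im z0 \<Longrightarrow> dist w z0 < e \<Longrightarrow> f w = g w" and w: "w \<in> S"
  shows "f w = g w"
proof -
  obtain d where d: "d > 0" "ball z0 d \<subseteq> S" using assms(3) z0 open_contains_ball by blast
  have "f w - g w = 0"
  proof (rule analytic_continuation[where S = S and U = "{w\<in>S. Im w = Im z0 \<and> dist w z0 < e}"
        and \<xi> = z0 and f = "\<lambda>w. f w - g w"])
    show "(\<lambda>w. f w - g w) holomorphic_on S" using assms by (intro holomorphic_intros)
    show "z0 islimpt {w\<in>S. Im w = Im z0 \<and> dist w z0 < e}"
      unfolding islimpt_approachable
    proof (intro allI impI)
      fix e' :: real assume "e' > 0"
      define m where "m = min e' (min d e) / 2"
      have m: "m > 0" "m < e'" "m < d" "m < e" using \<open>e' > 0\<close> d(1) e by (auto simp: m_def)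
      then have "z0 + of_real m \<in> S" using d(2) by (auto simp: subset_iff dist_norm)
      then show "\<exists>x'\<in>{w\<in>S. Im w = Im z0 \<and> dist w z0 < e}. x' \<noteq> z0 \<and> dist x' z0 < e'"
        using m by (intro bexI[of _ "z0 + of_real m"]) (auto simp: dist_norm)
    qed
  qed (use assms in auto)
  then show ?thesis by simp
qed

lemma set_integrable_exp_atLeast:
  fixes b c :: real
  assumes "c > 0"
  shows "set_integrable lborel {b..} (\<lambda>x. exp (- c * x))"
proof -
  have "(\<lambda>x. exp (- c * x)) integrable_on {b..}"
    using integrable_on_exp_minus_to_infinity[OF assms, of b] by simp
  then have "(\<lambda>x. exp (- c * x)) absolutely_integrable_on {b..}"
    by (intro nonnegative_absolutely_integrable_1) auto
  then show ?thesis
    unfolding set_integrable_def by (subst (asm) integrable_completion) auto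
qed

lemma set_integrable_dominated:
  fixes f :: "real \<Rightarrow> 'b::{banach, second_countable_topology}" and D :: "real \<Rightarrow> real"
  assumes "set_integrable lborel A D" "set_borel_measurable lborel A f"
    and "\<And>x. x \<in> A \<Longrightarrow> norm (f x) \<le> D x"
  shows "set_integrable lborel A f"
  using assms unfolding set_integrable_def set_borel_measurable_def
  by (elim Bochner_Integration.integrable_bound)
     (auto intro!: AE_I2 simp: indicator_def intro: order_trans[OF _ abs_ge_self])

lemma laplace_integrand_bound:
  fixes f :: complex
  assumes "norm f \<le> K * exp (c / 2 * t)" "c < Re (exp w)" "t \<ge> 0"
  shows "norm (exp (- exp w * of_real t) * f) \<le> K * exp (- (c / 2) * t)"
proof -
  have K: "K \<ge> 0" using order_trans[OF norm_ge_zero assms(1)] by (simp add: zero_le_mult_iff)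
  have "norm (exp (- exp w * of_real t) * f) \<le> exp (- c * t) * (K * exp (c / 2 * t))"
    unfolding norm_mult
  proof (rule mult_mono)
    have "Re (exp w) * t \<ge> c * t" using assms(2,3) by (intro mult_right_mono) auto
    then show "norm (exp (- exp w * of_real t)) \<le> exp (- c * t)" by simp
  qed (use assms in auto)
  also have "\<dots> = K * exp (- (c / 2) * t)" by (simp add: field_simps flip: exp_add)
  finally show ?thesis .
qed

lemma Re_exp_pos: "\<bar>Im w\<bar> < pi / 2 \<Longrightarrow> Re (exp w) > 0"
  by (auto simp: Re_exp intro!: mult_pos_pos cos_gt_zero_pi)

lemma set_integrable_laplace:
  fixes f :: "real \<Rightarrow> complex"
  assumes f: "set_borel_measurable lborel {0..} f"
    and growth: "\<And>\<epsilon>. \<epsilon> > 0 \<Longrightarrow> \<exists>K. \<forall>t\<ge>0. norm (f t) \<le> K * exp (\<epsilon> * t)"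
    and w: "\<bar>Im w\<bar> < pi / 2"
  shows "set_integrable lborel {0..} (\<lambda>t. exp (- exp w * of_real t) * f t)"
proof -
  define c where "c = Re (exp w) / 2"
  have c: "c > 0" "c < Re (exp w)" using Re_exp_pos[OF w] by (auto simp: c_def)
  obtain K where K: "\<And>t. t \<ge> 0 \<Longrightarrow> norm (f t) \<le> K * exp (c / 2 * t)" using growth[of "c / 2"] c by auto
  show ?thesis
  proof (rule set_integrable_dominated)
    show "set_integrable lborel {0..} (\<lambda>t. K * exp (- (c / 2) * t))"
      using set_integrable_exp_atLeast[of "c / 2" 0] c by (intro set_integrable_mult_right) auto
    have "(\<lambda>t. exp (- exp w * complex_of_real t)) \<in> borel_measurable borel"
      by (intro borel_measurable_continuous_onI continuous_intros)
    then have "(\<lambda>t. exp (- exp w * complex_of_real t) * (indicator {0..} t *\<^sub>R f t)) \<in> borel_measurable borel"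
      using f by (intro borel_measurable_times) (auto simp: set_borel_measurable_def)
    then show "set_borel_measurable lborel {0..} (\<lambda>t. exp (- exp w * of_real t) * f t)"
      by (simp add: set_borel_measurable_def)
  qed (use laplace_integrand_bound[OF K c(2)] in auto)
qed

lemma laplace_transform_holomorphic:
  fixes f :: "real \<Rightarrow> complex"
  assumes f: "set_borel_measurable lborel {0..} f"
    and growth: "\<And>\<epsilon>. \<epsilon> > 0 \<Longrightarrow> \<exists>K. \<forall>t\<ge>0. norm (f t) \<le> K * exp (\<epsilon> * t)"
  shows "(\<lambda>w. exp w * (LBINT t:{0..}. exp (- exp w * of_real t) * f t))
           holomorphic_on (Im_strip (- (pi / 2)) (pi / 2))"
proof -
  have "(\<lambda>w. integral\<^sup>L lborel (\<lambda>t. indicator {0..} t *\<^sub>R (exp (- exp w * of_real t) * f t)))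
      holomorphic_on (Im_strip (- (pi / 2)) (pi / 2))" (is "_ holomorphic_on ?S")
  proof (rule holomorphic_on_integral[OF open_Im_strip])
    fix w assume w: "w \<in> ?S"
    show "(\<lambda>t. indicator {0..} t *\<^sub>R (exp (- exp w * of_real t) * f t)) \<in> borel_measurable lborel"
      using set_integrable_laplace[OF f growth, of w] w by (auto simp: set_integrable_def abs_less_iff)
    define c where "c = Re (exp w) / 2"
    have c: "c > 0" "c < Re (exp w)" using Re_exp_pos[of w] w by (auto simp: c_def abs_less_iff)
    obtain K where K: "\<And>t. t \<ge> 0 \<Longrightarrow> norm (f t) \<le> K * exp (c / 2 * t)" using growth[of "c / 2"] c by auto
    have "open {y. c < Re (exp y)}" by (intro open_Collect_less continuous_intros)
    then obtain e where e: "e > 0" "ball w e \<subseteq> {y. c < Re (exp y)}"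
      using c(2) by (auto simp: open_contains_ball)
    have int: "integrable lborel (\<lambda>t. indicator {0..} t *\<^sub>R (K * exp (- (c / 2) * t)))"
      using set_integrable_mult_right[of K lborel "{0..}" "\<lambda>t. exp (- (c / 2) * t)"]
        set_integrable_exp_atLeast[of "c / 2" 0] c by (simp add: set_integrable_def)
    have "norm (indicator {0..} t *\<^sub>R (exp (- exp y * of_real t) * f t)) \<le>
        indicator {0..} t *\<^sub>R (K * exp (- (c / 2) * t))" if "dist w y < e" for y t
      using laplace_integrand_bound[OF K, of t y] e(2) that by (auto simp: indicator_def)
    then show "\<exists>e>0. \<exists>D. integrable lborel D \<and> (\<forall>y\<in>?S. dist w y < e \<longrightarrow>
        (\<forall>t\<in>space lborel. norm (indicator {0..} t *\<^sub>R (exp (- exp y * of_real t) * f t)) \<le> D t))"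
      using e(1) int by (intro exI[of _ e] conjI exI[of _ "\<lambda>t. indicator {0..} t *\<^sub>R (K * exp (- (c / 2) * t))"]) auto
  qed (intro holomorphic_intros)
  then show ?thesis unfolding set_lebesgue_integral_def by (intro holomorphic_intros)
qed

lemma connected_Im_strip: "connected (Im_strip l u)"
  using convex_Im_strip convex_connected by blast

section \<open>Continuation of the branches\<close>

text \<open>
  If the admissible germs form a local system, i.e. near every point they are the germs of one
  family of functions on a common neighbourhood, then continuation along a path exists:
  it exists on short pieces of the path, and pieces can be joined.
\<close>

lemma local_system_continuation:
  fixes good :: "complex \<Rightarrow> (complex \<Rightarrow> complex) \<Rightarrow> bool"
  assumes L: "\<And>z. z \<in> \<Omega> \<Longrightarrow> \<exists>V \<F>. open V \<and> z \<in> V \<and> (\<forall>h\<in>\<F>. h holomorphic_on V) \<and>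
      (\<forall>z'\<in>V. \<forall>f. good z' f \<longleftrightarrow> (\<exists>h\<in>\<F>. \<forall>\<^sub>F t in nhds z'. f t = h t))"
    and path: "path \<gamma>" "path_image \<gamma> \<subseteq> \<Omega>" and f: "good (\<gamma> 0) f"
  shows "\<exists>g. continuation_along \<gamma> f g \<and> good (\<gamma> 1) (g 1)"
proof -
  define cont where "cont x y f g \<longleftrightarrow>
      (\<forall>s\<in>{x..y}. g s analytic_on {\<gamma> s} \<and> good (\<gamma> s) (g s)) \<and>
      (\<forall>s\<in>{x..y}. \<forall>\<^sub>F s' in at s within {x..y}. \<forall>\<^sub>F t in nhds (\<gamma> s'). g s' t = g s t) \<and>
      (\<forall>\<^sub>F t in nhds (\<gamma> x). g x t = f t)"
    for x y :: real and f :: "complex \<Rightarrow> complex" and g :: "real \<Rightarrow> complex \<Rightarrow> complex"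
  define P where "P x y \<longleftrightarrow> (x \<le> y \<longrightarrow> 0 \<le> x \<longrightarrow> y \<le> 1 \<longrightarrow> (\<forall>f. good (\<gamma> x) f \<longrightarrow> (\<exists>g. cont x y f g)))"
    for x y
  have near: "\<exists>d>0. \<forall>s'. s' \<in> {x..y} \<longrightarrow> s' \<noteq> s \<longrightarrow> dist s' s < d \<longrightarrow> (\<forall>\<^sub>F t in nhds (\<gamma> s'). g s' t = g s t)"
    if "cont x y f g" "s \<in> {x..y}" for x y f g s
  proof -
    have "\<forall>\<^sub>F s' in at s within {x..y}. \<forall>\<^sub>F t in nhds (\<gamma> s'). g s' t = g s t"
      using that unfolding cont_def by blast
    then show ?thesis unfolding eventually_at by blast
  qed
  have c\<gamma>: "continuous_on {0..1} \<gamma>" using path(1) by (simp add: path_def)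
  have "P 0 1"
  proof (rule Bolzano)
    fix x y z :: real assume P1: "P x y" and P2: "P y z" and le: "x \<le> y" "y \<le> z"
    show "P x z"
      unfolding P_def
    proof (intro impI allI)
      fix f assume b: "0 \<le> x" "z \<le> 1" and f: "good (\<gamma> x) f"
      obtain g1 where g1: "cont x y f g1" using P1 f b le by (auto simp: P_def)
      then have "good (\<gamma> y) (g1 y)" using le by (auto simp: cont_def)
      then obtain g2 where g2: "cont y z (g1 y) g2" using P2 b le by (auto simp: P_def)
      define g where "g s = (if s \<le> y then g1 s else g2 s)" for s
      have "\<forall>\<^sub>F s' in at s within {x..z}. \<forall>\<^sub>F t in nhds (\<gamma> s'). g s' t = g s t" if s: "s \<in> {x..z}" for s
      proof -
        consider "s < y" | "s > y" | "s = y" by linarith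
        then show ?thesis
        proof cases
          case 1
          then obtain d where d: "d > 0" "\<And>s'. s' \<in> {x..y} \<Longrightarrow> s' \<noteq> s \<Longrightarrow> dist s' s < d \<Longrightarrow>
              \<forall>\<^sub>F t in nhds (\<gamma> s'). g1 s' t = g1 s t"
            using near[OF g1, of s] s by auto
          then show ?thesis using 1
            unfolding eventually_at by (intro exI[of _ "min d (y - s)"]) (auto simp: g_def dist_real_def)
        next
          case 2
          then obtain d where d: "d > 0" "\<And>s'. s' \<in> {y..z} \<Longrightarrow> s' \<noteq> s \<Longrightarrow> dist s' s < d \<Longrightarrow>
              \<forall>\<^sub>F t in nhds (\<gamma> s'). g2 s' t = g2 s t"
            using near[OF g2, of s] s by auto
          then show ?thesis using 2
            unfolding eventually_at by (intro exI[of _ "min d (s - y)"]) (auto simp: g_def dist_real_def)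
        next
          case 3
          obtain d1 where d1: "d1 > 0" "\<And>s'. s' \<in> {x..y} \<Longrightarrow> s' \<noteq> y \<Longrightarrow> dist s' y < d1 \<Longrightarrow>
              \<forall>\<^sub>F t in nhds (\<gamma> s'). g1 s' t = g1 y t"
            using near[OF g1, of y] le by auto
          obtain d2 where d2: "d2 > 0" "\<And>s'. s' \<in> {y..z} \<Longrightarrow> s' \<noteq> y \<Longrightarrow> dist s' y < d2 \<Longrightarrow>
              \<forall>\<^sub>F t in nhds (\<gamma> s'). g2 s' t = g2 y t"
            using near[OF g2, of y] le by auto
          have "\<forall>\<^sub>F u in nhds (\<gamma> y). \<forall>\<^sub>F t in nhds u. g2 y t = g1 y t"
            using g2 unfolding cont_def by (simp add: eventually_eventually)
          moreover have "(\<gamma> \<longlongrightarrow> \<gamma> y) (at y within {x..z})"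
            using continuous_on_subset[OF c\<gamma>, of "{x..z}"] b le by (auto simp: continuous_on_def)
          ultimately have "\<forall>\<^sub>F s' in at y within {x..z}. \<forall>\<^sub>F t in nhds (\<gamma> s'). g2 y t = g1 y t"
            unfolding filterlim_iff by blast
          then obtain d3 where d3: "d3 > 0" "\<And>s'. s' \<in> {x..z} \<Longrightarrow> s' \<noteq> y \<Longrightarrow> dist s' y < d3 \<Longrightarrow>
              \<forall>\<^sub>F t in nhds (\<gamma> s'). g2 y t = g1 y t"
            unfolding eventually_at by auto
          have "\<forall>\<^sub>F t in nhds (\<gamma> s'). g s' t = g y t"
            if s': "s' \<in> {x..z}" "s' \<noteq> y" "dist s' y < min d1 (min d2 d3)" for s'
          proof (cases "s' \<le> y")
            case True
            then show ?thesis using d1(2)[of s'] s' by (auto simp: g_def)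
          next
            case False
            have "\<forall>\<^sub>F t in nhds (\<gamma> s'). g2 s' t = g2 y t" "\<forall>\<^sub>F t in nhds (\<gamma> s'). g2 y t = g1 y t"
              using d2(2)[of s'] d3(2)[of s'] s' False by auto
            then show ?thesis by eventually_elim (use False in \<open>auto simp: g_def\<close>)
          qed
          then show ?thesis using d1(1) d2(1) d3(1) 3
            unfolding eventually_at by (intro exI[of _ "min d1 (min d2 d3)"]) auto
        qed
      qed
      moreover have "\<forall>s\<in>{x..z}. g s analytic_on {\<gamma> s} \<and> good (\<gamma> s) (g s)"
        using g1 g2 by (auto simp: cont_def g_def)
      moreover have "\<forall>\<^sub>F t in nhds (\<gamma> x). g x t = f t"
        using g1 le by (auto simp: cont_def g_def)
      ultimately show "\<exists>g. cont x z f g" unfolding cont_def by blast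
    qed
  next
    fix x :: real assume x: "0 \<le> x" "x \<le> 1"
    then have "\<gamma> x \<in> \<Omega>" using path(2) by (auto simp: path_image_def)
    from L[OF this] obtain V \<F> where VF: "open V \<and> \<gamma> x \<in> V \<and> (\<forall>h\<in>\<F>. h holomorphic_on V) \<and>
        (\<forall>z'\<in>V. \<forall>f. good z' f \<longleftrightarrow> (\<exists>h\<in>\<F>. \<forall>\<^sub>F t in nhds z'. f t = h t))"
      by (elim exE) (rule that)
    have V: "open V" "\<gamma> x \<in> V" "\<And>h. h \<in> \<F> \<Longrightarrow> h holomorphic_on V"
      using VF by simp_all
    have good: "good z' f \<longleftrightarrow> (\<exists>h\<in>\<F>. \<forall>\<^sub>F t in nhds z'. f t = h t)" if "z' \<in> V" for z' f
      by (rule VF[THEN conjunct2, THEN conjunct2, THEN conjunct2, THEN bspec, OF that, THEN spec])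
    obtain e where e: "e > 0" "ball (\<gamma> x) e \<subseteq> V" using V open_contains_ball by blast
    obtain d where d: "d > 0" "\<And>s. s \<in> {0..1} \<Longrightarrow> dist s x < d \<Longrightarrow> dist (\<gamma> s) (\<gamma> x) < e"
      using c\<gamma> e(1) x unfolding continuous_on_iff by (metis atLeastAtMost_iff)
    have inV: "\<gamma> s \<in> V" if "s \<in> {0..1}" "dist s x < d" for s
      using d(2)[OF that] e(2) by (auto simp: dist_commute)
    have "P u v" if uv: "u \<le> x \<and> x \<le> v \<and> v - u < d" for u v
      unfolding P_def
    proof (intro impI allI)
      fix f assume b: "u \<le> v" "0 \<le> u" "v \<le> 1" and f: "good (\<gamma> u) f"
      have inV': "\<gamma> s \<in> V" if "s \<in> {u..v}" for s
        using that uv b by (intro inV) (auto simp: dist_real_def)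
      have "\<gamma> u \<in> V" using inV'[of u] b by auto
      from good[OF this, THEN iffD1, OF f]
      obtain h where h: "h \<in> \<F>" "\<forall>\<^sub>F t in nhds (\<gamma> u). f t = h t" by (elim bexE) (rule that)
      have "\<forall>\<^sub>F t in nhds (\<gamma> u). h t = f t" using h(2) by eventually_elim simp
      moreover have "h analytic_on {\<gamma> s}" if "s \<in> {u..v}" for s
        using V h(1) inV'[OF that] by (meson analytic_at)
      moreover have "good (\<gamma> s) h" if "s \<in> {u..v}" for s
        by (rule good[OF inV'[OF that], THEN iffD2]) (rule bexI[OF _ h(1)], simp)
      ultimately have "cont u v f (\<lambda>_. h)" unfolding cont_def by simp
      then show "\<exists>g. cont u v f g" by blast
    qed
    then show "\<exists>d>0. \<forall>u v. u \<le> x \<and> x \<le> v \<and> v - u < d \<longrightarrow> P u v" using d(1) by blast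
  qed simp
  then obtain g where "cont 0 1 f g" using f by (auto simp: P_def)
  then show ?thesis unfolding cont_def continuation_along_def by auto
qed

lemma cut_plane_iff: "t \<in> cut_plane a \<longleftrightarrow> Im t \<noteq> 0 \<or> Re t > - a"
  by (auto simp: cut_plane_def complex_eq_iff image_iff)

lemma open_cut_plane: "open (cut_plane a)"
proof -
  have "cut_plane a = {t. Im t \<noteq> 0} \<union> {t. Re t > - a}" by (auto simp: cut_plane_iff)
  moreover have "open {t. Im t \<noteq> 0}" by (intro open_Collect_neq continuous_intros)
  ultimately show ?thesis by (simp add: open_Un open_halfspace_Re_gt)
qed

lemma mem_sector_iff:
  assumes "a > 0"
  shows "w \<in> sector a \<alpha> \<beta> \<longleftrightarrow> ln a < Re w \<and> \<alpha> < Im w \<and> Im w < \<beta>"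
proof -
  have "ln a < Re w \<longleftrightarrow> a < exp (Re w)" using assms by (metis exp_less_cancel_iff exp_ln)
  then show ?thesis by (simp add: sector_def)
qed

text \<open>
  Passing from one sheet of the logarithm to the next changes one of the two coefficients of a
  branch with respect to \<open>F(t)\<close> and \<open>F(- a - t)\<close>.  Listing the new coefficients in the order of the
  sheets gives a sequence of this kind; two neighbouring terms are the data of one sheet.
\<close>

lemma two_sided_recurrence:
  fixes T p q :: complex
  shows "\<exists>x :: int \<Rightarrow> complex. x k = p \<and> x (k - 1) = q \<and> (\<forall>j. x (j + 1) = x (j - 1) - T * x j)"
proof -
  define u where "u n = fst (((\<lambda>(y, z). (z, y - T * z)) ^^ n) (q, p))" for n :: nat
  define d where "d n = fst (((\<lambda>(y, z). (z, y + T * z)) ^^ n) (p, q))" for n :: nat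
  have u: "u 0 = q" "u (Suc 0) = p" "u (Suc (Suc n)) = u n - T * u (Suc n)" for n
    by (simp_all add: u_def case_prod_beta)
  have d: "d 0 = p" "d (Suc 0) = q" "d (Suc (Suc n)) = d n + T * d (Suc n)" for n
    by (simp_all add: d_def case_prod_beta)
  define x where "x j = (if j \<ge> k - 1 then u (nat (j - k + 1)) else d (nat (k - j)))" for j
  have "x (j + 1) = x (j - 1) - T * x j" for j
  proof -
    consider "j \<ge> k" | "j = k - 1" | "j = k - 2" | "j < k - 2" by linarith
    then show ?thesis
    proof cases
      case 1
      then have "nat (j + 1 - k + 1) = Suc (Suc (nat (j - k)))" "nat (j - k + 1) = Suc (nat (j - k))"
        by auto
      with 1 show ?thesis by (simp add: x_def u(3))
    next
      case 2
      then show ?thesis by (simp add: x_def u d numeral_2_eq_2 numeral_3_eq_3)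
    next
      case 3
      then show ?thesis by (simp add: x_def u d numeral_2_eq_2 numeral_3_eq_3)
    next
      case 4
      then have "nat (k - (j - 1)) = Suc (Suc (nat (k - (j + 1))))" "nat (k - j) = Suc (nat (k - (j + 1)))"
        by auto
      with 4 show ?thesis by (simp add: x_def d(3))
    qed
  qed
  moreover have "x k = p" "x (k - 1) = q" by (simp_all add: x_def u)
  ultimately show ?thesis by blast
qed

text \<open>
  \<open>B\<close> is the continuation of \<open>F\<close> from the lower half plane across \<open>(-\<infinity>, - a)\<close>; its value in the
  upper half plane is dictated by the jump condition.  Since \<open>B\<close> is defined only off \<open>[- a, \<infinity>)\<close>,
  its growth matters on the closed lower half plane, the banks included.
\<close>

locale two_branches =
  fixes a :: real and T :: complex and F B :: "complex \<Rightarrow> complex"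
  assumes a: "a > 0"
    and F_hol: "F holomorphic_on cut_plane a"
    and B_hol: "B holomorphic_on {t. Im t \<noteq> 0 \<or> Re t < - a}"
    and B_lower: "\<And>t. Im t < 0 \<Longrightarrow> B t = F t"
    and B_upper: "\<And>t. Im t > 0 \<Longrightarrow> B t = F t + T * F (- of_real a - t)"
    and F_growth: "\<And>\<epsilon>. \<epsilon> > 0 \<Longrightarrow> \<exists>K R. \<forall>t\<in>cut_plane a. R \<le> norm t \<longrightarrow>
        norm (F t) \<le> K * exp (\<epsilon> * norm t)"
    and B_growth: "\<And>\<epsilon>. \<epsilon> > 0 \<Longrightarrow> \<exists>K R. \<forall>t. Im t \<le> 0 \<and> (Im t \<noteq> 0 \<or> Re t < - a) \<and> R \<le> norm t \<longrightarrow>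
        norm (B t) \<le> K * exp (\<epsilon> * norm t)"
begin

definition \<sigma> :: "complex \<Rightarrow> complex" where "\<sigma> t = - of_real a - t"

lemma \<sigma>_simps [simp]: "Re (\<sigma> t) = - a - Re t" "Im (\<sigma> t) = - Im t"
  by (simp_all add: \<sigma>_def)

lemma \<sigma>_hol [holomorphic_intros]: "f holomorphic_on A \<Longrightarrow> (\<lambda>t. \<sigma> (f t)) holomorphic_on A"
  unfolding \<sigma>_def by (intro holomorphic_intros)

lemma F_comp: "f holomorphic_on A \<Longrightarrow> (\<And>t. t \<in> A \<Longrightarrow> Im (f t) \<noteq> 0 \<or> Re (f t) > - a) \<Longrightarrow>
    (\<lambda>t. F (f t)) holomorphic_on A"
  using holomorphic_on_compose_gen[OF _ F_hol, of f A] by (auto simp: comp_def image_subset_iff cut_plane_iff)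

lemma B_comp: "f holomorphic_on A \<Longrightarrow> (\<And>t. t \<in> A \<Longrightarrow> Im (f t) \<noteq> 0 \<or> Re (f t) < - a) \<Longrightarrow>
    (\<lambda>t. B (f t)) holomorphic_on A"
  using holomorphic_on_compose_gen[OF _ B_hol, of f A] by (auto simp: comp_def)

text \<open>
  A basis of the branches near \<open>z\<close>.  Away from the real line it consists of \<open>F(t)\<close> and \<open>F(- a - t)\<close>;
  on the two outer intervals the member that has its cut there is replaced by its continuation.
\<close>

definition phi :: "complex \<Rightarrow> complex \<Rightarrow> complex" where
  "phi z t = (if Im z = 0 \<and> Re z < - a then B t else F t)"

definition psi :: "complex \<Rightarrow> complex \<Rightarrow> complex" where
  "psi z t = (if Im z = 0 \<and> Re z > 0 then B (\<sigma> t) else F (\<sigma> t))"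

definition branch_germ :: "complex \<Rightarrow> (complex \<Rightarrow> complex) \<Rightarrow> bool" where
  "branch_germ z f \<longleftrightarrow> (\<exists>\<alpha> \<beta>. \<forall>\<^sub>F t in nhds z. f t = \<alpha> * phi z t + \<beta> * psi z t)"

text \<open>
  Crossing the real line changes the basis by a triangular matrix, which does not affect the span.
\<close>

lemma change_basis:
  fixes p q p' q' :: "complex \<Rightarrow> complex"
  assumes "\<forall>\<^sub>F t in nhds z. p' t = p t + c * q t" "\<forall>\<^sub>F t in nhds z. q' t = q t"
  shows "(\<exists>\<alpha> \<beta>. \<forall>\<^sub>F t in nhds z. f t = \<alpha> * p t + \<beta> * q t) \<longleftrightarrow>
         (\<exists>\<alpha> \<beta>. \<forall>\<^sub>F t in nhds z. f t = \<alpha> * p' t + \<beta> * q' t)"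
proof
  assume "\<exists>\<alpha> \<beta>. \<forall>\<^sub>F t in nhds z. f t = \<alpha> * p t + \<beta> * q t"
  then obtain \<alpha> \<beta> where "\<forall>\<^sub>F t in nhds z. f t = \<alpha> * p t + \<beta> * q t" by blast
  then have "\<forall>\<^sub>F t in nhds z. f t = \<alpha> * p' t + (\<beta> - c * \<alpha>) * q' t"
    using assms by eventually_elim (simp add: algebra_simps)
  then show "\<exists>\<alpha> \<beta>. \<forall>\<^sub>F t in nhds z. f t = \<alpha> * p' t + \<beta> * q' t" by blast
next
  assume "\<exists>\<alpha> \<beta>. \<forall>\<^sub>F t in nhds z. f t = \<alpha> * p' t + \<beta> * q' t"
  then obtain \<alpha> \<beta> where "\<forall>\<^sub>F t in nhds z. f t = \<alpha> * p' t + \<beta> * q' t" by blast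
  then have "\<forall>\<^sub>F t in nhds z. f t = \<alpha> * p t + (\<beta> + c * \<alpha>) * q t"
    using assms by eventually_elim (simp add: algebra_simps)
  then show "\<exists>\<alpha> \<beta>. \<forall>\<^sub>F t in nhds z. f t = \<alpha> * p t + \<beta> * q t" by blast
qed

lemma change_basis':
  fixes p q p' q' :: "complex \<Rightarrow> complex"
  assumes "\<forall>\<^sub>F t in nhds z. p' t = p t" "\<forall>\<^sub>F t in nhds z. q' t = q t + c * p t"
  shows "(\<exists>\<alpha> \<beta>. \<forall>\<^sub>F t in nhds z. f t = \<alpha> * p t + \<beta> * q t) \<longleftrightarrow>
         (\<exists>\<alpha> \<beta>. \<forall>\<^sub>F t in nhds z. f t = \<alpha> * p' t + \<beta> * q' t)"
proof -
  have swap: "(\<exists>\<alpha> \<beta>. \<forall>\<^sub>F t in nhds z. f t = \<alpha> * u t + \<beta> * v t) \<longleftrightarrow>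
      (\<exists>\<beta> \<alpha>. \<forall>\<^sub>F t in nhds z. f t = \<beta> * v t + \<alpha> * u t)" for u v
    by (subst ex_comm) (simp only: add.commute)
  show ?thesis
    unfolding swap[of p q] swap[of p' q'] by (rule change_basis[OF assms(2,1)])
qed

lemma near_Im:
  shows "Im z > 0 \<Longrightarrow> \<forall>\<^sub>F t in nhds z. Im t > 0" "Im z < 0 \<Longrightarrow> \<forall>\<^sub>F t in nhds z. Im t < 0"
  using eventually_nhds_in_open[OF open_halfspace_Im_gt[of 0], of z]
    eventually_nhds_in_open[OF open_halfspace_Im_lt[of 0], of z] by auto

lemma germ_pos:
  assumes "Re z > 0"
  shows "branch_germ z f \<longleftrightarrow> (\<exists>\<alpha> \<beta>. \<forall>\<^sub>F t in nhds z. f t = \<alpha> * F t + \<beta> * B (\<sigma> t))"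
proof -
  consider "Im z = 0" | "Im z > 0" | "Im z < 0" by linarith
  then show ?thesis
  proof cases
    case 2
    have "\<forall>\<^sub>F t in nhds z. B (\<sigma> t) = F (\<sigma> t) + 0 * F t"
      using near_Im(1)[OF 2] by eventually_elim (simp add: B_lower)
    from change_basis'[where p = F and p' = F, OF _ this, of f] have *: "(\<exists>\<alpha> \<beta>. \<forall>\<^sub>F t in nhds z. f t = \<alpha> * F t + \<beta> * F (\<sigma> t)) \<longleftrightarrow>
      (\<exists>\<alpha> \<beta>. \<forall>\<^sub>F t in nhds z. f t = \<alpha> * F t + \<beta> * B (\<sigma> t))" by (simp only: refl always_eventually simp_thms)
    show ?thesis unfolding *[symmetric]
      using 2 by (simp add: branch_germ_def phi_def psi_def)
  next
    case 3
    have "\<forall>\<^sub>F t in nhds z. B (\<sigma> t) = F (\<sigma> t) + T * F t"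
      using near_Im(2)[OF 3]
    proof eventually_elim
      case (elim t)
      then show ?case using B_upper[of "\<sigma> t"] by (simp add: \<sigma>_def)
    qed
    from change_basis'[where p = F and p' = F, OF _ this, of f] have *: "(\<exists>\<alpha> \<beta>. \<forall>\<^sub>F t in nhds z. f t = \<alpha> * F t + \<beta> * F (\<sigma> t)) \<longleftrightarrow>
      (\<exists>\<alpha> \<beta>. \<forall>\<^sub>F t in nhds z. f t = \<alpha> * F t + \<beta> * B (\<sigma> t))" by (simp only: refl always_eventually simp_thms)
    show ?thesis unfolding *[symmetric]
      using 3 by (simp add: branch_germ_def phi_def psi_def)
  next
    case 1
    then have c: "\<not> (Im z = 0 \<and> Re z < - a)" "Im z = 0 \<and> Re z > 0" using assms a by auto
    show ?thesis unfolding branch_germ_def phi_def psi_def if_not_P[OF c(1)] if_P[OF c(2)] by (rule refl)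
  qed
qed

lemma germ_neg:
  assumes "Re z < - a"
  shows "branch_germ z f \<longleftrightarrow> (\<exists>\<alpha> \<beta>. \<forall>\<^sub>F t in nhds z. f t = \<alpha> * B t + \<beta> * F (\<sigma> t))"
proof -
  consider "Im z = 0" | "Im z > 0" | "Im z < 0" by linarith
  then show ?thesis
  proof cases
    case 2
    have "\<forall>\<^sub>F t in nhds z. B t = F t + T * F (\<sigma> t)"
      using near_Im(1)[OF 2] by eventually_elim (simp add: B_upper \<sigma>_def)
    from change_basis[where q = "\<lambda>t. F (\<sigma> t)" and q' = "\<lambda>t. F (\<sigma> t)", OF this, of f] have *: "(\<exists>\<alpha> \<beta>. \<forall>\<^sub>F t in nhds z. f t = \<alpha> * F t + \<beta> * F (\<sigma> t)) \<longleftrightarrow>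
      (\<exists>\<alpha> \<beta>. \<forall>\<^sub>F t in nhds z. f t = \<alpha> * B t + \<beta> * F (\<sigma> t))" by (simp only: refl always_eventually simp_thms)
    show ?thesis unfolding *[symmetric]
      using 2 by (simp add: branch_germ_def phi_def psi_def)
  next
    case 3
    have "\<forall>\<^sub>F t in nhds z. B t = F t + 0 * F (\<sigma> t)"
      using near_Im(2)[OF 3] by eventually_elim (simp add: B_lower)
    from change_basis[where q = "\<lambda>t. F (\<sigma> t)" and q' = "\<lambda>t. F (\<sigma> t)", OF this, of f] have *: "(\<exists>\<alpha> \<beta>. \<forall>\<^sub>F t in nhds z. f t = \<alpha> * F t + \<beta> * F (\<sigma> t)) \<longleftrightarrow>
      (\<exists>\<alpha> \<beta>. \<forall>\<^sub>F t in nhds z. f t = \<alpha> * B t + \<beta> * F (\<sigma> t))" by (simp only: refl always_eventually simp_thms)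
    show ?thesis unfolding *[symmetric]
      using 3 by (simp add: branch_germ_def phi_def psi_def)
  next
    case 1
    then have c: "Im z = 0 \<and> Re z < - a" "\<not> (Im z = 0 \<and> Re z > 0)" using assms a by auto
    show ?thesis unfolding branch_germ_def phi_def psi_def if_P[OF c(1)] if_not_P[OF c(2)] by (rule refl)
  qed
qed

lemma germ_mid:
  assumes "Im z \<noteq> 0 \<or> - a \<le> Re z \<and> Re z \<le> 0"
  shows "branch_germ z f \<longleftrightarrow> (\<exists>\<alpha> \<beta>. \<forall>\<^sub>F t in nhds z. f t = \<alpha> * F t + \<beta> * F (\<sigma> t))"
proof -
  have "\<not> (Im z = 0 \<and> Re z < - a)" "\<not> (Im z = 0 \<and> Re z > 0)" using assms a by auto
  then show ?thesis by (simp only: branch_germ_def phi_def psi_def if_False)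
qed

lemma germ_chart:
  assumes "open V" "z \<in> V" "p holomorphic_on V" "q holomorphic_on V"
    and "\<And>z' f. z' \<in> V \<Longrightarrow> branch_germ z' f \<longleftrightarrow> (\<exists>\<alpha> \<beta>. \<forall>\<^sub>F t in nhds z'. f t = \<alpha> * p t + \<beta> * q t)"
  shows "\<exists>V \<F>. open V \<and> z \<in> V \<and> (\<forall>h\<in>\<F>. h holomorphic_on V) \<and>
      (\<forall>z'\<in>V. \<forall>f. branch_germ z' f \<longleftrightarrow> (\<exists>h\<in>\<F>. \<forall>\<^sub>F t in nhds z'. f t = h t))"
proof -
  define g where "g \<alpha> \<beta> t = \<alpha> * p t + \<beta> * q t" for \<alpha> \<beta> t
  have g: "g \<alpha> \<beta> holomorphic_on V" for \<alpha> \<beta>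
    unfolding g_def[abs_def] using assms(3,4) by (intro holomorphic_intros)
  have iff: "(\<exists>h\<in>{h. \<exists>\<alpha> \<beta>. h = g \<alpha> \<beta>}. Q h) \<longleftrightarrow> (\<exists>\<alpha> \<beta>. Q (g \<alpha> \<beta>))" for Q by blast
  show ?thesis
  proof (intro exI[of _ V] exI[of _ "{h. \<exists>\<alpha> \<beta>. h = g \<alpha> \<beta>}"] conjI ballI allI)
    show "h holomorphic_on V" if "h \<in> {h. \<exists>\<alpha> \<beta>. h = g \<alpha> \<beta>}" for h using that g by blast
    show "branch_germ z' f \<longleftrightarrow> (\<exists>h\<in>{h. \<exists>\<alpha> \<beta>. h = g \<alpha> \<beta>}. \<forall>\<^sub>F t in nhds z'. f t = h t)" if "z' \<in> V" for z' f
      unfolding iff assms(5)[OF that] g_def by (rule refl)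
  qed (use assms in auto)
qed

lemma branch_germ_local:
  assumes "z \<noteq> 0" "z \<noteq> - of_real a"
  shows "\<exists>V \<F>. open V \<and> z \<in> V \<and> (\<forall>h\<in>\<F>. h holomorphic_on V) \<and>
      (\<forall>z'\<in>V. \<forall>f. branch_germ z' f \<longleftrightarrow> (\<exists>h\<in>\<F>. \<forall>\<^sub>F t in nhds z'. f t = h t))"
proof -
  consider "Re z > 0" | "Re z < - a" | "Im z \<noteq> 0 \<or> - a < Re z \<and> Re z < 0"
    using assms a by (fastforce simp: complex_eq_iff)
  then show ?thesis
  proof cases
    case 1
    have h: "F holomorphic_on {t. Re t > 0}" "(\<lambda>t. B (\<sigma> t)) holomorphic_on {t. Re t > 0}"
      using a by (auto intro!: F_comp B_comp holomorphic_intros)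
    show ?thesis
    proof (rule germ_chart[OF open_halfspace_Re_gt _ h])
      show "z \<in> {t. Re t > 0}" using 1 by simp
    qed (rule germ_pos, simp)
  next
    case 2
    have h: "B holomorphic_on {t. Re t < - a}" "(\<lambda>t. F (\<sigma> t)) holomorphic_on {t. Re t < - a}"
      using a by (auto intro!: F_comp B_comp holomorphic_intros)
    show ?thesis
    proof (rule germ_chart[OF open_halfspace_Re_lt _ h])
      show "z \<in> {t. Re t < - a}" using 2 by simp
    qed (rule germ_neg, simp)
  next
    case 3
    let ?V = "{t. Im t \<noteq> 0 \<or> - a < Re t \<and> Re t < 0}"
    have V: "open ?V"
      by (intro open_Collect_disj open_Collect_conj open_Collect_neq open_Collect_less continuous_intros)
    have h: "F holomorphic_on ?V" "(\<lambda>t. F (\<sigma> t)) holomorphic_on ?V"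
      by (auto intro!: holomorphic_intros F_comp)
    show ?thesis
    proof (rule germ_chart[OF V _ h])
      show "z \<in> ?V" using 3 by simp
    qed (rule germ_mid, auto)
  qed
qed

lemma continuation_exists:
  assumes "admissible_path a \<gamma>"
  shows "\<exists>g. continuation_along \<gamma> F g \<and> branch_germ (\<gamma> 1) (g 1)"
proof (rule local_system_continuation)
  show "path \<gamma>" "path_image \<gamma> \<subseteq> - {0, - of_real a}" using assms by (auto simp: admissible_path_def)
  have "Im (\<gamma> 0) \<noteq> 0 \<or> Re (\<gamma> 0) > - a"
    using assms by (auto simp: admissible_path_def cut_plane_iff pathstart_def)
  then have "phi (\<gamma> 0) = F" by (auto simp: phi_def fun_eq_iff)
  then show "branch_germ (\<gamma> 0) F"
    unfolding branch_germ_def by (intro exI[of _ 1] exI[of _ 0]) simp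
next
  fix z assume "z \<in> - {0, - complex_of_real a}"
  then have "z \<noteq> 0" "z \<noteq> - of_real a" by auto
  then show "\<exists>V \<F>. open V \<and> z \<in> V \<and> (\<forall>h\<in>\<F>. h holomorphic_on V) \<and>
      (\<forall>z'\<in>V. \<forall>f. branch_germ z' f \<longleftrightarrow> (\<exists>h\<in>\<F>. \<forall>\<^sub>F t in nhds z'. f t = h t))"
    by (rule branch_germ_local)
qed

text \<open>
  The branch on the two neighbouring half sheets \<open>(k - 1) \<pi> < Im w < (k + 1) \<pi>\<close> with coefficients
  \<open>x k\<close> and \<open>x (k - 1)\<close>.  For even \<open>k\<close> the line between the half sheets lies over the positive axis,
  where \<open>F(- a - t)\<close> has its cut, and for odd \<open>k\<close> over the negative axis, where \<open>F\<close> has its cut.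
\<close>

definition strip_branch :: "(int \<Rightarrow> complex) \<Rightarrow> int \<Rightarrow> complex \<Rightarrow> complex" where
  "strip_branch x k w = (if even k then x k * F (exp w) + x (k - 1) * B (\<sigma> (exp w))
     else x k * F (\<sigma> (exp w)) + x (k - 1) * B (exp w))"

lemma exp_sheet:
  "exp w = (if even k then exp (w - of_int k * of_real pi * \<i>) else - exp (w - of_int k * of_real pi * \<i>))"
proof -
  have e: "exp w = exp (w - of_int k * of_real pi * \<i>) * exp (of_int k * (of_real pi * \<i>))"
    by (simp flip: exp_add)
  have "exp (of_int k * (of_real pi * \<i>)) = (if even k then 1 else -1 :: complex)"
  proof (cases "even k")
    case True
    then obtain m where "k = 2 * m" by blast
    then show ?thesis using exp_integer_2pi[of "of_int m"] by (simp add: mult_ac)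
  next
    case False
    then obtain m where "k = 2 * m + 1" by (elim oddE)
    then show ?thesis using exp_integer_2pi_plus1[of "of_int m"] by (simp add: algebra_simps)
  qed
  with e show ?thesis by auto
qed

lemma exp_near_axis:
  assumes "\<bar>Im v\<bar> < pi"
  shows "Im v > 0 \<Longrightarrow> Im (exp v) > 0" "Im v < 0 \<Longrightarrow> Im (exp v) < 0"
    "Im v = 0 \<Longrightarrow> Im (exp v) = 0 \<and> Re (exp v) = exp (Re v)"
  using assms sin_gt_zero[of "Im v"] sin_gt_zero[of "- Im v"]
  by (auto simp: Im_exp Re_exp mult_pos_neg)

lemma ln_a_less: "ln a < x \<longleftrightarrow> a < exp x"
  using a by (metis exp_less_cancel_iff exp_ln)

definition double_strip :: "int \<Rightarrow> complex set" where
  "double_strip k = {w. ln a < Re w \<and> (of_int k - 1) * pi < Im w \<and> Im w < (of_int k + 1) * pi}"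

lemma double_strip_sheet:
  assumes "w \<in> double_strip k"
  defines "v \<equiv> w - of_int k * of_real pi * \<i>"
  shows "\<bar>Im v\<bar> < pi" "exp (Re v) > a" "Im v = Im w - of_int k * pi"
proof -
  show v: "Im v = Im w - of_int k * pi" by (simp add: v_def)
  show "\<bar>Im v\<bar> < pi" using assms(1) unfolding v double_strip_def by (auto simp: algebra_simps abs_less_iff)
  have "Re v = Re w" by (simp add: v_def)
  then show "exp (Re v) > a" using assms(1) a by (simp add: double_strip_def ln_a_less)
qed

lemma double_strip_even:
  assumes "w \<in> double_strip k" "even k"
  shows "Im w > of_int k * pi \<Longrightarrow> Im (exp w) > 0" "Im w < of_int k * pi \<Longrightarrow> Im (exp w) < 0"
    "Im w = of_int k * pi \<Longrightarrow> Im (exp w) = 0" "Im (exp w) \<noteq> 0 \<or> Re (exp w) > a"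
proof -
  note v = double_strip_sheet[OF assms(1)]
  note e = exp_near_axis[OF v(1)]
  have E: "exp w = exp (w - of_int k * of_real pi * \<i>)" using exp_sheet[of w k] assms(2) by simp
  show "Im w > of_int k * pi \<Longrightarrow> Im (exp w) > 0" using e(1) v(3) unfolding E by simp
  show "Im w < of_int k * pi \<Longrightarrow> Im (exp w) < 0" using e(2) v(3) unfolding E by simp
  show "Im w = of_int k * pi \<Longrightarrow> Im (exp w) = 0" using e(3) v(3) unfolding E by simp
  show "Im (exp w) \<noteq> 0 \<or> Re (exp w) > a"
    using e v by (cases "Im (w - of_int k * of_real pi * \<i>)" "0 :: real" rule: linorder_cases) (simp_all add: E)
qed

lemma double_strip_odd:
  assumes "w \<in> double_strip k" "odd k"
  shows "Im w > of_int k * pi \<Longrightarrow> Im (exp w) < 0" "Im w < of_int k * pi \<Longrightarrow> Im (exp w) > 0"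
    "Im w = of_int k * pi \<Longrightarrow> Im (exp w) = 0" "Im (exp w) \<noteq> 0 \<or> Re (exp w) < - a"
proof -
  note v = double_strip_sheet[OF assms(1)]
  note e = exp_near_axis[OF v(1)]
  have E: "exp w = - exp (w - of_int k * of_real pi * \<i>)" using exp_sheet[of w k] assms(2) by simp
  show "Im w > of_int k * pi \<Longrightarrow> Im (exp w) < 0" using e(1) v(3) unfolding E by simp
  show "Im w < of_int k * pi \<Longrightarrow> Im (exp w) > 0" using e(2) v(3) unfolding E by simp
  show "Im w = of_int k * pi \<Longrightarrow> Im (exp w) = 0" using e(3) v(3) unfolding E by simp
  show "Im (exp w) \<noteq> 0 \<or> Re (exp w) < - a"
    using e v by (cases "Im (w - of_int k * of_real pi * \<i>)" "0 :: real" rule: linorder_cases) (simp_all add: E)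
qed

lemma strip_branch_hol: "strip_branch x k holomorphic_on double_strip k"
proof (cases "even k")
  case True
  have "(\<lambda>w. x k * F (exp w) + x (k - 1) * B (\<sigma> (exp w))) holomorphic_on double_strip k"
    using double_strip_even(4)[OF _ True] a
    by (intro holomorphic_intros F_comp B_comp) fastforce+
  then show ?thesis using True by (simp add: strip_branch_def[abs_def])
next
  case False
  have "(\<lambda>w. x k * F (\<sigma> (exp w)) + x (k - 1) * B (exp w)) holomorphic_on double_strip k"
    using double_strip_odd(4)[OF _ False] a
    by (intro holomorphic_intros F_comp B_comp) fastforce+
  then show ?thesis using False by (simp add: strip_branch_def[abs_def])
qed

text \<open>
  This is where the recurrence comes from: on the common half sheet the two formulas have the same
  coefficient at one function, and comparing the coefficients at the other one gives it.
\<close>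

lemma strip_branch_agree:
  assumes x: "\<And>j. x (j + 1) = x (j - 1) - T * x j"
    and w: "w \<in> double_strip k" "Im w > of_int k * pi"
  shows "strip_branch x (k + 1) w = strip_branch x k w"
proof (cases "even k")
  case True
  then have "Im (exp w) > 0" using double_strip_even w by blast
  then have "B (\<sigma> (exp w)) = F (\<sigma> (exp w))" "B (exp w) = F (exp w) + T * F (\<sigma> (exp w))"
    by (simp_all add: B_lower B_upper \<sigma>_def)
  then show ?thesis using True by (simp add: strip_branch_def x[of k]) (simp add: algebra_simps)
next
  case False
  then have "Im (exp w) < 0" using double_strip_odd w by blast
  then have "B (exp w) = F (exp w)" "B (\<sigma> (exp w)) = F (\<sigma> (exp w)) + T * F (exp w)"
    using B_upper[of "\<sigma> (exp w)"] by (simp_all add: B_lower \<sigma>_def)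
  then show ?thesis using False by (simp add: strip_branch_def x[of k]) (simp add: algebra_simps)
qed

definition log_branch :: "(int \<Rightarrow> complex) \<Rightarrow> complex \<Rightarrow> complex" where
  "log_branch x w = strip_branch x \<lfloor>Im w / pi\<rfloor> w"

lemma floor_strip: "\<lfloor>Im w / pi\<rfloor> = k \<longleftrightarrow> of_int k * pi \<le> Im w \<and> Im w < (of_int k + 1) * pi"
  by (simp add: floor_eq_iff field_simps)

lemma log_branch_eq:
  assumes x: "\<And>j. x (j + 1) = x (j - 1) - T * x j" and w: "w \<in> double_strip k"
  shows "log_branch x w = strip_branch x k w"
proof (cases "Im w < of_int k * pi")
  case False
  then have "\<lfloor>Im w / pi\<rfloor> = k" using w unfolding floor_strip by (auto simp: double_strip_def)
  then show ?thesis by (simp add: log_branch_def)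
next
  case True
  then have k: "\<lfloor>Im w / pi\<rfloor> = k - 1" using w unfolding floor_strip by (auto simp: double_strip_def)
  moreover have "w \<in> double_strip (k - 1)" "Im w > of_int (k - 1) * pi"
    using w True by (auto simp: double_strip_def algebra_simps)
  from strip_branch_agree[OF x this] show ?thesis by (simp add: log_branch_def k)
qed

lemma double_strip_floor: "ln a < Re w \<Longrightarrow> w \<in> double_strip \<lfloor>Im w / pi\<rfloor>"
  using floor_strip[of w "\<lfloor>Im w / pi\<rfloor>"] pi_gt_zero by (simp add: double_strip_def algebra_simps)

lemma open_double_strip: "open (double_strip k)"
  unfolding double_strip_def by (intro open_Collect_conj open_Collect_less continuous_intros)

lemma log_branch_hol:
  assumes x: "\<And>j. x (j + 1) = x (j - 1) - T * x j"
  shows "log_branch x holomorphic_on {w. ln a < Re w}"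
proof -
  have "log_branch x holomorphic_on (\<Union>k. double_strip k)"
  proof (rule holomorphic_on_UN_open)
    fix k
    show "log_branch x holomorphic_on double_strip k"
      using strip_branch_hol[of x k] by (rule holomorphic_transform) (simp add: log_branch_eq[OF x])
  qed (rule open_double_strip)
  then show ?thesis by (rule holomorphic_on_subset) (use double_strip_floor in blast)
qed

lemmas sector_iff = mem_sector_iff[OF a]

lemma log_branch_growth: "minimal_type_on (sector a \<alpha> \<beta>) (log_branch x)"
  unfolding minimal_type_on_def
proof (intro allI impI)
  fix \<epsilon> :: real assume \<epsilon>: "\<epsilon> > 0"
  obtain K1 R1 where 1: "\<And>t. t \<in> cut_plane a \<Longrightarrow> R1 \<le> norm t \<Longrightarrow> norm (F t) \<le> K1 * exp (\<epsilon> * norm t)"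
    using F_growth[OF \<epsilon>] by blast
  obtain K2 R2 where 2: "\<And>t. Im t \<le> 0 \<Longrightarrow> Im t \<noteq> 0 \<or> Re t < - a \<Longrightarrow> R2 \<le> norm t \<Longrightarrow>
      norm (B t) \<le> K2 * exp (\<epsilon> * norm t)"
    using B_growth[OF \<epsilon>] by blast
  define K where "K = max \<bar>K1\<bar> \<bar>K2\<bar> * exp (\<epsilon> * a)"
  define R where "R = max R1 R2 + a"
  \<comment> \<open>Only finitely many half sheets meet the sector, so one constant bounds all coefficients.\<close>
  define X where "X = (\<Sum>k\<in>{\<lfloor>\<alpha> / pi\<rfloor>..\<lfloor>\<beta> / pi\<rfloor>}. norm (x k) + norm (x (k - 1)))"
  have K0: "K \<ge> 0" by (simp add: K_def)
  have aux: "C * exp (\<epsilon> * norm s) \<le> K * exp (\<epsilon> * n)"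
    if "norm s \<le> n + a" "C \<le> max \<bar>K1\<bar> \<bar>K2\<bar>" for C s and n :: real
  proof -
    have "C * exp (\<epsilon> * norm s) \<le> max \<bar>K1\<bar> \<bar>K2\<bar> * exp (\<epsilon> * (n + a))"
      using that \<epsilon> by (intro mult_mono) auto
    then show ?thesis by (simp add: K_def exp_add distrib_left mult_ac)
  qed
  have n\<sigma>: "norm (\<sigma> t) \<le> norm t + a" "norm t - a \<le> norm (\<sigma> t)" for t
    using norm_triangle_ineq4[of "- of_real a" t] norm_triangle_ineq2[of t "- of_real a"] a
    by (auto simp: \<sigma>_def norm_minus_commute)
  have "norm (log_branch x w) \<le> (X * K) * exp (\<epsilon> * norm (exp w))"
    if w: "w \<in> sector a \<alpha> \<beta>" "R \<le> norm (exp w)" for w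
  proof -
    define k where "k = \<lfloor>Im w / pi\<rfloor>"
    define n where "n = norm (exp w)"
    have D: "w \<in> double_strip k" and kI: "of_int k * pi \<le> Im w"
      using double_strip_floor[of w] floor_strip[of w k] w(1) by (auto simp: k_def sector_iff)
    have kin: "k \<in> {\<lfloor>\<alpha> / pi\<rfloor>..\<lfloor>\<beta> / pi\<rfloor>}"
      using w(1) unfolding k_def sector_iff by (auto intro!: floor_mono divide_right_mono)
    have X: "norm (x k) + norm (x (k - 1)) \<le> X"
      unfolding X_def by (rule member_le_sum[OF kin]) auto
    have R': "R1 \<le> n" "R2 \<le> n" "R1 \<le> norm (\<sigma> (exp w))" "R2 \<le> norm (\<sigma> (exp w))"
      using w(2) n\<sigma>(2)[of "exp w"] a by (auto simp: R_def n_def)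
    have nn: "norm (exp w) \<le> n + a" "norm (\<sigma> (exp w)) \<le> n + a" using n\<sigma>(1)[of "exp w"] a by (simp_all add: n_def)
    have KK: "K1 \<le> max \<bar>K1\<bar> \<bar>K2\<bar>" "K2 \<le> max \<bar>K1\<bar> \<bar>K2\<bar>" by auto
    have fin: "norm (x k * p + x (k - 1) * q) \<le> (X * K) * exp (\<epsilon> * n)"
      if "norm p \<le> K * exp (\<epsilon> * n)" "norm q \<le> K * exp (\<epsilon> * n)" for p q
    proof -
      have "norm (x k * p + x (k - 1) * q) \<le> norm (x k) * (K * exp (\<epsilon> * n)) + norm (x (k - 1)) * (K * exp (\<epsilon> * n))"
        using that by (intro norm_triangle_le add_mono) (auto simp: norm_mult intro!: mult_left_mono)
      also have "\<dots> = (norm (x k) + norm (x (k - 1))) * (K * exp (\<epsilon> * n))" by (simp add: algebra_simps)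
      also have "\<dots> \<le> X * (K * exp (\<epsilon> * n))" using X K0 by (intro mult_right_mono) auto
      finally show ?thesis by (simp add: mult.assoc)
    qed
    show ?thesis
    proof (cases "even k")
      case True
      note e = double_strip_even[OF D True]
      have im: "Im (exp w) \<ge> 0" using e kI by fastforce
      have "norm (F (exp w)) \<le> K1 * exp (\<epsilon> * n)"
        unfolding n_def using e(4) a R' by (intro 1) (auto simp: cut_plane_iff n_def)
      moreover have "norm (B (\<sigma> (exp w))) \<le> K2 * exp (\<epsilon> * norm (\<sigma> (exp w)))"
        using e(4) im a R' by (intro 2) auto
      ultimately have "norm (F (exp w)) \<le> K * exp (\<epsilon> * n)" "norm (B (\<sigma> (exp w))) \<le> K * exp (\<epsilon> * n)"
        using order_trans[OF _ aux[OF nn(1) KK(1)]] order_trans[OF _ aux[OF nn(2) KK(2)]] by (auto simp: n_def)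
      from fin[OF this] show ?thesis using True
        by (simp add: log_branch_def strip_branch_def n_def flip: k_def)
    next
      case False
      note e = double_strip_odd[OF D False]
      have im: "Im (exp w) \<le> 0" using e kI by fastforce
      have "norm (B (exp w)) \<le> K2 * exp (\<epsilon> * n)"
        unfolding n_def using e(4) im a R' by (intro 2) (auto simp: n_def)
      moreover have "norm (F (\<sigma> (exp w))) \<le> K1 * exp (\<epsilon> * norm (\<sigma> (exp w)))"
        using e(4) a R' by (intro 1) (auto simp: cut_plane_iff)
      ultimately have "norm (F (\<sigma> (exp w))) \<le> K * exp (\<epsilon> * n)" "norm (B (exp w)) \<le> K * exp (\<epsilon> * n)"
        using order_trans[OF _ aux[OF nn(1) KK(2)]] order_trans[OF _ aux[OF nn(2) KK(1)]] by (auto simp: n_def)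
      from fin[OF this] show ?thesis using False
        by (simp add: log_branch_def strip_branch_def n_def flip: k_def)
    qed
  qed
  then show "\<exists>K R. \<forall>w\<in>sector a \<alpha> \<beta>. R \<le> norm (exp w) \<longrightarrow>
      norm (log_branch x w) \<le> K * exp (\<epsilon> * norm (exp w))" by blast
qed

text \<open>
  A germ determines two consecutive coefficients, hence the whole sequence, hence a function on
  all of \<open>Re w > ln a\<close>; so the opening of a sector is irrelevant.
\<close>

lemma branch_germ_sector:
  assumes w: "ln a < Re w" and f: "branch_germ (exp w) f"
  shows "\<exists>x. (\<forall>j. x (j + 1) = x (j - 1) - T * x j) \<and> (\<forall>\<^sub>F z in nhds w. log_branch x z = f (exp z))"
proof -
  define k where "k = \<lfloor>Im w / pi\<rfloor>"
  have D: "w \<in> double_strip k" and kI: "of_int k * pi \<le> Im w"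
    using double_strip_floor[OF w] floor_strip[of w k] by (auto simp: k_def)
  have "\<exists>p q. \<forall>\<^sub>F t in nhds (exp w). f t =
      (if even k then p * F t + q * B (\<sigma> t) else p * F (\<sigma> t) + q * B t)"
  proof (cases "even k")
    case True
    note e = double_strip_even[OF D True]
    have "Im (exp w) > 0 \<or> Re (exp w) > 0" using e kI a by fastforce
    then show ?thesis
    proof
      assume "Re (exp w) > 0"
      then show ?thesis using f True by (simp add: germ_pos)
    next
      assume im: "Im (exp w) > 0"
      then obtain p q where "\<forall>\<^sub>F t in nhds (exp w). f t = p * F t + q * F (\<sigma> t)"
        using f germ_mid[of "exp w" f] by auto
      then have "\<forall>\<^sub>F t in nhds (exp w). f t = p * F t + q * B (\<sigma> t)"
        using near_Im(1)[OF im] by eventually_elim (simp add: B_lower)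
      then show ?thesis using True by auto
    qed
  next
    case False
    note e = double_strip_odd[OF D False]
    have "Im (exp w) < 0 \<or> Re (exp w) < - a" using e kI a by fastforce
    then show ?thesis
    proof
      assume "Re (exp w) < - a"
      then obtain p q where "\<forall>\<^sub>F t in nhds (exp w). f t = p * B t + q * F (\<sigma> t)"
        using f germ_neg by blast
      then have "\<forall>\<^sub>F t in nhds (exp w). f t = q * F (\<sigma> t) + p * B t"
        by eventually_elim simp
      then show ?thesis using False by auto
    next
      assume im: "Im (exp w) < 0"
      then obtain p q where "\<forall>\<^sub>F t in nhds (exp w). f t = p * F t + q * F (\<sigma> t)"
        using f germ_mid[of "exp w" f] by auto
      then have "\<forall>\<^sub>F t in nhds (exp w). f t = q * F (\<sigma> t) + p * B t"
        using near_Im(2)[OF im] by eventually_elim (simp add: B_lower)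
      then show ?thesis using False by auto
    qed
  qed
  then obtain p q where pq: "\<forall>\<^sub>F t in nhds (exp w). f t =
      (if even k then p * F t + q * B (\<sigma> t) else p * F (\<sigma> t) + q * B t)" by blast
  obtain x :: "int \<Rightarrow> complex" where x: "x k = p" "x (k - 1) = q" "\<And>j. x (j + 1) = x (j - 1) - T * x j"
    using two_sided_recurrence[of k p q T] by blast
  have "isCont exp w" by (intro continuous_intros)
  then have "filterlim exp (nhds (exp w)) (nhds w)"
    by (simp add: isCont_def tendsto_at_iff_tendsto_nhds)
  then have "\<forall>\<^sub>F z in nhds w. f (exp z) =
      (if even k then p * F (exp z) + q * B (\<sigma> (exp z)) else p * F (\<sigma> (exp z)) + q * B (exp z))"
    using pq unfolding filterlim_iff by blast
  moreover have "\<forall>\<^sub>F z in nhds w. z \<in> double_strip k"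
    using D open_double_strip by (rule eventually_nhds_in_open[rotated])
  ultimately have "\<forall>\<^sub>F z in nhds w. log_branch x z = f (exp z)"
    by eventually_elim (use x in \<open>simp add: log_branch_eq strip_branch_def\<close>)
  then show ?thesis using x(3) by blast
qed

lemma sector_continuation:
  assumes \<gamma>: "admissible_path a \<gamma>" and w: "w \<in> sector a \<alpha> \<beta>" "exp w = pathfinish \<gamma>"
  shows "\<exists>g G. continuation_along \<gamma> F g \<and> G holomorphic_on sector a \<alpha> \<beta> \<and>
           (\<forall>\<^sub>F z in nhds w. G z = g 1 (exp z)) \<and> minimal_type_on (sector a \<alpha> \<beta>) G"
proof -
  obtain g where g: "continuation_along \<gamma> F g" "branch_germ (\<gamma> 1) (g 1)"
    using continuation_exists[OF \<gamma>] by blast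
  obtain x where x: "\<And>j. x (j + 1) = x (j - 1) - T * x j"
    "\<forall>\<^sub>F z in nhds w. log_branch x z = g 1 (exp z)"
    using branch_germ_sector[of w "g 1"] g(2) w by (auto simp: sector_iff pathfinish_def)
  have "log_branch x holomorphic_on sector a \<alpha> \<beta>"
    using log_branch_hol[OF x(1)] by (rule holomorphic_on_subset) (auto simp: sector_iff)
  then show ?thesis using g(1) x(2) log_branch_growth by blast
qed

end

section \<open>The Hankel integral of an element of S\<close>

lemma set_integrable_exp_neg_exp: "set_integrable lborel {b..} (\<lambda>x::real. exp (- exp x))"
proof (rule set_integrable_dominated)
  show "set_integrable lborel {b..} (\<lambda>x. exp (- 1 * x))" by (rule set_integrable_exp_atLeast) simp
  show "norm (exp (- exp x)) \<le> exp (- 1 * x)" for x :: real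
    using exp_ge_add_one_self[of x] by (simp add: order_trans[of x "1 + x"])
qed (simp add: set_borel_measurable_def)

lemma integral_exp_neg_exp_le:
  fixes b :: real
  shows "(LBINT x:{b..}. exp (- exp x)) \<le> \<bar>b\<bar> + 1"
proof -
  have i1: "set_integrable lborel {0..} (\<lambda>x::real. exp (- 1 * x))"
    by (rule set_integrable_exp_atLeast) simp
  have "((\<lambda>x::real. exp (- 1 * x)) has_integral exp (- 1 * 0) / 1) {0..}"
    by (rule has_integral_exp_minus_to_infinity) simp
  then have v1: "(LBINT x:{0::real..}. exp (- 1 * x)) = 1"
    using set_borel_integral_eq_integral(2)[OF i1] by (simp add: integral_unique)
  have i2: "set_integrable lborel {- \<bar>b\<bar>..0} (\<lambda>x::real. 1::real)"
    by (intro borel_integrable_atLeastAtMost' continuous_intros)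
  have v2: "(LBINT x:{- \<bar>b\<bar>..0}. (1::real)) = \<bar>b\<bar>"
    by (simp add: set_lebesgue_integral_def)
  have "(LBINT x:{b..}. exp (- exp x)) \<le>
      (LBINT x. indicator {0..} x *\<^sub>R exp (- 1 * x) + indicator {- \<bar>b\<bar>..0} x *\<^sub>R (1::real))"
    unfolding set_lebesgue_integral_def
  proof (rule integral_mono)
    fix x :: real
    have "exp (- exp x) \<le> exp (- x)" "exp (- exp x) \<le> 1"
      using exp_ge_add_one_self[of x] by (auto simp: order_trans[of x "1 + x"])
    moreover have "exp (- exp x) \<le> exp (- x) + 1"
      using \<open>exp (- exp x) \<le> 1\<close> exp_gt_zero[of "- x"] by linarith
    ultimately show "indicator {b..} x *\<^sub>R exp (- exp x) \<le>
        indicator {0..} x *\<^sub>R exp (- 1 * x) + indicator {- \<bar>b\<bar>..0} x *\<^sub>R (1::real)"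
      by (auto simp: indicator_def)
  qed (use set_integrable_exp_neg_exp i1 i2 in \<open>auto simp: set_integrable_def intro!: Bochner_Integration.integrable_add\<close>)
  also have "\<dots> = (LBINT x:{0::real..}. exp (- 1 * x)) + (LBINT x:{- \<bar>b\<bar>..0}. (1::real))"
    unfolding set_lebesgue_integral_def
    by (rule Bochner_Integration.integral_add) (use i1 i2 in \<open>auto simp: set_integrable_def\<close>)
  finally show ?thesis using v1 v2 by simp
qed

locale borel_data =
  fixes a :: real and T :: complex and P :: "complex \<Rightarrow> complex"
  assumes a: "a > 0" and P: "P \<in> S_space a T"
begin

lemma P_hol: "P holomorphic_on UNIV" using P by (simp add: S_space_def)

lemma P_comp [holomorphic_intros]: "f holomorphic_on A \<Longrightarrow> (\<lambda>w. P (f w)) holomorphic_on A"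
  using holomorphic_on_compose_gen[OF _ P_hol, of f A] by (simp add: comp_def)

lemma P_cont [continuous_intros]: "continuous_on A f \<Longrightarrow> continuous_on A (\<lambda>x. P (f x))"
  using continuous_on_compose2[OF holomorphic_on_imp_continuous_on[OF P_hol], of A f] by simp

lemma P_meas [measurable]: "P \<in> borel_measurable borel"
  by (intro borel_measurable_continuous_onI holomorphic_on_imp_continuous_on P_hol)

lemma P_fun: "P (w + pi * \<i>) = P (w - pi * \<i>) + T * exp (- (of_real a * exp w)) * P w"
  using P by (simp add: S_space_def)

text \<open>
  The functional equation carries the bound from \<open>\<bar>arg \<zeta>\<bar> \<le> \<pi>\<close> to \<open>\<bar>arg \<zeta>\<bar> \<le> 3\<pi>/2\<close>, because the exponential
  factor is at most \<open>1\<close> in the left half plane.  The additional \<open>\<pi>/2\<close> on both sides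
  is what lets the branches below cross the cut.
\<close>

lemma P_bound:
  "\<exists>N\<ge>0. \<forall>w. \<bar>Im w\<bar> \<le> 3 * pi / 2 \<and> \<rho> \<le> Re w \<longrightarrow> norm (P w) \<le> N"
proof -
  obtain M :: "real \<Rightarrow> real" where M: "\<And>r. r > 0 \<Longrightarrow> M r > 0"
    "\<And>r w. r > 0 \<Longrightarrow> \<bar>Im w\<bar> \<le> pi \<Longrightarrow> norm (exp w) \<ge> r \<Longrightarrow> norm (P w) \<le> M r"
    using P unfolding S_space_def by blast
  define m where "m = M (exp \<rho>)"
  have m: "m > 0" unfolding m_def by (rule M(1)) simp
  have b: "norm (P w) \<le> m" if "\<bar>Im w\<bar> \<le> pi" "\<rho> \<le> Re w" for w
    unfolding m_def by (rule M(2)) (use that in auto)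
  have E: "exp (w - pi * \<i>) = - exp w" "exp (w + pi * \<i>) = - exp w" for w
    by (simp_all add: exp_diff exp_add)
  have "norm (P w) \<le> m + norm T * m" if w: "\<bar>Im w\<bar> \<le> 3 * pi / 2" "\<rho> \<le> Re w" for w
  proof -
    consider "\<bar>Im w\<bar> \<le> pi" | "Im w > pi" | "Im w < - pi" by linarith
    then show ?thesis
    proof cases
      case 1
      then show ?thesis using b[of w] w m norm_ge_zero[of T] by (smt (verit) mult_nonneg_nonneg)
    next
      case 2
      have "cos (Im w) \<le> 0" using cos_ge_zero[of "Im w - pi"] 2 w by (simp add: cos_diff)
      then have re: "Re (of_real a * exp w) \<le> 0" using a by (simp add: Re_exp mult_nonneg_nonpos)
      have "P w = P (w - 2 * pi * \<i>) + T * exp (of_real a * exp w) * P (w - pi * \<i>)"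
        using P_fun[of "w - pi * \<i>", unfolded E] by (simp add: algebra_simps)
      also have "norm \<dots> \<le> m + norm T * (1 * m)"
      proof (intro norm_triangle_le add_mono)
        show "norm (P (w - 2 * pi * \<i>)) \<le> m" by (rule b) (use 2 w in auto)
        have "norm (exp (of_real a * exp w)) * norm (P (w - pi * \<i>)) \<le> 1 * m"
          by (intro mult_mono b) (use 2 w re in auto)
        then show "norm (T * exp (of_real a * exp w) * P (w - pi * \<i>)) \<le> norm T * (1 * m)"
          by (simp add: norm_mult mult.assoc mult_left_mono del: norm_exp_eq_Re)
      qed
      finally show ?thesis by simp
    next
      case 3
      have "cos (Im w) \<le> 0" using cos_ge_zero[of "Im w + pi"] 3 w by (simp add: cos_add)
      then have re: "Re (of_real a * exp w) \<le> 0" using a by (simp add: Re_exp mult_nonneg_nonpos)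
      have "P w = P (w + 2 * pi * \<i>) - T * exp (of_real a * exp w) * P (w + pi * \<i>)"
        using P_fun[of "w + pi * \<i>", unfolded E] by (simp add: algebra_simps)
      also have "norm \<dots> \<le> m + norm T * (1 * m)"
      proof (intro norm_triangle_le_diff add_mono)
        show "norm (P (w + 2 * pi * \<i>)) \<le> m" by (rule b) (use 3 w in auto)
        have "norm (exp (of_real a * exp w)) * norm (P (w + pi * \<i>)) \<le> 1 * m"
          by (intro mult_mono b) (use 3 w re in auto)
        then show "norm (T * exp (of_real a * exp w) * P (w + pi * \<i>)) \<le> norm T * (1 * m)"
          by (simp add: norm_mult mult.assoc mult_left_mono del: norm_exp_eq_Re)
      qed
      finally show ?thesis by simp
    qed
  qed
  then show ?thesis using m by (intro exI[of _ "m + norm T * m"]) (auto intro: add_nonneg_nonneg)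
qed

text \<open>
  The integrand \<open>e\<^sup>-\<^sup>\<zeta>\<^sup>s P(\<zeta>) d\<zeta>/\<zeta>\<close> in the coordinate \<open>v = log \<zeta>\<close>.  It is entire in \<open>v\<close>, so such integrals are
  differences of a primitive (\<open>seg_primitive\<close>) and all deformations of contours reduce to algebra.
\<close>

definition seg :: "complex \<Rightarrow> complex \<Rightarrow> complex \<Rightarrow> complex" where
  "seg p q s = contour_integral (linepath p q) (\<lambda>v. exp (- exp v * s) * P v)"

lemma seg_primitive:
  obtains \<Psi> where "\<And>v. (\<Psi> has_field_derivative exp (- exp v * s) * P v) (at v)"
    "\<And>p q. seg p q s = \<Psi> q - \<Psi> p"
proof -
  have "(\<lambda>v. exp (- exp v * s) * P v) holomorphic_on UNIV" by (intro holomorphic_intros)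
  from holomorphic_convex_primitive'[OF _ _ this] obtain \<Psi> where
    \<Psi>: "\<And>v. (\<Psi> has_field_derivative exp (- exp v * s) * P v) (at v)" by auto
  moreover have "seg p q s = \<Psi> q - \<Psi> p" for p q
    unfolding seg_def
    using contour_integral_unique[OF contour_integral_primitive[of UNIV \<Psi> _ "linepath p q"]] \<Psi> by auto
  ultimately show ?thesis using that by blast
qed

lemma seg_holomorphic:
  assumes S: "open S" and h: "p holomorphic_on S" "q holomorphic_on S" "s holomorphic_on S"
  shows "(\<lambda>w. seg (p w) (q w) (s w)) holomorphic_on S"
proof -
  define f where "f w x = exp (- exp (linepath (p w) (q w) x) * s w) * P (linepath (p w) (q w) x) * (q w - p w)" for w x
  have cf: "continuous_on {0..1} (f w)" for w
    unfolding f_def linepath_def by (intro continuous_intros)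
  have eq: "seg (p w) (q w) (s w) = integral\<^sup>L lborel (\<lambda>x. indicator {0..1} x *\<^sub>R f w x)" for w
  proof -
    have "seg (p w) (q w) (s w) = integral {0..1} (f w)"
      unfolding seg_def contour_integral_integral f_def
      by (intro integral_cong) (simp add: vector_derivative_linepath_within)
    also have "\<dots> = (LBINT x:{0..1}. f w x)"
      using set_borel_integral_eq_integral(2)[OF borel_integrable_atLeastAtMost'[OF cf]] by simp
    finally show ?thesis by (simp add: set_lebesgue_integral_def)
  qed
  have "(\<lambda>w. integral\<^sup>L lborel (\<lambda>x. indicator {0..1} x *\<^sub>R f w x)) holomorphic_on S"
  proof (rule holomorphic_on_integral[OF S])
    fix w assume w: "w \<in> S"
    show "(\<lambda>x. indicator {0..1} x *\<^sub>R f w x) \<in> borel_measurable lborel"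
      using borel_integrable_atLeastAtMost'[OF cf, of w] by (simp add: set_integrable_def)
    obtain e where e: "e > 0" "cball w e \<subseteq> S" using S w open_contains_cball by blast
    have "continuous_on (S \<times> {0..1}) (\<lambda>z. f (fst z) (snd z))"
    proof -
      have c: "continuous_on (S \<times> {0..1::real}) (\<lambda>z. g (fst z))" if "g holomorphic_on S" for g :: "complex \<Rightarrow> complex"
        by (rule continuous_on_compose2[OF holomorphic_on_imp_continuous_on[OF that]])
          (auto intro!: continuous_intros)
      show ?thesis unfolding f_def linepath_def by (intro continuous_intros c h)
    qed
    then have "continuous_on (cball w e \<times> {0..1}) (\<lambda>z. f (fst z) (snd z))"
      by (rule continuous_on_subset) (use e in auto)
    then have "bounded ((\<lambda>z. f (fst z) (snd z)) ` (cball w e \<times> {0..1}))"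
      by (intro compact_imp_bounded compact_continuous_image compact_Times) auto
    then obtain C where C: "\<And>y x. y \<in> cball w e \<Longrightarrow> x \<in> {0..1} \<Longrightarrow> norm (f y x) \<le> C"
      unfolding bounded_iff by fastforce
    have "integrable lborel (\<lambda>x::real. indicator {0..1} x *\<^sub>R C)"
      by (simp add: integrable_indicator_iff)
    moreover have "norm (indicator {0..1} x *\<^sub>R f y x) \<le> indicator {0..1} x *\<^sub>R C" if "dist w y < e" for y x
      using C[of y x] that by (auto simp: indicator_def)
    ultimately show "\<exists>e>0. \<exists>D. integrable lborel D \<and> (\<forall>y\<in>S. dist w y < e \<longrightarrow>
        (\<forall>x\<in>space lborel. norm (indicator {0..1} x *\<^sub>R f y x) \<le> D x))"
      using e(1) by (intro exI[of _ e] conjI exI[of _ "\<lambda>x. indicator {0..1} x *\<^sub>R C"]) auto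
  qed (unfold f_def linepath_def, intro holomorphic_intros h)
  then show ?thesis by (simp add: eq)
qed

lemma seg_bound:
  assumes "\<And>v. v \<in> closed_segment p q \<Longrightarrow> norm (exp (- exp v * s) * P v) \<le> K" "K \<ge> 0"
  shows "norm (seg p q s) \<le> K * norm (q - p)"
proof -
  have "(\<lambda>v. exp (- exp v * s) * P v) contour_integrable_on linepath p q"
    by (intro contour_integrable_continuous_linepath continuous_intros)
  from contour_integral_bound_linepath[OF this assms(2,1)] show ?thesis by (simp add: seg_def)
qed

text \<open>
  The integral of \<open>e\<^sup>-\<^sup>\<zeta>\<^sup>s P(\<zeta>) d\<zeta>/\<zeta>\<close> over the part of the ray \<open>arg (\<zeta> s) = 0\<close> on which \<open>\<zeta> s \<ge> e\<^sup>b\<close>, where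
  \<open>s = e\<^sup>w\<close>.  Turning the ray together with \<open>s\<close> makes one formula valid on the whole strip.
\<close>

definition tail :: "real \<Rightarrow> complex \<Rightarrow> complex" where
  "tail b w = (LBINT x:{b..}. of_real (exp (- exp x)) * P (of_real x - w))"

lemma tail_integrand:
  assumes "\<bar>Im w\<bar> \<le> 3 * pi / 2" "Re w \<le> c"
    and N: "\<And>w. \<bar>Im w\<bar> \<le> 3 * pi / 2 \<Longrightarrow> b - c \<le> Re w \<Longrightarrow> norm (P w) \<le> N"
  shows "x \<in> {b..} \<Longrightarrow> norm (of_real (exp (- exp x)) * P (of_real x - w)) \<le> N * exp (- exp x)"
  using N[of "of_real x - w"] assms by (simp add: norm_mult mult.commute)

lemma tail_meas: "set_borel_measurable lborel {b..} (\<lambda>x. of_real (exp (- exp x)) * P (of_real x - w))"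
  unfolding set_borel_measurable_def by measurable

lemma tail_integrable:
  assumes "\<bar>Im w\<bar> \<le> 3 * pi / 2"
  shows "set_integrable lborel {b..} (\<lambda>x. of_real (exp (- exp x)) * P (of_real x - w))"
proof -
  obtain N where N: "\<And>v. \<bar>Im v\<bar> \<le> 3 * pi / 2 \<Longrightarrow> b - Re w \<le> Re v \<Longrightarrow> norm (P v) \<le> N"
    using P_bound[of "b - Re w"] by blast
  show ?thesis
  proof (rule set_integrable_dominated[OF _ tail_meas])
    show "set_integrable lborel {b..} (\<lambda>x. N * exp (- exp x))"
      by (intro set_integrable_mult_right set_integrable_exp_neg_exp)
  qed (rule tail_integrand[OF assms order_refl N])
qed

lemma tail_bound:
  assumes "\<bar>Im w\<bar> \<le> 3 * pi / 2"
    and N: "\<And>v. \<bar>Im v\<bar> \<le> 3 * pi / 2 \<Longrightarrow> b - Re w \<le> Re v \<Longrightarrow> norm (P v) \<le> N"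
    and "N \<ge> 0"
  shows "norm (tail b w) \<le> N * (\<bar>b\<bar> + 1)"
proof -
  have "norm (tail b w) \<le> (LBINT x:{b..}. N * exp (- exp x))"
    unfolding tail_def set_lebesgue_integral_def
  proof (rule order_trans[OF integral_norm_bound], rule integral_mono)
    fix x :: real
    show "norm (indicator {b..} x *\<^sub>R (of_real (exp (- exp x)) * P (of_real x - w))) \<le>
        indicator {b..} x *\<^sub>R (N * exp (- exp x))"
      using tail_integrand[OF assms(1) order_refl N, of x] by (auto simp: indicator_def)
  next
    show "integrable lborel (\<lambda>x. norm (indicator {b..} x *\<^sub>R (of_real (exp (- exp x)) * P (of_real x - w))))"
      using tail_integrable[OF assms(1), of b] unfolding set_integrable_def by (rule integrable_norm)
    show "integrable lborel (\<lambda>x. indicator {b..} x *\<^sub>R (N * exp (- exp x)))"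
      using set_integrable_mult_right[of N lborel "{b..}" "\<lambda>x. exp (- exp x)"] set_integrable_exp_neg_exp
      by (simp add: set_integrable_def)
  qed
  also have "\<dots> = N * (LBINT x:{b..}. exp (- exp x))" by simp
  also have "\<dots> \<le> N * (\<bar>b\<bar> + 1)" using integral_exp_neg_exp_le \<open>N \<ge> 0\<close> by (rule mult_left_mono)
  finally show ?thesis .
qed

lemma tail_holomorphic: "tail b holomorphic_on (Im_strip (- (3 * pi / 2)) (3 * pi / 2))"
  (is "_ holomorphic_on ?S")
proof -
  have "(\<lambda>w. integral\<^sup>L lborel (\<lambda>x. indicator {b..} x *\<^sub>R (of_real (exp (- exp x)) * P (of_real x - w))))
      holomorphic_on ?S"
  proof (rule holomorphic_on_integral[OF open_Im_strip])
    fix w assume w: "w \<in> ?S"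
    show "(\<lambda>x. indicator {b..} x *\<^sub>R (of_real (exp (- exp x)) * P (of_real x - w))) \<in> borel_measurable lborel"
      using tail_meas by (simp add: set_borel_measurable_def)
    obtain N where N: "\<And>v. \<bar>Im v\<bar> \<le> 3 * pi / 2 \<Longrightarrow> b - (Re w + 1) \<le> Re v \<Longrightarrow> norm (P v) \<le> N"
      using P_bound[of "b - (Re w + 1)"] by blast
    have "integrable lborel (\<lambda>x. indicator {b..} x *\<^sub>R (N * exp (- exp x)))"
      using set_integrable_mult_right[of N lborel "{b..}" "\<lambda>x. exp (- exp x)"] set_integrable_exp_neg_exp
      by (simp add: set_integrable_def)
    moreover have "norm (indicator {b..} x *\<^sub>R (of_real (exp (- exp x)) * P (of_real x - y))) \<le>
        indicator {b..} x *\<^sub>R (N * exp (- exp x))" if "y \<in> ?S" "dist w y < 1" for y x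
    proof -
      have "\<bar>Im y\<bar> \<le> 3 * pi / 2" using that by auto
      moreover have "Re y \<le> Re w + 1"
        using abs_Re_le_cmod[of "w - y"] that by (simp add: dist_norm)
      ultimately show ?thesis using tail_integrand[of y "Re w + 1" b N x] N by (auto simp: indicator_def)
    qed
    ultimately show "\<exists>e>0. \<exists>D. integrable lborel D \<and> (\<forall>y\<in>?S. dist w y < e \<longrightarrow>
        (\<forall>x\<in>space lborel. norm (indicator {b..} x *\<^sub>R (of_real (exp (- exp x)) * P (of_real x - y))) \<le> D x))"
      by (intro exI[of _ 1] conjI exI[of _ "\<lambda>x. indicator {b..} x *\<^sub>R (N * exp (- exp x))"]) auto
  qed (intro holomorphic_intros)
  then show ?thesis by (simp add: tail_def[abs_def] set_lebesgue_integral_def)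
qed

text \<open>
  The continuation in \<open>w = log s\<close> of the integral of \<open>e\<^sup>-\<^sup>\<zeta>\<^sup>s P(\<zeta>) d\<zeta>/\<zeta>\<close> over \<open>\<zeta> > e\<^sup>\<rho>\<close>: the path runs from
  \<open>e\<^sup>\<rho>\<close> to the beginning of the ray in \<open>tail\<close>.  That beginning may be chosen freely (\<open>J_eq\<close>).
  The value \<open>b = 0\<close> is convenient for holomorphy.
\<close>

definition J :: "real \<Rightarrow> complex \<Rightarrow> complex" where
  "J \<rho> w = tail 0 w + seg (of_real \<rho>) (- w) (exp w)"

lemma J_holomorphic: "J \<rho> holomorphic_on (Im_strip (- (3 * pi / 2)) (3 * pi / 2))"
  unfolding J_def[abs_def]
  by (intro holomorphic_intros tail_holomorphic seg_holomorphic open_Im_strip)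

lemma tail_diff:
  assumes w: "\<bar>Im w\<bar> \<le> 3 * pi / 2" and "b \<le> b'"
  shows "tail b w = tail b' w + seg (of_real b - w) (of_real b' - w) (exp w)"
proof -
  define f where "f x = of_real (exp (- exp x)) * P (of_real x - w)" for x :: real
  obtain \<Psi> where \<Psi>: "\<And>v. (\<Psi> has_field_derivative exp (- exp v * exp w) * P v) (at v)"
    "\<And>p q. seg p q (exp w) = \<Psi> q - \<Psi> p" by (rule seg_primitive[of "exp w"]) (rule that, assumption+)
  have t: "(f has_integral tail c w) {c..}" for c
    using set_borel_integral_eq_integral[OF tail_integrable[OF w, of c]]
    by (simp add: f_def[abs_def] tail_def has_integral_iff)
  have "(f has_integral (\<Psi> (of_real b' - w) - \<Psi> (of_real b - w))) {b..b'}"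
  proof (rule fundamental_theorem_of_calculus[OF \<open>b \<le> b'\<close>])
    fix x :: real
    have "exp (of_real x - w) * exp w = of_real (exp x)" by (simp flip: exp_add exp_of_real)
    then have e: "exp (- exp (of_real x - w) * exp w) = of_real (exp (- exp x))"
      by (simp flip: exp_of_real)
    have "((\<lambda>x. of_real x - w) has_vector_derivative 1) (at x within {b..b'})"
      by (auto intro!: derivative_eq_intros)
    from field_vector_diff_chain_within[OF this has_field_derivative_at_within[OF \<Psi>(1)]]
    show "((\<lambda>x. \<Psi> (of_real x - w)) has_vector_derivative f x) (at x within {b..b'})"
      by (simp only: comp_def f_def e mult_1)
  qed
  note ftc = this
  have set: "{b..b'} \<union> {b'..} = {b..}" "{b..b'} \<inter> {b'..} = {b'}"
    using \<open>b \<le> b'\<close> by auto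
  have "(f has_integral (\<Psi> (of_real b' - w) - \<Psi> (of_real b - w)) + tail b' w) {b..}"
    using has_integral_Un[OF ftc t[of b']] unfolding set by (simp only: negligible_sing simp_thms)
  from has_integral_unique[OF t[of b] this] show ?thesis by (simp add: \<Psi>(2))
qed

lemma J_eq:
  assumes w: "\<bar>Im w\<bar> \<le> 3 * pi / 2"
  shows "J \<rho> w = tail b w + seg (of_real \<rho>) (of_real b - w) (exp w)"
proof -
  obtain \<Psi> where \<Psi>: "\<And>p q. seg p q (exp w) = \<Psi> q - \<Psi> p" by (rule seg_primitive[of "exp w"]) (rule that, assumption+)
  show ?thesis
    using tail_diff[OF w, of b 0] tail_diff[OF w, of 0 b] by (cases "b \<le> 0") (simp_all add: J_def \<Psi>)
qed

text \<open>
  Here the path is the arc \<open>\<bar>\<zeta>\<bar> = e\<^sup>\<rho>\<close> followed by the ray.  The arc contributes the exponential, and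
  the ray the logarithmic singularity at \<open>s = 0\<close>, in the form of the term \<open>\<bar>Re w\<bar>\<close>.
\<close>

lemma J_bound:
  assumes N: "\<And>v. \<bar>Im v\<bar> \<le> 3 * pi / 2 \<Longrightarrow> \<rho> \<le> Re v \<Longrightarrow> norm (P v) \<le> N" "N \<ge> 0"
    and w: "\<bar>Im w\<bar> \<le> 3 * pi / 2"
  shows "norm (J \<rho> w) \<le> N * (\<bar>\<rho>\<bar> + \<bar>Re w\<bar> + 1) + 5 * N * exp (exp \<rho> * norm (exp w))"
proof -
  define q where "q = of_real (\<rho> + Re w) - w"
  have q: "Re q = \<rho>" "Im q = - Im w" by (simp_all add: q_def)
  have "norm (tail (\<rho> + Re w) w) \<le> N * (\<bar>\<rho> + Re w\<bar> + 1)"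
    by (rule tail_bound) (use N w in auto)
  also have "\<dots> \<le> N * (\<bar>\<rho>\<bar> + \<bar>Re w\<bar> + 1)" using N(2) by (intro mult_left_mono) auto
  finally have 1: "norm (tail (\<rho> + Re w) w) \<le> N * (\<bar>\<rho>\<bar> + \<bar>Re w\<bar> + 1)" .
  have "norm (seg (of_real \<rho>) q (exp w)) \<le> (exp (exp \<rho> * norm (exp w)) * N) * norm (q - of_real \<rho>)"
  proof (rule seg_bound)
    fix v assume "v \<in> closed_segment (of_real \<rho>) q"
    then obtain u where u: "0 \<le> u" "u \<le> 1" "v = (1 - u) *\<^sub>R of_real \<rho> + u *\<^sub>R q"
      by (auto simp: closed_segment_def)
    have "Re v = \<rho>" "Im v = - (u * Im w)" unfolding u(3) by (simp_all add: q algebra_simps)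
    then have v: "Re v = \<rho>" "\<bar>Im v\<bar> \<le> \<bar>Im w\<bar>"
      using u(1,2) by (simp_all add: abs_mult mult_left_le_one_le)
    have "- Re (exp v * exp w) \<le> norm (exp v * exp w)" using abs_Re_le_cmod[of "exp v * exp w"] by linarith
    then have "norm (exp (- exp v * exp w)) \<le> exp (exp \<rho> * norm (exp w))"
      using v by (simp add: norm_mult)
    moreover have "norm (P v) \<le> N" by (rule N) (use v w in auto)
    ultimately show "norm (exp (- exp v * exp w) * P v) \<le> exp (exp \<rho> * norm (exp w)) * N"
      unfolding norm_mult by (intro mult_mono) auto
  qed (use N in auto)
  moreover have "norm (q - of_real \<rho>) \<le> 5"
  proof -
    have "norm (q - of_real \<rho>) = \<bar>Im w\<bar>" using q by (simp add: cmod_def)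
    moreover have "pi < 16 / 5" using pi_approx by simp
    ultimately show ?thesis using w by linarith
  qed
  ultimately have "norm (seg (of_real \<rho>) q (exp w)) \<le> (exp (exp \<rho> * norm (exp w)) * N) * 5"
    using N(2) by (elim order_trans) (intro mult_left_mono, auto)
  then have 2: "norm (seg (of_real \<rho>) q (exp w)) \<le> 5 * N * exp (exp \<rho> * norm (exp w))"
    by (simp only: mult_ac)
  have "J \<rho> w = tail (\<rho> + Re w) w + seg (of_real \<rho>) q (exp w)"
    unfolding q_def by (rule J_eq[OF w])
  then show ?thesis using norm_triangle_mono[OF 1 2] by simp
qed

text \<open>The integral of \<open>e\<^sup>\<zeta>\<^sup>t P(\<zeta>) d\<zeta>/\<zeta>\<close> over the full circle \<open>\<bar>\<zeta>\<bar> = e\<^sup>\<rho>\<close>.\<close>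

definition A :: "real \<Rightarrow> complex \<Rightarrow> complex" where
  "A \<rho> t = seg (of_real \<rho> - pi * \<i>) (of_real \<rho> + pi * \<i>) (- t)"

lemma A_holomorphic: "A \<rho> holomorphic_on UNIV"
  unfolding A_def[abs_def] by (intro seg_holomorphic holomorphic_intros) auto

lemma A_bound:
  assumes N: "\<And>v. \<bar>Im v\<bar> \<le> 3 * pi / 2 \<Longrightarrow> \<rho> \<le> Re v \<Longrightarrow> norm (P v) \<le> N" "N \<ge> 0"
  shows "norm (A \<rho> t) \<le> 7 * N * exp (exp \<rho> * norm t)"
proof -
  have "norm (A \<rho> t) \<le> (exp (exp \<rho> * norm t) * N) * norm ((of_real \<rho> + pi * \<i>) - (of_real \<rho> - pi * \<i>))"
    unfolding A_def
  proof (rule seg_bound)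
    fix v assume "v \<in> closed_segment (of_real \<rho> - pi * \<i>) (of_real \<rho> + pi * \<i>)"
    then obtain u where u: "0 \<le> u" "u \<le> 1" "v = (1 - u) *\<^sub>R (of_real \<rho> - pi * \<i>) + u *\<^sub>R (of_real \<rho> + pi * \<i>)"
      by (auto simp: closed_segment_def)
    have "Im v = (2 * u - 1) * pi" "Re v = \<rho>" unfolding u(3) by (simp_all add: algebra_simps)
    moreover have "\<bar>(2 * u - 1) * pi\<bar> \<le> 1 * pi" unfolding abs_mult using u by (intro mult_mono) auto
    ultimately have v: "Re v = \<rho>" "\<bar>Im v\<bar> \<le> pi" by auto
    have "Re (exp v * t) \<le> norm (exp v * t)" by (rule complex_Re_le_cmod)
    then have "norm (exp (- exp v * - t)) \<le> exp (exp \<rho> * norm t)"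
      using v by (simp add: norm_mult)
    moreover have "norm (P v) \<le> N" by (rule N) (use v in auto)
    ultimately show "norm (exp (- exp v * - t) * P v) \<le> exp (exp \<rho> * norm t) * N"
      unfolding norm_mult by (intro mult_mono) auto
  qed (use N in auto)
  also have "(of_real \<rho> + pi * \<i>) - (of_real \<rho> - pi * \<i>) = of_real (2 * pi) * \<i>" by (simp add: complex_eq_iff)
  also have "norm (of_real (2 * pi) * \<i>) = 2 * pi" unfolding norm_mult by simp
  finally show ?thesis using N(2) pi_approx
    by (elim order_trans) (simp add: mult_ac mult_left_mono)
qed

text \<open>
  The Hankel integral, with a branch \<open>w\<close> of \<open>log (t + a)\<close> as a separate argument.
\<close>

definition K :: "real \<Rightarrow> complex \<Rightarrow> complex \<Rightarrow> complex" where
  "K \<rho> t w = A \<rho> t + T * J \<rho> w"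

text \<open>
  The derivative with respect to \<open>\<rho>\<close> collects the integrand at the three ends of the path, and the
  functional equation says that they cancel.
\<close>

lemma K_indep:
  assumes w: "\<bar>Im w\<bar> \<le> 3 * pi / 2" and t: "exp w = t + of_real a"
  shows "K \<rho> t w = K \<rho>' t w"
proof -
  obtain \<Psi> where \<Psi>: "\<And>v. (\<Psi> has_field_derivative exp (- exp v * exp w) * P v) (at v)"
    "\<And>p q. seg p q (exp w) = \<Psi> q - \<Psi> p" by (rule seg_primitive[of "exp w"]) (rule that, assumption+)
  obtain \<Phi> where \<Phi>: "\<And>v. (\<Phi> has_field_derivative exp (- exp v * - t) * P v) (at v)"
    "\<And>p q. seg p q (- t) = \<Phi> q - \<Phi> p" by (rule seg_primitive[of "- t"]) (rule that, assumption+)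
  define D where "D z = \<Phi> (z + pi * \<i>) - \<Phi> (z - pi * \<i>) - T * \<Psi> z" for z
  have "(D has_field_derivative 0) (at z)" for z
  proof -
    have E: "exp (z + pi * \<i>) = - exp z" "exp (z - pi * \<i>) = - exp z" by (simp_all add: exp_diff exp_add)
    have 1: "((\<lambda>z. \<Phi> (z + pi * \<i>)) has_field_derivative exp (- (exp z * t)) * P (z + pi * \<i>)) (at z)"
      using \<Phi>(1)[of "z + pi * \<i>"] unfolding DERIV_shift E by simp
    have 2: "((\<lambda>z. \<Phi> (z - pi * \<i>)) has_field_derivative exp (- (exp z * t)) * P (z - pi * \<i>)) (at z)"
      using \<Phi>(1)[of "z - pi * \<i>"] DERIV_shift[of \<Phi> _ z "- (pi * \<i>)"] unfolding E by simp
    have e: "exp (- exp z * exp w) = exp (- (exp z * t)) * exp (- (of_real a * exp z))"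
      unfolding t by (simp add: algebra_simps flip: exp_add)
    have "(D has_field_derivative exp (- (exp z * t)) * P (z + pi * \<i>) - exp (- (exp z * t)) * P (z - pi * \<i>)
        - T * (exp (- exp z * exp w) * P z)) (at z)"
      unfolding D_def[abs_def] by (intro DERIV_diff 1 2 DERIV_cmult \<Psi>)
    also have "exp (- (exp z * t)) * P (z + pi * \<i>) - exp (- (exp z * t)) * P (z - pi * \<i>)
        - T * (exp (- exp z * exp w) * P z) = 0"
      unfolding e P_fun by (simp add: algebra_simps)
    finally show ?thesis .
  qed
  then obtain c where c: "\<And>z. D z = c"
    using has_field_derivative_zero_constant[of UNIV D] by auto
  have "K \<rho> t w = D (of_real \<rho>) + T * (tail 0 w + \<Psi> (- w))" for \<rho>
    by (simp add: K_def A_def J_def \<Phi>(2) \<Psi>(2) D_def algebra_simps)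
  then show ?thesis by (simp add: c)
qed

text \<open>The radius \<open>e\<^sup>\<rho> = \<epsilon>\<close> gives the exponential rate \<open>\<epsilon>\<close>.\<close>

lemma K_growth:
  assumes \<epsilon>: "\<epsilon> > 0"
  shows "\<exists>C R. \<forall>t w. exp w = t + of_real a \<and> \<bar>Im w\<bar> \<le> 3 * pi / 2 \<and> R \<le> norm t \<longrightarrow>
    norm (K 0 t w) \<le> C * exp (\<epsilon> * norm t)"
proof -
  define \<rho> where "\<rho> = ln \<epsilon>"
  have e\<rho>: "exp \<rho> = \<epsilon>" using \<epsilon> by (simp add: \<rho>_def)
  obtain N where N: "N \<ge> 0" "\<And>v. \<bar>Im v\<bar> \<le> 3 * pi / 2 \<Longrightarrow> \<rho> \<le> Re v \<Longrightarrow> norm (P v) \<le> N"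
    using P_bound[of \<rho>] by blast
  \<comment> \<open>\<open>J\<close> grows with \<open>\<bar>t + a\<bar>\<close> instead of \<open>\<bar>t\<bar>\<close>, which costs the factor \<open>exp (\<epsilon> * a)\<close>.\<close>
  define C where "C = exp (\<epsilon> * a) * (7 * N + norm T * (N * (\<bar>\<rho>\<bar> + 1 / \<epsilon> + 1) + 5 * N))"
  have "norm (K 0 t w) \<le> C * exp (\<epsilon> * norm t)"
    if t: "exp w = t + of_real a" "\<bar>Im w\<bar> \<le> 3 * pi / 2" "a + 1 \<le> norm t" for t w
  proof -
    define X where "X = exp (\<epsilon> * (norm t + a))"
    have X1: "X \<ge> 1" using \<epsilon> a by (simp add: X_def)
    have nt: "1 \<le> norm (exp w)" "norm (exp w) \<le> norm t + a"
      using t norm_triangle_ineq2[of t "- of_real a"] norm_triangle_ineq[of t "of_real a"] a by auto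
    have "Re w \<ge> 0" using nt(1) by simp
    moreover have "Re w \<le> norm (exp w)" using exp_ge_add_one_self[of "Re w"] unfolding norm_exp_eq_Re by linarith
    ultimately have "\<bar>Re w\<bar> \<le> norm t + a" using nt(2) by linarith
    also have "\<dots> \<le> 1 / \<epsilon> * X"
    proof -
      have "\<epsilon> * (norm t + a) \<le> X"
        using exp_ge_add_one_self[of "\<epsilon> * (norm t + a)"] unfolding X_def by linarith
      then show ?thesis using \<epsilon> by (simp add: field_simps)
    qed
    finally have re: "\<bar>Re w\<bar> \<le> 1 / \<epsilon> * X" .
    have ew: "exp (exp \<rho> * norm (exp w)) \<le> X"
      using nt \<epsilon> unfolding X_def e\<rho> by (simp del: norm_exp_eq_Re)
    have et: "exp (exp \<rho> * norm t) \<le> X" using \<epsilon> a by (simp add: X_def e\<rho>)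
    have "norm (J \<rho> w) \<le> N * (\<bar>\<rho>\<bar> + \<bar>Re w\<bar> + 1) + 5 * N * exp (exp \<rho> * norm (exp w))"
      by (rule J_bound[OF N(2,1) t(2)])
    also have "\<dots> \<le> N * (\<bar>\<rho>\<bar> * X + 1 / \<epsilon> * X + X) + 5 * N * X"
      using N(1) re ew X1 mult_left_mono[OF X1, of "\<bar>\<rho>\<bar>"] by (intro add_mono mult_left_mono) auto
    also have "\<dots> = (N * (\<bar>\<rho>\<bar> + 1 / \<epsilon> + 1) + 5 * N) * X" by (simp add: algebra_simps)
    finally have J: "norm (J \<rho> w) \<le> (N * (\<bar>\<rho>\<bar> + 1 / \<epsilon> + 1) + 5 * N) * X" .
    have "norm (A \<rho> t) \<le> 7 * N * exp (exp \<rho> * norm t)" by (rule A_bound[OF N(2,1)])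
    also have "\<dots> \<le> 7 * N * X" using N(1) et by (intro mult_left_mono) auto
    finally have A: "norm (A \<rho> t) \<le> 7 * N * X" .
    have "norm (K \<rho> t w) \<le> 7 * N * X + norm T * ((N * (\<bar>\<rho>\<bar> + 1 / \<epsilon> + 1) + 5 * N) * X)"
      unfolding K_def using A J by (intro norm_triangle_le add_mono) (auto simp: norm_mult intro!: mult_left_mono)
    also have "\<dots> = C * exp (\<epsilon> * norm t)"
      unfolding C_def X_def by (simp add: exp_add algebra_simps)
    finally show ?thesis using K_indep[OF t(2,1), of 0 \<rho>] by simp
  qed
  then show ?thesis by blast
qed

lemma tail_jump:
  assumes s: "s > 0"
  shows "tail (\<rho> + ln s) (of_real (ln s) + pi * \<i>) - tail (\<rho> + ln s) (of_real (ln s) - pi * \<i>) =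
    - T * tail (\<rho> + ln (s + a)) (of_real (ln (s + a)))"
proof -
  define b where "b = \<rho> + ln s"
  define f where "f x = of_real (exp (- exp x)) * P (of_real x - of_real (ln (s + a)))" for x :: real
  define g where "g \<epsilon> x = of_real (exp (- exp x)) * P (of_real x - (of_real (ln s) + \<epsilon> * (pi * \<i>)))" for \<epsilon> :: complex and x :: real
  have gi: "set_integrable lborel {b..} (g 1)" "set_integrable lborel {b..} (g (-1))"
    unfolding g_def by (intro tail_integrable; simp)+
  have "tail b (of_real (ln s) + pi * \<i>) - tail b (of_real (ln s) - pi * \<i>) = (LBINT x:{b..}. g 1 x - g (-1) x)"
    using set_integral_diff(2)[OF gi] by (simp add: tail_def g_def)
  also have "\<dots> = (LBINT x:{b..}. - T * f (x + (ln (s + a) - ln s)))"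
  proof (rule set_lebesgue_integral_cong)
    show "\<forall>x. x \<in> {b..} \<longrightarrow> g 1 x - g (-1) x = - T * f (x + (ln (s + a) - ln s))"
    proof (intro allI impI)
      fix x :: real
      define z where "z = complex_of_real (x - ln s)"
      have x: "x = ln s + (x - ln s)" by simp
      have "exp x + a * exp (x - ln s) = exp (x - ln s) * (s + a)"
        using s by (simp add: exp_diff field_simps)
      also have "\<dots> = exp (x + (ln (s + a) - ln s))"
        using s a by (simp add: exp_diff exp_add)
      finally have ex: "exp (x + (ln (s + a) - ln s)) = exp x + a * exp (x - ln s)" ..
      have "exp (- (of_real a * exp z)) = of_real (exp (- (a * exp (x - ln s))))"
        by (simp only: z_def exp_of_real flip: of_real_mult of_real_minus)
      moreover have "exp (- exp (x + (ln (s + a) - ln s))) = exp (- exp x) * exp (- (a * exp (x - ln s)))"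
        unfolding ex by (simp flip: exp_add)
      moreover have "P (z + pi * \<i>) = P (z - pi * \<i>) + T * exp (- (of_real a * exp z)) * P z" by (rule P_fun)
      ultimately show "g 1 x - g (-1) x = - T * f (x + (ln (s + a) - ln s))"
        by (simp add: g_def f_def z_def algebra_simps)
    qed
  qed simp
  also have "\<dots> = - T * (LBINT x:{b..}. f (x + (ln (s + a) - ln s)))" by (rule set_integral_mult_right)
  also have "(LBINT x:{b..}. f (x + (ln (s + a) - ln s))) = (LBINT x:{\<rho> + ln (s + a)..}. f x)"
    unfolding set_lebesgue_integral_def
    by (subst lborel_integral_real_affine[where c = 1 and t = "ln (s + a) - ln s"])
      (auto simp: b_def indicator_def add.commute intro!: Bochner_Integration.integral_cong)
  finally show ?thesis unfolding tail_def b_def f_def .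
qed

text \<open>
  On the two banks of \<open>s < 0\<close> the paths of \<open>J\<close> start at the same point, run along opposite half
  circles, and go off along the two banks of the negative axis.  Their difference is therefore the
  Hankel contour itself, with reversed orientation.
\<close>

lemma J_jump:
  assumes s: "s > 0"
  shows "J 0 (of_real (ln s) + pi * \<i>) - J 0 (of_real (ln s) - pi * \<i>) = - K 0 (of_real s) (of_real (ln (s + a)))"
proof -
  have e: "exp (of_real (ln s) + pi * \<i>) = - of_real s" "exp (of_real (ln s) - pi * \<i>) = - of_real s"
    using s by (simp_all add: exp_add exp_diff exp_of_real)
  have "J 0 (of_real (ln s) + pi * \<i>) = tail (ln s) (of_real (ln s) + pi * \<i>) + seg 0 (- (pi * \<i>)) (- of_real s)"
    using J_eq[of "of_real (ln s) + pi * \<i>" 0 "ln s"] by (simp add: e)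
  moreover have "J 0 (of_real (ln s) - pi * \<i>) = tail (ln s) (of_real (ln s) - pi * \<i>) + seg 0 (pi * \<i>) (- of_real s)"
    using J_eq[of "of_real (ln s) - pi * \<i>" 0 "ln s"] by (simp add: e)
  moreover have "J 0 (of_real (ln (s + a))) = tail (ln (s + a)) (of_real (ln (s + a)))"
    using J_eq[of "of_real (ln (s + a))" 0 "ln (s + a)"] by (simp add: seg_def)
  moreover obtain \<Phi> where \<Phi>: "\<And>p q. seg p q (- of_real s) = \<Phi> q - \<Phi> p"
    by (rule seg_primitive[of "- of_real s"]) (rule that, assumption+)
  ultimately show ?thesis
    using tail_jump[OF s, of 0] by (simp add: K_def A_def \<Phi>)
qed

text \<open>The factor \<open>1 / (2 \<pi> i)\<close> normalises the Borel transform.\<close>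

definition F :: "complex \<Rightarrow> complex" where
  "F t = (if t \<in> cut_plane a then K 0 t (Ln (t + of_real a)) / (2 * pi * \<i>) else 0)"

lemma shifted_cut_plane: "t \<in> cut_plane a \<longleftrightarrow> t + of_real a \<notin> \<real>\<^sub>\<le>\<^sub>0"
  by (auto simp: cut_plane_iff complex_nonpos_Reals_iff)

lemma Im_Ln_cut: "z \<noteq> 0 \<Longrightarrow> \<bar>Im (Ln z)\<bar> \<le> 3 * pi / 2"
  using mpi_less_Im_Ln[of z] Im_Ln_le_pi[of z] by (simp add: abs_le_iff)

lemma K_Ln_holomorphic:
  assumes "S \<subseteq> cut_plane a"
  shows "(\<lambda>t. K 0 t (Ln (t + of_real a))) holomorphic_on S"
proof -
  have L: "(\<lambda>t. Ln (t + of_real a)) holomorphic_on S"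
    using assms shifted_cut_plane by (intro holomorphic_intros) auto
  have "J 0 \<circ> (\<lambda>t. Ln (t + of_real a)) holomorphic_on S"
  proof (rule holomorphic_on_compose_gen[OF L J_holomorphic])
    show "(\<lambda>t. Ln (t + of_real a)) ` S \<subseteq> (Im_strip (- (3 * pi / 2)) (3 * pi / 2))"
    proof clarify
      fix t assume "t \<in> S"
      then have "t + of_real a \<noteq> 0" using assms shifted_cut_plane[of t] by auto
      then show "- (3 * pi / 2) < Im (Ln (t + of_real a)) \<and> Im (Ln (t + of_real a)) < 3 * pi / 2"
        using mpi_less_Im_Ln[of "t + of_real a"] Im_Ln_le_pi[of "t + of_real a"] pi_gt_zero by auto
    qed
  qed
  then show ?thesis
    using holomorphic_on_subset[OF A_holomorphic, of S] unfolding K_def comp_def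
    by (intro holomorphic_intros) auto
qed

lemma F_holomorphic: "F holomorphic_on cut_plane a"
proof -
  have "(\<lambda>t. K 0 t (Ln (t + of_real a)) / (2 * pi * \<i>)) holomorphic_on cut_plane a"
    by (intro holomorphic_intros K_Ln_holomorphic) auto
  then show ?thesis by (rule holomorphic_transform) (simp add: F_def)
qed

text \<open>
  The continuations of \<open>F\<close> from the upper (\<open>d = 1\<close>) and the lower (\<open>d = - 1\<close>) half plane to the
  half plane \<open>Re t < - a\<close>, on which \<open>\<bar>arg (t + a) - d \<pi>\<bar> < \<pi>/2\<close>.
\<close>

definition bank :: "complex \<Rightarrow> complex \<Rightarrow> complex" where
  "bank d t = K 0 t (Ln (- t - of_real a) + d * (pi * \<i>)) / (2 * pi * \<i>)"

lemma bank_arg: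
  assumes "Re t < - a" and d: "d = 1 \<or> d = - 1"
  shows "exp (Ln (- t - of_real a) + d * (pi * \<i>)) = t + of_real a"
    "\<bar>Im (Ln (- t - of_real a) + d * (pi * \<i>))\<bar> < 3 * pi / 2"
proof -
  have re: "Re (- t - of_real a) > 0" using assms by simp
  then have "- t - of_real a \<noteq> 0" by (metis less_irrefl zero_complex.simps(1))
  then show "exp (Ln (- t - of_real a) + d * (pi * \<i>)) = t + of_real a"
    using d by (auto simp: exp_add exp_minus)
  have "\<bar>Im (Ln (- t - of_real a))\<bar> < pi / 2"
    using Re_Ln_pos_lt[of "- t - of_real a"] re \<open>- t - of_real a \<noteq> 0\<close> by simp
  then show "\<bar>Im (Ln (- t - of_real a) + d * (pi * \<i>))\<bar> < 3 * pi / 2"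
    using d by auto
qed

lemma bank_holomorphic:
  assumes d: "d = 1 \<or> d = - 1"
  shows "bank d holomorphic_on {t. Re t < - a}"
proof -
  have L: "(\<lambda>t. Ln (- t - of_real a) + d * (pi * \<i>)) holomorphic_on {t. Re t < - a}"
    by (intro holomorphic_intros) (auto simp: complex_nonpos_Reals_iff)
  have "J 0 \<circ> (\<lambda>t. Ln (- t - of_real a) + d * (pi * \<i>)) holomorphic_on {t. Re t < - a}"
  proof (rule holomorphic_on_compose_gen[OF L J_holomorphic], rule image_subsetI)
    fix t assume "t \<in> {t. Re t < - a}"
    then have "\<bar>Im (Ln (- t - of_real a) + d * (pi * \<i>))\<bar> < 3 * pi / 2"
      by (intro bank_arg(2) d) simp
    then show "Ln (- t - of_real a) + d * (pi * \<i>) \<in> (Im_strip (- (3 * pi / 2)) (3 * pi / 2))"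
      unfolding abs_less_iff mem_Collect_eq by linarith
  qed
  then show ?thesis
    using holomorphic_on_subset[OF A_holomorphic, of "{t. Re t < - a}"] unfolding bank_def[abs_def] K_def comp_def
    by (intro holomorphic_intros) auto
qed

lemma bank_eq_F:
  assumes "Re t < - a"
  shows "Im t > 0 \<Longrightarrow> bank 1 t = F t" "Im t < 0 \<Longrightarrow> bank (-1) t = F t"
proof -
  have nz: "- t - of_real a \<noteq> 0" using assms by (auto simp: complex_eq_iff)
  have m: "t + of_real a = - (- t - of_real a)" by simp
  show "bank 1 t = F t" if "Im t > 0"
    using that nz unfolding bank_def F_def cut_plane_iff m Ln_minus[OF nz] by (simp add: mult.commute)
  show "bank (-1) t = F t" if "Im t < 0"
    using that nz unfolding bank_def F_def cut_plane_iff m Ln_minus[OF nz] by (simp add: mult.commute)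
qed

text \<open>\<open>J_jump\<close> gives this on the cut, and both sides are holomorphic around the cut.\<close>

lemma bank_jump:
  assumes "Re t < - a"
  shows "bank 1 t = bank (-1) t - T * F (- of_real a - t)"
proof (rule holomorphic_eq_from_line[where f = "bank 1" and g = "\<lambda>t. bank (-1) t - T * F (- of_real a - t)"
      and S = "{t. Re t < - a}" and ?z0.0 = "of_real (- a - 1)" and e = 1])
  show "(\<lambda>t. bank (-1) t - T * F (- of_real a - t)) holomorphic_on {t. Re t < - a}"
  proof -
    have "F \<circ> (\<lambda>t. - of_real a - t) holomorphic_on {t. Re t < - a}"
      by (rule holomorphic_on_compose_gen[OF _ F_holomorphic]) (use a in \<open>auto intro!: holomorphic_intros simp: cut_plane_iff\<close>)
    then show ?thesis unfolding comp_def by (intro holomorphic_intros bank_holomorphic) auto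
  qed
  fix t assume t: "t \<in> {t. Re t < - a}" "Im t = Im (of_real (- a - 1))"
  define s where "s = - a - Re t"
  have s: "s > 0" "t = of_real (- a - s)" "- of_real a - t = of_real s"
    using t by (auto simp: s_def complex_eq_iff)
  have L: "Ln (- t - of_real a) = of_real (ln s)" "Ln (of_real s + of_real a) = of_real (ln (s + a))"
  proof -
    have "- t - of_real a = of_real s" "of_real s + of_real a = complex_of_real (s + a)" using s(2) by simp_all
    then show "Ln (- t - of_real a) = of_real (ln s)" "Ln (of_real s + of_real a) = of_real (ln (s + a))"
      using s(1) a by (simp_all only: Ln_of_real add_pos_pos)
  qed
  have "of_real s \<in> cut_plane a" using s(1) a by (simp add: cut_plane_iff)
  then have F: "F (- of_real a - t) = K 0 (of_real s) (of_real (ln (s + a))) / (2 * pi * \<i>)"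
    unfolding s(3) F_def L by simp
  have "bank 1 t - bank (-1) t =
      T * (J 0 (of_real (ln s) + pi * \<i>) - J 0 (of_real (ln s) - pi * \<i>)) / (2 * pi * \<i>)"
    by (simp add: bank_def L K_def algebra_simps diff_divide_distrib add_divide_distrib)
  also have "\<dots> = - T * F (- of_real a - t)"
    unfolding J_jump[OF s(1)] F by simp
  finally show "bank 1 t = bank (-1) t - T * F (- of_real a - t)" by (simp add: algebra_simps)
qed (use assms bank_holomorphic in \<open>auto simp: open_halfspace_Re_lt convex_connected convex_halfspace_Re_lt\<close>)

definition B :: "complex \<Rightarrow> complex" where
  "B t = (if Im t < 0 then F t else if Im t > 0 then F t + T * F (- of_real a - t) else bank (-1) t)"

lemma B_eq_bank: "Re t < - a \<Longrightarrow> B t = bank (-1) t"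
  using bank_eq_F(2)[of t] bank_eq_F(1)[of t, symmetric] by (simp add: B_def bank_jump)

lemma B_holomorphic: "B holomorphic_on {t. Im t \<noteq> 0 \<or> Re t < - a}"
proof -
  have "B holomorphic_on {t. Re t < - a}"
    by (rule holomorphic_transform[OF bank_holomorphic[of "-1"]]) (simp_all add: B_eq_bank)
  moreover have "B holomorphic_on {t. Im t < 0}"
  proof (rule holomorphic_transform)
    show "F holomorphic_on {t. Im t < 0}"
      by (rule holomorphic_on_subset[OF F_holomorphic]) (auto simp: cut_plane_iff)
  qed (simp add: B_def)
  moreover have "B holomorphic_on {t. Im t > 0}"
  proof (rule holomorphic_transform)
    have "F \<circ> (\<lambda>t. - of_real a - t) holomorphic_on {t. Im t > 0}"
      by (rule holomorphic_on_compose_gen[OF _ F_holomorphic]) (auto intro!: holomorphic_intros simp: cut_plane_iff)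
    moreover have "F holomorphic_on {t. Im t > 0}"
      by (rule holomorphic_on_subset[OF F_holomorphic]) (auto simp: cut_plane_iff)
    ultimately show "(\<lambda>t. F t + T * F (- of_real a - t)) holomorphic_on {t. Im t > 0}"
      unfolding comp_def by (intro holomorphic_intros)
  qed (simp add: B_def)
  ultimately have "B holomorphic_on ({t. Re t < - a} \<union> {t. Im t < 0}) \<union> {t. Im t > 0}"
    by (intro holomorphic_on_Un open_Un open_halfspace_Re_lt open_halfspace_Im_lt open_halfspace_Im_gt)
  then show ?thesis by (rule holomorphic_on_subset) auto
qed

lemma F_growth:
  assumes "\<epsilon> > 0"
  shows "\<exists>C R. \<forall>t\<in>cut_plane a. R \<le> norm t \<longrightarrow> norm (F t) \<le> C * exp (\<epsilon> * norm t)"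
proof -
  obtain C R where C: "\<And>t w. exp w = t + of_real a \<Longrightarrow> \<bar>Im w\<bar> \<le> 3 * pi / 2 \<Longrightarrow> R \<le> norm t \<Longrightarrow>
      norm (K 0 t w) \<le> C * exp (\<epsilon> * norm t)" using K_growth[OF assms] by blast
  have "norm (F t) \<le> (C / (2 * pi)) * exp (\<epsilon> * norm t)" if t: "t \<in> cut_plane a" "R \<le> norm t" for t
  proof -
    have "norm (K 0 t (Ln (t + of_real a))) \<le> C * exp (\<epsilon> * norm t)"
      using t shifted_cut_plane[of t] by (intro C Im_Ln_cut exp_Ln) auto
    then show ?thesis using t by (simp add: F_def norm_divide norm_mult divide_right_mono)
  qed
  then show ?thesis by blast
qed

lemma bank_growth:
  assumes "\<epsilon> > 0"
  shows "\<exists>C R. \<forall>t. Re t < - a \<and> R \<le> norm t \<longrightarrow> norm (bank (-1) t) \<le> C * exp (\<epsilon> * norm t)"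
proof -
  obtain C R where C: "\<And>t w. exp w = t + of_real a \<Longrightarrow> \<bar>Im w\<bar> \<le> 3 * pi / 2 \<Longrightarrow> R \<le> norm t \<Longrightarrow>
      norm (K 0 t w) \<le> C * exp (\<epsilon> * norm t)" using K_growth[OF assms] by blast
  have "norm (bank (-1) t) \<le> (C / (2 * pi)) * exp (\<epsilon> * norm t)" if t: "Re t < - a" "R \<le> norm t" for t
  proof -
    have "norm (K 0 t (Ln (- t - of_real a) + (-1) * (pi * \<i>))) \<le> C * exp (\<epsilon> * norm t)"
      using bank_arg[OF t(1), of "-1"] t by (intro C) auto
    then show ?thesis unfolding bank_def by (simp add: norm_divide norm_mult divide_right_mono)
  qed
  then show ?thesis by blast
qed

sublocale two_branches a T F B
proof
  show "\<exists>C R. \<forall>t. Im t \<le> 0 \<and> (Im t \<noteq> 0 \<or> Re t < - a) \<and> R \<le> norm t \<longrightarrow>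
      norm (B t) \<le> C * exp (\<epsilon> * norm t)" if "\<epsilon> > 0" for \<epsilon>
  proof -
    obtain C R where 1: "\<And>t. t \<in> cut_plane a \<Longrightarrow> R \<le> norm t \<Longrightarrow> norm (F t) \<le> C * exp (\<epsilon> * norm t)"
      using F_growth[OF \<open>\<epsilon> > 0\<close>] by blast
    obtain C' R' where 2: "\<And>t. Re t < - a \<Longrightarrow> R' \<le> norm t \<Longrightarrow> norm (bank (-1) t) \<le> C' * exp (\<epsilon> * norm t)"
      using bank_growth[OF \<open>\<epsilon> > 0\<close>] by blast
    have "norm (B t) \<le> max C C' * exp (\<epsilon> * norm t)"
      if t: "Im t \<le> 0" "Im t \<noteq> 0 \<or> Re t < - a" "max R R' \<le> norm t" for t
    proof (cases "Im t = 0")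
      case True
      then have "norm (B t) \<le> C' * exp (\<epsilon> * norm t)" using 2[of t] t by (simp add: B_def)
      also have "\<dots> \<le> max C C' * exp (\<epsilon> * norm t)" by (intro mult_right_mono) auto
      finally show ?thesis .
    next
      case False
      then have "norm (B t) \<le> C * exp (\<epsilon> * norm t)" using 1[of t] t by (simp add: B_def cut_plane_iff)
      also have "\<dots> \<le> max C C' * exp (\<epsilon> * norm t)" by (intro mult_right_mono) auto
      finally show ?thesis .
    qed
    then show ?thesis by blast
  qed
qed (use a F_holomorphic B_holomorphic F_growth in \<open>auto simp: B_def\<close>)

text \<open>
  On the disc in question \<open>\<bar>log (t + a)\<bar>\<close> exceeds \<open>1\<close>, so the bounded terms can be absorbed.
\<close>

lemma F_bigo:
  "F \<in> O[at (- of_real a) within (cut_plane a \<inter> ball (- of_real a) a)](\<lambda>t. Ln (t + of_real a))"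
proof -
  obtain N where N: "N \<ge> 0" "\<And>v. \<bar>Im v\<bar> \<le> 3 * pi / 2 \<Longrightarrow> 0 \<le> Re v \<Longrightarrow> norm (P v) \<le> N"
    using P_bound[of 0] by blast
  define C where "C = (7 * N * exp (a + 1) + norm T * (2 * N + 5 * N * exp 1)) / (2 * pi)"
  have "norm (F t) \<le> C * norm (Ln (t + of_real a))"
    if t: "t \<in> cut_plane a" "norm (t + of_real a) < exp (- 1)" for t
  proof -
    define w where "w = Ln (t + of_real a)"
    have nz: "t + of_real a \<noteq> 0" using t(1) shifted_cut_plane[of t] by auto
    have w: "exp w = t + of_real a" "\<bar>Im w\<bar> \<le> 3 * pi / 2" using nz Im_Ln_cut by (auto simp: w_def)
    have "exp (Re w) < exp (- 1)" using t(2) unfolding norm_exp_eq_Re[symmetric] w(1) .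
    then have re: "Re w < - 1" by simp
    have lw: "\<bar>Re w\<bar> \<le> norm w" by (rule abs_Re_le_cmod)
    have w1: "norm w \<ge> 1" using re lw by linarith
    have n1: "norm (exp w) \<le> 1" using re by simp
    have "norm t \<le> a + 1"
      using norm_triangle_ineq[of "exp w" "- of_real a"] n1 a w(1) by (simp del: norm_exp_eq_Re)
    have "norm (J 0 w) \<le> N * (\<bar>0\<bar> + \<bar>Re w\<bar> + 1) + 5 * N * exp (exp 0 * norm (exp w))"
      by (rule J_bound[OF N(2,1) w(2)])
    also have "\<dots> \<le> N * (2 * norm w) + (5 * N * exp 1) * norm w"
    proof (rule add_mono)
      show "N * (\<bar>0\<bar> + \<bar>Re w\<bar> + 1) \<le> N * (2 * norm w)" using lw w1 N(1) by (intro mult_left_mono) auto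
      have "exp (exp 0 * norm (exp w)) \<le> exp 1" using n1 by (simp del: norm_exp_eq_Re)
      then have "5 * N * exp (exp 0 * norm (exp w)) \<le> 5 * N * exp 1" using N(1) by (intro mult_left_mono) auto
      also have "\<dots> \<le> (5 * N * exp 1) * norm w" using w1 N(1) mult_left_mono[of 1 "norm w" "5 * N * exp 1"] by simp
      finally show "5 * N * exp (exp 0 * norm (exp w)) \<le> (5 * N * exp 1) * norm w" .
    qed
    finally have J: "norm (J 0 w) \<le> (2 * N + 5 * N * exp 1) * norm w" by (simp add: algebra_simps)
    have "norm (A 0 t) \<le> 7 * N * exp (exp 0 * norm t)" by (rule A_bound[OF N(2,1)])
    also have "\<dots> \<le> 7 * N * exp (a + 1)" using N(1) \<open>norm t \<le> a + 1\<close> by (intro mult_left_mono) auto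
    also have "\<dots> \<le> 7 * N * exp (a + 1) * norm w"
      using w1 N(1) mult_left_mono[of 1 "norm w" "7 * N * exp (a + 1)"] by simp
    finally have A: "norm (A 0 t) \<le> 7 * N * exp (a + 1) * norm w" .
    have "norm (K 0 t w) \<le> 7 * N * exp (a + 1) * norm w + norm T * ((2 * N + 5 * N * exp 1) * norm w)"
      unfolding K_def using A J by (intro norm_triangle_le add_mono) (auto simp: norm_mult intro!: mult_left_mono)
    also have "\<dots> = 2 * pi * (C * norm w)" by (simp add: C_def field_simps)
    finally show ?thesis using t(1)
      by (simp add: F_def norm_divide norm_mult field_simps flip: w_def)
  qed
  moreover have "\<forall>\<^sub>F t in at (- of_real a) within (cut_plane a \<inter> ball (- of_real a) a).
      t \<in> cut_plane a \<and> norm (t + of_real a) < exp (- 1)"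
    unfolding eventually_at by (intro exI[of _ "exp (- 1)"]) (auto simp: dist_norm)
  ultimately show ?thesis
    by (intro bigoI[of _ C]) (auto elim: eventually_mono)
qed

lemma F_bank_limits:
  assumes s: "s > 0"
  shows "(F \<longlongrightarrow> bank 1 (of_real (- a - s))) (at (of_real (- a - s)) within {t. Im t > 0})"
    "(F \<longlongrightarrow> bank (-1) (of_real (- a - s))) (at (of_real (- a - s)) within {t. Im t < 0})"
proof -
  let ?p = "complex_of_real (- a - s)"
  have lim: "(bank d \<longlongrightarrow> bank d ?p) (at ?p within X)" if "d = 1 \<or> d = - 1" for d X
  proof -
    have "isCont (bank d) ?p"
      using holomorphic_on_imp_continuous_on[OF bank_holomorphic[OF that]] s
      by (subst (asm) continuous_on_eq_continuous_at) (auto simp: open_halfspace_Re_lt)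
    then show ?thesis using continuous_at_imp_continuous_at_within continuous_within by blast
  qed
  have near: "\<forall>\<^sub>F t in at ?p within X. t \<in> X \<and> Re t < - a" for X
  proof -
    have "\<forall>\<^sub>F t in nhds ?p. t \<in> {t. Re t < - a}"
      by (rule eventually_nhds_in_open[OF open_halfspace_Re_lt]) (use s in simp)
    then show ?thesis by (auto simp: eventually_at_filter elim: eventually_mono)
  qed
  show "(F \<longlongrightarrow> bank 1 ?p) (at ?p within {t. Im t > 0})"
    by (rule Lim_transform_eventually[OF lim]) (use near[of "{t. Im t > 0}"] bank_eq_F in \<open>auto elim: eventually_mono\<close>)
  show "(F \<longlongrightarrow> bank (-1) ?p) (at ?p within {t. Im t < 0})"
    by (rule Lim_transform_eventually[OF lim]) (use near[of "{t. Im t < 0}"] bank_eq_F in \<open>auto elim: eventually_mono\<close>)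
qed

lemma F_in_H: "F \<in> H_space a T"
proof -
  have "\<exists>u l. (F \<longlongrightarrow> u) (at (of_real (- a - s)) within {t. Im t > 0}) \<and>
        (F \<longlongrightarrow> l) (at (of_real (- a - s)) within {t. Im t < 0}) \<and>
        u = l - T * F (of_real s)" if s: "s > 0" for s
    using F_bank_limits[OF s] bank_jump[of "of_real (- a - s)"] s
    by (intro exI[of _ "bank 1 (of_real (- a - s))"] exI[of _ "bank (-1) (of_real (- a - s))"]) simp
  moreover have "\<exists>g. continuation_along \<gamma> F g" if "admissible_path a \<gamma>" for \<gamma>
    using continuation_exists[OF that] by blast
  ultimately show ?thesis
    unfolding H_space_def mem_Collect_eq
    by (intro conjI allI impI sector_continuation F_holomorphic F_bigo) (auto simp: F_def)
qed

end

section \<open>The Laplace transform of the Hankel integral\<close>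

lemma set_integral_FTC:
  fixes f G :: "real \<Rightarrow> complex"
  assumes "set_integrable lborel {a..b} f" "a \<le> b"
    and "\<And>x. a \<le> x \<Longrightarrow> x \<le> b \<Longrightarrow> (G has_vector_derivative f x) (at x)"
  shows "(LBINT x:{a..b}. f x) = G b - G a"
proof -
  have "(f has_integral (G b - G a)) {a..b}"
    by (rule fundamental_theorem_of_calculus[OF assms(2)])
      (use assms(3) in \<open>auto intro: has_vector_derivative_at_within\<close>)
  then show ?thesis using set_borel_integral_eq_integral(2)[OF assms(1)] by (simp add: integral_unique)
qed

lemma set_integral_FTC_at_top:
  fixes f G :: "real \<Rightarrow> complex"
  assumes f: "set_integrable lborel {a..} f"
    and G: "\<And>x. a \<le> x \<Longrightarrow> (G has_vector_derivative f x) (at x)"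
    and L: "(G \<longlongrightarrow> L) at_top"
  shows "(LBINT x:{a..}. f x) = L - G a"
proof (rule tendsto_unique[OF trivial_limit_at_top_linorder])
  show "((\<lambda>b. LBINT x:{a..b}. f x) \<longlongrightarrow> (LBINT x:{a..}. f x)) at_top"
    by (rule tendsto_set_lebesgue_integral_at_top[OF _ f]) simp
  have "\<forall>\<^sub>F b in at_top. G b - G a = (LBINT x:{a..b}. f x)"
    using eventually_ge_at_top[of a]
  proof eventually_elim
    case (elim b)
    have "set_integrable lborel {a..b} f" by (rule set_integrable_subset[OF f]) auto
    from set_integral_FTC[OF this elim, of G] G show ?case by simp
  qed
  moreover have "((\<lambda>b. G b - G a) \<longlongrightarrow> L - G a) at_top" by (intro tendsto_intros L)
  ultimately show "((\<lambda>b. LBINT x:{a..b}. f x) \<longlongrightarrow> L - G a) at_top" by (rule Lim_transform_eventually[rotated])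
qed

lemma exp_integral_complex:
  fixes q :: complex
  assumes "Re q > 0"
  shows "set_integrable lborel {0..} (\<lambda>t::real. exp (- q * of_real t))"
    "(LBINT t:{0::real..}. exp (- q * of_real t)) = 1 / q"
proof -
  show i: "set_integrable lborel {0..} (\<lambda>t::real. exp (- q * of_real t))"
  proof (rule set_integrable_dominated[OF set_integrable_exp_atLeast[OF assms]])
    show "set_borel_measurable lborel {0..} (\<lambda>t::real. exp (- q * of_real t))"
      unfolding set_borel_measurable_def by measurable
  qed simp
  have "(LBINT t:{0::real..}. exp (- q * of_real t)) = 0 - (- exp (- q * of_real 0) / q)"
  proof (rule set_integral_FTC_at_top[OF i])
    fix x :: real
    have "((\<lambda>z. - exp (- q * z) / q) has_field_derivative exp (- q * of_real x)) (at (of_real x))"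
      using assms by (auto intro!: derivative_eq_intros)
    from has_vector_derivative_real_field[OF this]
    show "((\<lambda>x. - exp (- q * of_real x) / q) has_vector_derivative exp (- q * of_real x)) (at x)" .
  next
    have "filterlim (\<lambda>t. Re q * t) at_top at_top"
      by (rule filterlim_tendsto_pos_mult_at_top[OF tendsto_const assms filterlim_ident])
    then have "filterlim (\<lambda>t. - (Re q * t)) at_bot at_top" by (simp add: filterlim_uminus_at_bot)
    then have "((\<lambda>t. exp (- (Re q * t))) \<longlongrightarrow> 0) at_top" by (rule filterlim_compose[OF exp_at_bot])
    then have "((\<lambda>t::real. exp (- q * of_real t)) \<longlongrightarrow> 0) at_top"
      by (rule Lim_null_comparison[rotated]) simp
    then show "((\<lambda>t::real. - exp (- q * of_real t) / q) \<longlongrightarrow> 0) at_top"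
      using tendsto_mult_right[OF tendsto_minus, of _ 0 at_top "1 / q"] by simp
  qed
  then show "(LBINT t:{0::real..}. exp (- q * of_real t)) = 1 / q" by simp
qed

text \<open>
  Superpositions of exponentials have the Laplace transform that Fubini's theorem predicts, as soon
  as \<open>\<zeta>\<close> lies to the right of all exponents.
\<close>

lemma laplace_of_exponential_integral:
  fixes c z :: "real \<Rightarrow> complex" and \<zeta> :: real
  assumes c: "integrable lborel c" and z [measurable]: "z \<in> borel_measurable borel"
    and bd: "\<And>u. c u \<noteq> 0 \<Longrightarrow> Re (z u) \<le> 1" and \<zeta>: "\<zeta> > 1"
  shows "set_integrable lborel {0..} (\<lambda>t. exp (- of_real \<zeta> * of_real t) * (LBINT u. exp (z u * of_real t) * c u))"
    "(LBINT t:{0..}. exp (- of_real \<zeta> * of_real t) * (LBINT u. exp (z u * of_real t) * c u)) =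
     (LBINT u. c u / (of_real \<zeta> - z u))"
proof -
  have cm [measurable]: "c \<in> borel_measurable borel" using borel_measurable_integrable[OF c] by simp
  define f where "f t u = indicator {0..} t *\<^sub>R (exp ((z u - of_real \<zeta>) * of_real t) * c u)" for t u :: real
  have fb: "norm (f t u) \<le> (indicator {0..} t * exp (- (\<zeta> - 1) * t)) * norm (c u)" for t u
  proof (cases "c u = 0 \<or> t < 0")
    case False
    then have "(Re (z u) - \<zeta>) * t \<le> - (\<zeta> - 1) * t"
      using bd[of u] by (intro mult_right_mono) auto
    then have "exp ((Re (z u) - \<zeta>) * t) \<le> exp (- (\<zeta> - 1) * t)" by (simp only: exp_le_cancel_iff)
    then show ?thesis using False by (simp add: f_def norm_mult mult_right_mono)
  qed (auto simp: f_def)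
  have ei: "integrable lborel (\<lambda>t. indicator {0..} t * exp (- (\<zeta> - 1) * t))"
    using set_integrable_exp_atLeast[of "\<zeta> - 1" 0] \<zeta> by (simp add: set_integrable_def)
  have fm: "case_prod f \<in> borel_measurable (lborel \<Otimes>\<^sub>M lborel)" unfolding f_def by measurable
  have fiu: "integrable lborel (f t)" for t
  proof (rule Bochner_Integration.integrable_bound)
    show "integrable lborel (\<lambda>u. (indicator {0..} t * exp (- (\<zeta> - 1) * t)) * norm (c u))"
      using c by (intro integrable_mult_right integrable_norm)
    show "f t \<in> borel_measurable lborel" unfolding f_def by measurable
  qed (use fb in \<open>auto intro!: AE_I2 simp: abs_mult\<close>)
  have fi: "integrable (lborel \<Otimes>\<^sub>M lborel) (case_prod f)"
  proof (rule lborel_pair.Fubini_integrable[OF fm])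
    show "integrable lborel (\<lambda>t. LBINT u. norm (case_prod f (t, u)))"
    proof (rule Bochner_Integration.integrable_bound)
      show "integrable lborel (\<lambda>t. (indicator {0..} t * exp (- (\<zeta> - 1) * t)) * (LBINT u. norm (c u)))"
        by (intro integrable_mult_left ei)
      show "(\<lambda>t. LBINT u. norm (case_prod f (t, u))) \<in> borel_measurable lborel"
        using fm by measurable
      show "AE t in lborel. norm (LBINT u. norm (case_prod f (t, u))) \<le>
          norm ((indicator {0..} t * exp (- (\<zeta> - 1) * t)) * (LBINT u. norm (c u)))"
      proof (rule AE_I2)
        fix t :: real
        have "(LBINT u. norm (f t u)) \<le> (LBINT u. (indicator {0..} t * exp (- (\<zeta> - 1) * t)) * norm (c u))"
          by (intro integral_mono fb integrable_norm fiu integrable_mult_right c)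
        then show "norm (LBINT u. norm (case_prod f (t, u))) \<le>
            norm ((indicator {0..} t * exp (- (\<zeta> - 1) * t)) * (LBINT u. norm (c u)))"
          by (simp add: abs_mult)
      qed
    qed
  qed (use fiu in simp)
  have inner: "(LBINT u. f t u) = indicator {0..} t *\<^sub>R
      (exp (- of_real \<zeta> * of_real t) * (LBINT u. exp (z u * of_real t) * c u))" for t
  proof -
    have "f t u = (indicator {0..} t *\<^sub>R exp (- of_real \<zeta> * of_real t)) * (exp (z u * of_real t) * c u)" for u
      by (simp add: f_def algebra_simps flip: exp_add)
    then show ?thesis by simp
  qed
  have outer: "(LBINT t. f t u) = c u / (of_real \<zeta> - z u)" for u
  proof (cases "c u = 0")
    case False
    have "(LBINT t. f t u) = (LBINT t:{0..}. exp (- (of_real \<zeta> - z u) * of_real t) * c u)"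
      unfolding set_lebesgue_integral_def f_def by (simp add: algebra_simps)
    also have "\<dots> = (LBINT t:{0::real..}. exp (- (of_real \<zeta> - z u) * of_real t)) * c u"
      by (rule set_integral_mult_left)
    also have "\<dots> = c u / (of_real \<zeta> - z u)"
      by (subst exp_integral_complex(2)) (use bd[OF False] \<zeta> in auto)
    finally show ?thesis .
  qed (simp add: f_def)
  show "set_integrable lborel {0..} (\<lambda>t. exp (- of_real \<zeta> * of_real t) * (LBINT u. exp (z u * of_real t) * c u))"
    using lborel_pair.integrable_fst'[OF fi] unfolding set_integrable_def inner[symmetric] by simp
  show "(LBINT t:{0..}. exp (- of_real \<zeta> * of_real t) * (LBINT u. exp (z u * of_real t) * c u)) =
     (LBINT u. c u / (of_real \<zeta> - z u))"
    using lborel_pair.Fubini_integral[OF fi] unfolding outer inner set_lebesgue_integral_def by simp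
qed

lemma halfline_growth:
  fixes F :: "complex \<Rightarrow> complex"
  assumes a: "a > 0" and F: "F holomorphic_on cut_plane a"
    and growth: "\<And>\<epsilon>. \<epsilon> > 0 \<Longrightarrow> \<exists>K R. \<forall>t\<in>cut_plane a. R \<le> norm t \<longrightarrow> norm (F t) \<le> K * exp (\<epsilon> * norm t)"
  shows "set_borel_measurable lborel {0..} (\<lambda>t. F (of_real t))"
    "\<epsilon> > 0 \<Longrightarrow> \<exists>K. \<forall>t\<ge>0. norm (F (of_real t)) \<le> K * exp (\<epsilon> * t)"
proof -
  have c: "continuous_on {0..} (\<lambda>t. F (of_real t))"
    by (rule continuous_on_compose2[OF holomorphic_on_imp_continuous_on[OF F]])
      (use a in \<open>auto intro!: continuous_intros simp: cut_plane_iff\<close>)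
  then show "set_borel_measurable lborel {0..} (\<lambda>t. F (of_real t))"
    unfolding set_borel_measurable_def by (auto intro: borel_measurable_continuous_on_indicator)
  show "\<exists>K. \<forall>t\<ge>0. norm (F (of_real t)) \<le> K * exp (\<epsilon> * t)" if \<epsilon>: "\<epsilon> > 0"
  proof -
    obtain K R where K: "\<And>t. t \<in> cut_plane a \<Longrightarrow> R \<le> norm t \<Longrightarrow> norm (F t) \<le> K * exp (\<epsilon> * norm t)"
      using growth[OF \<epsilon>] by blast
    have "bounded ((\<lambda>t. F (of_real t)) ` {0..R})"
      by (intro compact_imp_bounded compact_continuous_image continuous_on_subset[OF c]) auto
    then obtain C where "\<forall>x\<in>(\<lambda>t. F (of_real t)) ` {0..R}. norm x \<le> C"
      unfolding bounded_iff by (elim exE)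
    then have C: "norm (F (of_real t)) \<le> C" if "t \<in> {0..R}" for t using that by simp
    have "norm (F (of_real t)) \<le> max K C * exp (\<epsilon> * t)" if "t \<ge> 0" for t
    proof (cases "t \<le> R")
      case True
      then have "norm (F (of_real t)) \<le> C" using C that by auto
      also have "C \<le> C * exp (\<epsilon> * t)"
        using order_trans[OF norm_ge_zero C[of t]] True that \<epsilon> mult_left_mono[of 1 "exp (\<epsilon> * t)" C] by simp
      also have "\<dots> \<le> max K C * exp (\<epsilon> * t)" by (intro mult_right_mono) auto
      finally show ?thesis .
    next
      case False
      then have "norm (F (of_real t)) \<le> K * exp (\<epsilon> * t)"
        using K[of "of_real t"] that a by (simp add: cut_plane_iff)
      also have "\<dots> \<le> max K C * exp (\<epsilon> * t)" by (intro mult_right_mono) auto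
      finally show ?thesis .
    qed
    then show ?thesis by blast
  qed
qed

context borel_data
begin

text \<open>
  On the half line \<open>t \<ge> 0\<close> the two parts of the Hankel integral for the unit circle are
  superpositions of exponentials \<open>e\<^sup>z\<^sup>(\<^sup>u\<^sup>)\<^sup>t\<close> with densities \<open>c(u)\<close>: index \<open>1\<close> is the circle and
  index \<open>2\<close> the two banks combined.
\<close>

definition c1 :: "real \<Rightarrow> complex" where "c1 u = indicator {- pi..pi} u *\<^sub>R (\<i> * P (\<i> * of_real u))"
definition z1 :: "real \<Rightarrow> complex" where "z1 u = exp (\<i> * of_real u)"
definition c2 :: "real \<Rightarrow> complex" where
  "c2 u = indicator {0..} u *\<^sub>R (of_real (exp (- (a * exp u))) * P (of_real u))"
definition z2 :: "real \<Rightarrow> complex" where "z2 u = - of_real (exp u)"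

lemma c1_integrable: "integrable lborel c1"
proof -
  have "set_integrable lborel {- pi..pi} (\<lambda>u. \<i> * P (\<i> * of_real u))"
    by (intro borel_integrable_atLeastAtMost' continuous_intros)
  then show ?thesis by (simp add: set_integrable_def c1_def[abs_def])
qed

lemma c2_integrable: "integrable lborel c2"
proof -
  obtain N where N: "N \<ge> 0" "\<And>v. \<bar>Im v\<bar> \<le> 3 * pi / 2 \<Longrightarrow> 0 \<le> Re v \<Longrightarrow> norm (P v) \<le> N"
    using P_bound[of 0] by blast
  have "set_integrable lborel {0..} (\<lambda>u. of_real (exp (- (a * exp u))) * P (of_real u))"
  proof (rule set_integrable_dominated)
    show "set_integrable lborel {0..} (\<lambda>u. N * exp (- a * u))"
      using a by (intro set_integrable_mult_right set_integrable_exp_atLeast)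
    show "set_borel_measurable lborel {0..} (\<lambda>u. of_real (exp (- (a * exp u))) * P (of_real u))"
      unfolding set_borel_measurable_def by measurable
    fix u :: real assume u: "u \<in> {0..}"
    have "a * u \<le> a * exp u" using a exp_ge_add_one_self[of u] by (intro mult_left_mono) linarith+
    then have "exp (- (a * exp u)) * norm (P (of_real u)) \<le> exp (- a * u) * N"
      using N(2)[of "of_real u"] u by (intro mult_mono) auto
    then show "norm (of_real (exp (- (a * exp u))) * P (of_real u)) \<le> N * exp (- a * u)"
      by (simp add: norm_mult mult.commute)
  qed
  then show ?thesis by (simp add: set_integrable_def c2_def[abs_def])
qed

lemma A_as_integral: "A 0 (of_real t) = (LBINT u. exp (z1 u * of_real t) * c1 u)"
proof -
  obtain \<Phi> where \<Phi>: "\<And>v. (\<Phi> has_field_derivative exp (- exp v * - of_real t) * P v) (at v)"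
    "\<And>p q. seg p q (- of_real t) = \<Phi> q - \<Phi> p" by (rule seg_primitive[of "- of_real t"]) (rule that, assumption+)
  have "(LBINT u:{- pi..pi}. (\<i> * 1) * (exp (- exp (\<i> * of_real u) * - of_real t) * P (\<i> * of_real u))) =
      \<Phi> (\<i> * of_real pi) - \<Phi> (\<i> * of_real (- pi))"
  proof (rule set_integral_FTC)
    show "set_integrable lborel {- pi..pi} (\<lambda>u. (\<i> * 1) * (exp (- exp (\<i> * of_real u) * - of_real t) * P (\<i> * of_real u)))"
      by (intro borel_integrable_atLeastAtMost' continuous_intros)
    fix u :: real
    have "((\<lambda>u. \<i> * of_real u) has_vector_derivative (\<i> * 1)) (at u)"
      by (auto intro!: derivative_eq_intros)
    from field_vector_diff_chain_at[OF this \<Phi>(1)]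
    show "((\<lambda>u. \<Phi> (\<i> * of_real u)) has_vector_derivative
        (\<i> * 1) * (exp (- exp (\<i> * of_real u) * - of_real t) * P (\<i> * of_real u))) (at u)"
      by (simp only: comp_def)
  qed simp
  moreover have "(LBINT u. exp (z1 u * of_real t) * c1 u) =
      (LBINT u:{- pi..pi}. (\<i> * 1) * (exp (- exp (\<i> * of_real u) * - of_real t) * P (\<i> * of_real u)))"
    unfolding set_lebesgue_integral_def
    by (rule Bochner_Integration.integral_cong) (simp_all add: c1_def z1_def mult_ac)
  ultimately show ?thesis by (simp add: A_def \<Phi>(2) mult.commute)
qed

lemma J_as_integral:
  assumes t: "t \<ge> 0"
  shows "J 0 (of_real (ln (t + a))) = (LBINT u. exp (z2 u * of_real t) * c2 u)"
proof -
  define l where "l = ln (t + a)"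
  have el: "exp l = t + a" using t a by (simp add: l_def)
  have "J 0 (of_real l) = tail l (of_real l)"
    using J_eq[of "of_real l" 0 l] by (simp add: seg_def)
  also have "\<dots> = (LBINT u. indicator {l..} (l + 1 * u) *\<^sub>R (of_real (exp (- exp (l + 1 * u))) * P (of_real (l + 1 * u) - of_real l)))"
    unfolding tail_def set_lebesgue_integral_def
    by (subst lborel_integral_real_affine[where c = 1 and t = l]) auto
  also have "\<dots> = (LBINT u. exp (z2 u * of_real t) * c2 u)"
  proof (rule Bochner_Integration.integral_cong[OF refl])
    fix u :: real
    have "exp (- exp (l + u)) = exp (- (exp u * t)) * exp (- (a * exp u))"
      unfolding exp_add el by (simp add: algebra_simps flip: exp_add)
    then have "of_real (exp (- exp (l + u))) = exp (z2 u * of_real t) * of_real (exp (- (a * exp u)))"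
      by (simp add: z2_def flip: exp_of_real)
    then show "indicator {l..} (l + 1 * u) *\<^sub>R (of_real (exp (- exp (l + 1 * u))) * P (of_real (l + 1 * u) - of_real l)) =
        exp (z2 u * of_real t) * c2 u"
      by (auto simp: c2_def indicator_def)
  qed
  finally show ?thesis by (simp add: l_def)
qed

lemma F_as_integral:
  assumes t: "t \<ge> 0"
  shows "2 * pi * \<i> * F (of_real t) =
    (LBINT u. exp (z1 u * of_real t) * c1 u) + T * (LBINT u. exp (z2 u * of_real t) * c2 u)"
proof -
  have "Ln (of_real t + of_real a) = of_real (ln (t + a))"
    using t a by (simp add: Ln_of_real flip: of_real_add)
  moreover have "of_real t \<in> cut_plane a" using t a by (simp add: cut_plane_iff)
  ultimately show ?thesis
    by (simp add: F_def K_def A_as_integral J_as_integral[OF t])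
qed

lemma laplace_F_as_integral:
  assumes "\<zeta> > 1"
  shows "2 * pi * \<i> * (LBINT t:{0..}. exp (- of_real \<zeta> * of_real t) * F (of_real t)) =
    (LBINT u. c1 u / (of_real \<zeta> - z1 u)) + T * (LBINT u. c2 u / (of_real \<zeta> - z2 u))"
proof -
  have m: "z1 \<in> borel_measurable borel" "z2 \<in> borel_measurable borel"
    unfolding z1_def z2_def by measurable
  have b1: "Re (z1 u) \<le> 1" for u by (simp add: z1_def Re_exp)
  have b2: "Re (z2 u) \<le> 1" for u using exp_gt_zero[of u] by (simp add: z2_def order_trans[of _ 0])
  note L1 = laplace_of_exponential_integral[OF c1_integrable m(1) b1 assms]
  note L2 = laplace_of_exponential_integral[OF c2_integrable m(2) b2 assms]
  have "2 * pi * \<i> * (LBINT t:{0..}. exp (- of_real \<zeta> * of_real t) * F (of_real t)) =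
      (LBINT t:{0..}. 2 * pi * \<i> * (exp (- of_real \<zeta> * of_real t) * F (of_real t)))"
    by (rule set_integral_mult_right[symmetric])
  also have "\<dots> = (LBINT t:{0..}. exp (- of_real \<zeta> * of_real t) * (LBINT u. exp (z1 u * of_real t) * c1 u) +
      T * (exp (- of_real \<zeta> * of_real t) * (LBINT u. exp (z2 u * of_real t) * c2 u)))"
  proof (rule set_lebesgue_integral_cong)
    show "\<forall>t. t \<in> {0..} \<longrightarrow> 2 * pi * \<i> * (exp (- of_real \<zeta> * of_real t) * F (of_real t)) =
        exp (- of_real \<zeta> * of_real t) * (LBINT u. exp (z1 u * of_real t) * c1 u) +
        T * (exp (- of_real \<zeta> * of_real t) * (LBINT u. exp (z2 u * of_real t) * c2 u))"
    proof (intro allI impI)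
      fix t :: real assume "t \<in> {0..}"
      then have "exp (- of_real \<zeta> * of_real t) * (2 * pi * \<i> * F (of_real t)) =
          exp (- of_real \<zeta> * of_real t) * ((LBINT u. exp (z1 u * of_real t) * c1 u) + T * (LBINT u. exp (z2 u * of_real t) * c2 u))"
        using F_as_integral[of t] by simp
      then show "2 * pi * \<i> * (exp (- of_real \<zeta> * of_real t) * F (of_real t)) =
        exp (- of_real \<zeta> * of_real t) * (LBINT u. exp (z1 u * of_real t) * c1 u) +
        T * (exp (- of_real \<zeta> * of_real t) * (LBINT u. exp (z2 u * of_real t) * c2 u))"
        by (simp only: distrib_left mult_ac)
    qed
  qed simp
  also have "\<dots> = (LBINT u. c1 u / (of_real \<zeta> - z1 u)) + T * (LBINT u. c2 u / (of_real \<zeta> - z2 u))"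
    using set_integral_add(2)[OF L1(1) set_integrable_mult_right[OF L2(1), of T]] L1(2) L2(2) by simp
  finally show ?thesis .
qed

text \<open>
  The Cauchy kernel in the coordinate \<open>v\<close>, with its pole at \<open>v0\<close> removed by subtracting \<open>P v0\<close>.  In
  the strip \<open>\<bar>Im v\<bar> < 2 \<pi>\<close> there is no other pole, and the strip contains the contour
  including both banks.
\<close>

lemma quotient_primitive:
  assumes v0: "Im v0 = 0"
  obtains h \<Psi> where
    "\<And>v. \<bar>Im v\<bar> < 2 * pi \<Longrightarrow> (\<Psi> has_field_derivative h v) (at v)"
    "\<And>v. exp v \<noteq> exp v0 \<Longrightarrow> h v = exp v0 * (P v - P v0) / (exp v0 - exp v)"
proof -
  let ?S = "Im_strip (- (2 * pi)) (2 * pi)"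
  define hP where "hP v = (if v = v0 then deriv P v0 else (P v - P v0) / (v - v0))" for v
  define hE where "hE v = (if v = v0 then deriv exp v0 else (exp v - exp v0) / (v - v0))" for v :: complex
  have v0S: "v0 \<in> interior ?S"
    using v0 open_Im_strip[of "- (2 * pi)" "2 * pi"] by (simp add: interior_open)
  have "hP holomorphic_on ?S" unfolding hP_def
    by (rule pole_lemma[OF holomorphic_on_subset[OF P_hol] v0S]) simp
  moreover have "hE holomorphic_on ?S" unfolding hE_def
    by (rule pole_lemma[OF _ v0S]) (intro holomorphic_intros)
  moreover have "hE v \<noteq> 0" if "v \<in> ?S" for v
  proof (cases "v = v0")
    case True
    then show ?thesis by (simp add: hE_def DERIV_imp_deriv[OF DERIV_exp])
  next
    case False
    have "exp v \<noteq> exp v0"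
    proof
      assume "exp v = exp v0"
      then obtain n :: int where n: "v = v0 + of_real (2 * of_int n * pi) * \<i>" unfolding exp_eq by auto
      then have "Im v = 2 * of_int n * pi" using v0 by simp
      then have "\<bar>of_int n * (2 * pi)\<bar> < 1 * (2 * pi)" using that by (simp add: abs_less_iff mult_ac)
      then have "\<bar>real_of_int n\<bar> < 1" unfolding abs_mult by simp
      then have "n = 0" by linarith
      then show False using n False by simp
    qed
    then show ?thesis using False by (simp add: hE_def)
  qed
  ultimately have hol: "(\<lambda>v. - exp v0 * hP v / hE v) holomorphic_on ?S"
    by (intro holomorphic_intros) auto
  obtain \<Psi> where \<Psi>: "\<And>v. v \<in> ?S \<Longrightarrow> (\<Psi> has_field_derivative - exp v0 * hP v / hE v) (at v within ?S)"
    using holomorphic_convex_primitive'[OF convex_Im_strip open_Im_strip hol] by blast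
  show thesis
  proof (rule that)
    fix v assume "\<bar>Im v\<bar> < 2 * pi"
    then have v: "v \<in> ?S" by auto
    show "(\<Psi> has_field_derivative - exp v0 * hP v / hE v) (at v)"
      using \<Psi>[OF v] unfolding at_within_open[OF v open_Im_strip] .
  next
    fix v assume "exp v \<noteq> exp v0"
    moreover from this have "v \<noteq> v0" by auto
    ultimately show "- exp v0 * hP v / hE v = exp v0 * (P v - P v0) / (exp v0 - exp v)"
      by (simp add: hP_def hE_def divide_simps) (simp add: algebra_simps)
  qed
qed

text \<open>
  The Cauchy integral over the Hankel contour, which runs around \<open>\<zeta>\<close> if closed by a large circle.
  After subtraction of the constant \<open>P v0\<close> the integral is a difference of a primitive \<open>\<Psi>\<close> between
  the two ends of the contour, which vanishes at infinity because the kernel does; the constant itself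
  contributes on the circle only, since the two banks cancel for it.
\<close>

lemma residue_at_pole:
  assumes \<zeta>: "\<zeta> > 1"
  shows "of_real \<zeta> * ((LBINT u. c1 u / (of_real \<zeta> - z1 u)) + T * (LBINT u. c2 u / (of_real \<zeta> - z2 u))) =
    2 * pi * \<i> * P (of_real (ln \<zeta>))"
proof -
  define v0 where "v0 = complex_of_real (ln \<zeta>)"
  have ev0: "exp v0 = of_real \<zeta>" using \<zeta> by (simp add: v0_def exp_of_real)
  obtain h \<Psi> where \<Psi>: "\<And>v. \<bar>Im v\<bar> < 2 * pi \<Longrightarrow> (\<Psi> has_field_derivative h v) (at v)"
    and h: "\<And>v. exp v \<noteq> exp v0 \<Longrightarrow> h v = exp v0 * (P v - P v0) / (exp v0 - exp v)"
    by (rule quotient_primitive[of v0]) (simp add: v0_def, rule that, assumption+)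
  have hE: "h v = of_real \<zeta> * (P v - P v0) / (of_real \<zeta> - exp v)" if "exp v \<noteq> of_real \<zeta>" for v
    using h[of v] that by (simp add: ev0)
  define E where "E = \<Psi> (\<i> * of_real pi) - \<Psi> (- (\<i> * of_real pi))"

  have I1: "of_real \<zeta> * (LBINT u. c1 u / (of_real \<zeta> - z1 u)) = E + 2 * pi * \<i> * P v0"
  proof -
    define G where "G z = \<Psi> z + P v0 * (z - Ln (of_real \<zeta> - exp z))" for z
    define g where "g z = of_real \<zeta> * P z / (of_real \<zeta> - exp z)" for z
    have re: "Re (of_real \<zeta> - exp z) > 0" if "Re z = 0" for z
    proof -
      have "Re (exp z) \<le> 1" using that by (simp add: Re_exp)
      then show ?thesis using \<zeta> by simp
    qed
    have dG: "(G has_field_derivative g z) (at z)" if z: "Re z = 0" "\<bar>Im z\<bar> < 2 * pi" for z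
    proof -
      have nz: "of_real \<zeta> - exp z \<noteq> 0" using re[OF z(1)] by (metis less_irrefl zero_complex.simps(1))
      have nn: "of_real \<zeta> - exp z \<notin> \<real>\<^sub>\<le>\<^sub>0" using re[OF z(1)] by (auto simp: complex_nonpos_Reals_iff)
      have "(G has_field_derivative h z + P v0 * (1 - (0 - exp z) / (of_real \<zeta> - exp z))) (at z)"
        unfolding G_def[abs_def]
        by (intro derivative_intros \<Psi> z) (use nn in \<open>auto intro!: derivative_eq_intros simp: field_simps\<close>)
      also have "h z + P v0 * (1 - (0 - exp z) / (of_real \<zeta> - exp z)) = g z"
        using nz hE[of z] by (simp add: g_def divide_simps) (simp add: algebra_simps)
      finally show ?thesis .
    qed
    have cg: "continuous_on {- pi..pi} (\<lambda>u. \<i> * g (\<i> * of_real u))"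
    proof -
      have nz: "of_real \<zeta> - exp (\<i> * of_real u) \<noteq> 0" for u :: real
        using re[of "\<i> * of_real u"] by (metis less_irrefl zero_complex.simps(1) mult_zero_left Re_i_times Im_complex_of_real neg_0_equal_iff_equal)
      show ?thesis unfolding g_def using nz by (intro continuous_intros) auto
    qed
    have "(LBINT u:{- pi..pi}. \<i> * g (\<i> * of_real u)) = G (\<i> * of_real pi) - G (\<i> * of_real (- pi))"
    proof (rule set_integral_FTC)
      show "set_integrable lborel {- pi..pi} (\<lambda>u. \<i> * g (\<i> * of_real u))"
        by (rule borel_integrable_atLeastAtMost'[OF cg])
      fix u :: real assume u: "- pi \<le> u" "u \<le> pi"
      have "((\<lambda>u. \<i> * of_real u) has_vector_derivative \<i>) (at u)"
        by (auto intro!: derivative_eq_intros)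
      moreover have "(G has_field_derivative g (\<i> * of_real u)) (at (\<i> * of_real u))"
      proof (rule dG)
        have "\<bar>u\<bar> < 2 * pi" using u pi_gt_zero by linarith
        then show "\<bar>Im (\<i> * of_real u)\<bar> < 2 * pi" by simp
      qed simp
      ultimately show "((\<lambda>u. G (\<i> * of_real u)) has_vector_derivative \<i> * g (\<i> * of_real u)) (at u)"
        using field_vector_diff_chain_at[of "\<lambda>u. \<i> * of_real u" \<i> u G] by (simp only: comp_def)
    qed simp
    also have "G (\<i> * of_real pi) - G (\<i> * of_real (- pi)) = E + 2 * pi * \<i> * P v0"
      by (simp add: G_def E_def exp_minus algebra_simps)
    also have "(LBINT u:{- pi..pi}. \<i> * g (\<i> * of_real u)) = of_real \<zeta> * (LBINT u. c1 u / (of_real \<zeta> - z1 u))"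
      unfolding set_lebesgue_integral_def integral_mult_right_zero[symmetric]
      by (rule Bochner_Integration.integral_cong) (simp_all add: g_def c1_def z1_def scaleR_conv_of_real mult_ac)
    finally show ?thesis .
  qed

  have I2: "of_real \<zeta> * (T * (LBINT u. c2 u / (of_real \<zeta> - z2 u))) = - E"
  proof -
    define k where "k u = of_real \<zeta> * (T * (of_real (exp (- (a * exp u))) * P (of_real u) / (of_real \<zeta> - z2 u)))" for u :: real
    define G where "G u = \<Psi> (of_real u + pi * \<i>) - \<Psi> (of_real u - pi * \<i>)" for u :: real
    have zp: "of_real \<zeta> - z2 u = of_real (\<zeta> + exp u)" "\<zeta> + exp u > 1" for u
      using \<zeta> by (simp_all add: z2_def add_pos_pos less_add_same_cancel1 order_less_trans[OF \<zeta>])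
    have k: "k u = h (of_real u + pi * \<i>) - h (of_real u - pi * \<i>)" for u
    proof -
      have e: "exp (of_real u + pi * \<i>) = - of_real (exp u)" "exp (of_real u - pi * \<i>) = - of_real (exp u)"
        by (simp_all add: exp_add exp_diff exp_of_real)
      have nz: "complex_of_real (\<zeta> + exp u) \<noteq> 0" using zp(2)[of u] unfolding of_real_eq_0_iff by linarith
      have ne: "- of_real (exp u) \<noteq> complex_of_real \<zeta>"
        using nz by (metis add.commute add_eq_0_iff of_real_add)
      have hh: "h (of_real u + pi * \<i>) = of_real \<zeta> * (P (of_real u + pi * \<i>) - P v0) / of_real (\<zeta> + exp u)"
        "h (of_real u - pi * \<i>) = of_real \<zeta> * (P (of_real u - pi * \<i>) - P v0) / of_real (\<zeta> + exp u)"
        using hE[of "of_real u + pi * \<i>"] hE[of "of_real u - pi * \<i>"] ne unfolding e by simp_all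
      have "exp (- (of_real a * exp (of_real u))) = complex_of_real (exp (- (a * exp u)))"
        by (simp flip: exp_of_real)
      then have P': "P (of_real u + pi * \<i>) = P (of_real u - pi * \<i>) + T * of_real (exp (- (a * exp u))) * P (of_real u)"
        using P_fun[of "of_real u"] by simp
      show ?thesis
        unfolding k_def hh zp(1) diff_divide_distrib[symmetric] P' by (simp add: algebra_simps)
    qed
    have ki: "set_integrable lborel {0..} k"
    proof -
      have c2i: "set_integrable lborel {0..} (\<lambda>u. of_real (exp (- (a * exp u))) * P (of_real u))"
        using c2_integrable by (simp add: set_integrable_def c2_def[abs_def])
      have "set_integrable lborel {0..} (\<lambda>u. of_real (exp (- (a * exp u))) * P (of_real u) / (of_real \<zeta> - z2 u))"
      proof (rule set_integrable_dominated)
        show "set_integrable lborel {0..} (\<lambda>u. norm (of_real (exp (- (a * exp u))) * P (of_real u)))"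
          by (rule set_integrable_norm[OF c2i])
        show "set_borel_measurable lborel {0..} (\<lambda>u. of_real (exp (- (a * exp u))) * P (of_real u) / (of_real \<zeta> - z2 u))"
          unfolding set_borel_measurable_def z2_def by measurable
        fix u :: real
        have "norm (of_real \<zeta> - z2 u) \<ge> 1" using zp(2)[of u] unfolding zp(1) norm_of_real by linarith
        then show "norm (of_real (exp (- (a * exp u))) * P (of_real u) / (of_real \<zeta> - z2 u)) \<le>
            norm (of_real (exp (- (a * exp u))) * P (of_real u))"
          unfolding norm_divide
            using mult_left_mono[of 1 "norm (of_real \<zeta> - z2 u)" "norm (of_real (exp (- (a * exp u))) * P (of_real u))"]
            by (subst pos_divide_le_eq) auto
      qed
      then show ?thesis unfolding k_def by (intro set_integrable_mult_right)
    qed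
    have dG: "(G has_vector_derivative k u) (at u)" for u
    proof -
      have "((\<lambda>u. of_real u + d) has_vector_derivative 1) (at u)" for d :: complex
        by (auto intro!: derivative_eq_intros)
      note d = this
      have 1: "((\<lambda>u. \<Psi> (of_real u + pi * \<i>)) has_vector_derivative h (of_real u + pi * \<i>)) (at u)"
        using field_vector_diff_chain_at[OF d[of "pi * \<i>"] \<Psi>, of ] by (simp add: comp_def)
      have 2: "((\<lambda>u. \<Psi> (of_real u + - (pi * \<i>))) has_vector_derivative h (of_real u + - (pi * \<i>))) (at u)"
        using field_vector_diff_chain_at[OF d[of "- (pi * \<i>)"] \<Psi>, of ] by (simp add: comp_def)
      show ?thesis unfolding G_def[abs_def] k
        using has_vector_derivative_diff[OF 1 2] by simp
    qed
    have lim: "(G \<longlongrightarrow> 0) at_top"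
    proof -
      obtain N where N: "N \<ge> 0" "\<And>v. \<bar>Im v\<bar> \<le> 3 * pi / 2 \<Longrightarrow> 0 \<le> Re v \<Longrightarrow> norm (P v) \<le> N"
        using P_bound[of 0] by blast
      have Gb: "norm (G u) \<le> \<zeta> * (2 * N) / (exp u - \<zeta>) * (2 * pi)" if u: "u > ln \<zeta>" for u
      proof -
        have u0: "u > 0" using u \<zeta> ln_gt_zero[of \<zeta>] by linarith
        have eu: "exp u > \<zeta>" using u \<zeta> by (metis exp_less_cancel_iff exp_ln less_trans zero_less_one)
        define C where "C = {v. Re v = u \<and> Im v \<le> pi \<and> - pi \<le> Im v}"
        have cC: "convex C"
        proof -
          have C: "C = {v. 1 \<bullet> v = u} \<inter> ({v. \<i> \<bullet> v \<le> pi} \<inter> {v. \<i> \<bullet> v \<ge> - pi})"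
            unfolding C_def inner_complex_def by (simp add: set_eq_iff)
          show ?thesis unfolding C
            by (rule convex_Int[OF convex_hyperplane convex_Int[OF convex_halfspace_le convex_halfspace_ge]])
        qed
        have "norm (\<Psi> (of_real u + pi * \<i>) - \<Psi> (of_real u - pi * \<i>)) \<le>
            \<zeta> * (2 * N) / (exp u - \<zeta>) * norm ((of_real u + pi * \<i>) - (of_real u - pi * \<i>))"
        proof (rule field_differentiable_bound[OF cC])
          fix v assume "v \<in> C"
          then have "Re v = u" "Im v \<le> pi" "- pi \<le> Im v" by (simp_all add: C_def)
          then have v: "Re v = u" "\<bar>Im v\<bar> \<le> pi" "\<bar>Im v\<bar> < 2 * pi" "\<bar>Im v\<bar> \<le> 3 * pi / 2"
            using pi_gt_zero by linarith+
          show "(\<Psi> has_field_derivative h v) (at v within C)"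
            by (rule has_field_derivative_at_within[OF \<Psi>[OF v(3)]])
          have nv: "norm (exp v) = exp u" using v by simp
          have nev: "exp v \<noteq> of_real \<zeta>"
          proof
            assume e: "exp v = of_real \<zeta>"
            have "norm (exp v) = \<zeta>" unfolding e using \<zeta> by simp
            then show False using nv eu by simp
          qed
          have d: "exp u - \<zeta> \<le> norm (of_real \<zeta> - exp v)"
            using norm_triangle_ineq2[of "exp v" "of_real \<zeta>"] \<zeta> unfolding nv by (simp add: norm_minus_commute)
          have "norm (P v - P v0) \<le> 2 * N"
            using N(2)[of v] N(2)[of v0] v u0 \<zeta> norm_triangle_ineq4[of "P v" "P v0"] pi_gt_zero
            by (simp add: v0_def)
          then have "norm (of_real \<zeta> * (P v - P v0)) \<le> \<zeta> * (2 * N)"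
            using \<zeta> by (simp add: norm_mult)
          then show "norm (h v) \<le> \<zeta> * (2 * N) / (exp u - \<zeta>)"
            unfolding hE[OF nev] norm_divide using d eu \<zeta> N(1) by (intro frac_le) auto
        qed (auto simp: C_def)
        also have "(of_real u + pi * \<i>) - (of_real u - pi * \<i>) = of_real (2 * pi) * \<i>" by (simp add: complex_eq_iff)
        also have "norm (of_real (2 * pi) * \<i>) = 2 * pi" unfolding norm_mult by simp
        finally show ?thesis unfolding G_def .
      qed
      have "filterlim (\<lambda>u. - \<zeta> + exp u) at_top at_top"
        by (rule filterlim_tendsto_add_at_top[OF tendsto_const exp_at_top])
      then have "filterlim (\<lambda>u. exp u - \<zeta>) at_infinity at_top"
        using filterlim_at_top_imp_at_infinity by simp
      then have "((\<lambda>u. \<zeta> * (2 * N) / (exp u - \<zeta>)) \<longlongrightarrow> 0) at_top"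
        by (rule tendsto_divide_0[OF tendsto_const])
      then have "((\<lambda>u. \<zeta> * (2 * N) / (exp u - \<zeta>) * (2 * pi)) \<longlongrightarrow> 0) at_top"
        by (rule tendsto_mult_left_zero)
      then show ?thesis
        by (rule Lim_null_comparison[rotated]) (rule eventually_mono[OF eventually_gt_at_top[of "ln \<zeta>"] Gb])
    qed
    have "(LBINT u:{0..}. k u) = 0 - G 0"
      by (rule set_integral_FTC_at_top[OF ki dG lim])
    moreover have "(LBINT u:{0..}. k u) = of_real \<zeta> * (T * (LBINT u. c2 u / (of_real \<zeta> - z2 u)))"
      unfolding set_lebesgue_integral_def integral_mult_right_zero[symmetric]
      by (rule Bochner_Integration.integral_cong) (simp_all add: k_def c2_def scaleR_conv_of_real mult_ac)
    moreover have "G 0 = E" by (simp add: G_def E_def mult.commute)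
    ultimately show ?thesis by simp
  qed
  show ?thesis unfolding distrib_left I1 I2 by (simp add: v0_def)
qed

lemma is_laplace_F: "is_laplace F P"
proof -
  have g1: "set_borel_measurable lborel {0..} (\<lambda>t. F (of_real t))"
    by (rule halfline_growth(1)[OF a F_holomorphic F_growth])
  have g2: "\<exists>K. \<forall>t\<ge>0. norm (F (of_real t)) \<le> K * exp (\<epsilon> * t)" if "\<epsilon> > 0" for \<epsilon>
    by (rule halfline_growth(2)[OF a F_holomorphic F_growth that])
  have eq: "P w = exp w * (LBINT t:{0..}. exp (- exp w * of_real t) * F (of_real t))"
    if w: "\<bar>Im w\<bar> < pi / 2" for w
  proof (rule holomorphic_eq_from_line[where f = P and S = "Im_strip (- (pi / 2)) (pi / 2)"
        and g = "\<lambda>w. exp w * (LBINT t:{0..}. exp (- exp w * of_real t) * F (of_real t))"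
        and ?z0.0 = 2 and e = 1])
    show "(\<lambda>w. exp w * (LBINT t:{0..}. exp (- exp w * of_real t) * F (of_real t)))
        holomorphic_on (Im_strip (- (pi / 2)) (pi / 2))"
      by (rule laplace_transform_holomorphic[OF g1 g2])
    fix w assume w: "w \<in> (Im_strip (- (pi / 2)) (pi / 2))" "Im w = Im 2" "dist w 2 < 1"
    define \<zeta> where "\<zeta> = exp (Re w)"
    have "Re w > 0" using abs_Re_le_cmod[of "w - 2"] w(3) by (simp add: dist_norm)
    then have \<zeta>: "\<zeta> > 1" by (simp add: \<zeta>_def)
    have wz: "w = of_real (ln \<zeta>)" "exp w = of_real \<zeta>"
      using w(2) by (simp_all add: \<zeta>_def complex_eq_iff Re_exp Im_exp)
    have "2 * pi * \<i> * (of_real \<zeta> * (LBINT t:{0..}. exp (- of_real \<zeta> * of_real t) * F (of_real t))) =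
        2 * pi * \<i> * P (of_real (ln \<zeta>))"
      using residue_at_pole[OF \<zeta>] laplace_F_as_integral[OF \<zeta>] by (simp add: mult.left_commute)
    then show "P w = exp w * (LBINT t:{0..}. exp (- exp w * of_real t) * F (of_real t))"
      using wz by simp
  next
    show "P holomorphic_on (Im_strip (- (pi / 2)) (pi / 2))"
      by (rule holomorphic_on_subset[OF P_hol]) simp
    show "w \<in> (Im_strip (- (pi / 2)) (pi / 2))" using w by auto
    show "open (Im_strip (- (pi / 2)) (pi / 2))" by (rule open_Im_strip)
    show "connected (Im_strip (- (pi / 2)) (pi / 2))" by (rule connected_Im_strip)
  qed simp_all
  show ?thesis unfolding is_laplace_def
    using P_hol set_integrable_laplace[OF g1 g2] eq by blast
qed

end

section \<open>Rotated Laplace integrals of an element of H\<close>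

lemma continuation_along_const:
  assumes "continuation_along (\<lambda>_. p) f g"
  shows "\<forall>\<^sub>F t in nhds p. g 1 t = f t"
proof -
  define R where "R x y \<longleftrightarrow> (\<forall>\<^sub>F t in nhds p. g x t = g y t)" for x y
  have "R 0 1"
  proof (rule connected_equivalence_relation[of "{0..1::real}"])
    show "R y x" if "R x y" for x y using that unfolding R_def by eventually_elim simp
    show "R x z" if "R x y" "R y z" for x y z
      using that unfolding R_def by eventually_elim simp
    fix s :: real assume s: "s \<in> {0..1}"
    then have "\<forall>\<^sub>F s' in at s within {0..1}. \<forall>\<^sub>F t in nhds p. g s' t = g s t"
      using assms unfolding continuation_along_def by blast
    then obtain d where d: "d > 0" "\<And>s'. s' \<in> {0..1} \<Longrightarrow> s' \<noteq> s \<Longrightarrow> dist s' s < d \<Longrightarrow>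
        \<forall>\<^sub>F t in nhds p. g s' t = g s t"
      unfolding eventually_at by blast
    have "R s s'" if "s' \<in> {0..1} \<inter> ball s d" for s'
    proof (cases "s' = s")
      case False
      then have "\<forall>\<^sub>F t in nhds p. g s' t = g s t" using d(2)[of s'] that by (auto simp: dist_commute)
      then show ?thesis unfolding R_def by eventually_elim simp
    qed (simp add: R_def)
    then show "\<exists>T. openin (top_of_set {0..1}) T \<and> s \<in> T \<and> (\<forall>x\<in>T. R s x)"
      using s d(1) by (intro exI[of _ "{0..1} \<inter> ball s d"]) auto
  qed auto
  moreover have "\<forall>\<^sub>F t in nhds p. g 0 t = f t" using assms by (simp add: continuation_along_def)
  ultimately show ?thesis unfolding R_def by eventually_elim simp
qed

text \<open>
  An integrable majorant of the logarithm.  It depends on \<open>\<bar>t\<bar> - a\<close> alone, so it serves for all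
  rays that approach the cut.
\<close>

definition spike :: "real \<Rightarrow> real" where
  "spike y = (if \<bar>y\<bar> < 1 then \<bar>y\<bar> powr (- 1 / 2) else 0)"

lemma spike_nonneg: "spike y \<ge> 0" by (simp add: spike_def)

lemma spike_meas [measurable]: "spike \<in> borel_measurable borel"
  unfolding spike_def by measurable

lemma spike_integrable: "integrable lborel spike"
proof -
  have "(\<lambda>x::real. x powr (- 1 / 2)) integrable_on {0..1}"
    by (rule integrable_on_powr_from_0) auto
  then have "(\<lambda>x::real. x powr (- 1 / 2)) absolutely_integrable_on {0..1}"
    by (intro nonnegative_absolutely_integrable_1) auto
  then have i: "integrable lborel (\<lambda>x::real. indicator {0..1} x *\<^sub>R (x powr (- 1 / 2)))"
    unfolding set_integrable_def by (subst (asm) integrable_completion) auto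
  have i': "integrable lborel (\<lambda>x::real. indicator {0..1} (- x) *\<^sub>R ((- x) powr (- 1 / 2)))"
    using lborel_integrable_real_affine[OF i, of "-1" 0] by simp
  show ?thesis
  proof (rule Bochner_Integration.integrable_bound[OF Bochner_Integration.integrable_add[OF i i']])
    show "AE x in lborel. norm (spike x) \<le> norm (indicator {0..1} x *\<^sub>R (x powr (- 1 / 2)) +
        indicator {0..1} (- x) *\<^sub>R ((- x) powr (- 1 / 2)))"
      by (rule AE_I2) (auto simp: spike_def indicator_def abs_if)
  qed simp
qed

lemma norm_Ln_le_spike:
  assumes "0 < y" "y \<le> norm z" "norm z < 1"
  shows "norm (Ln z) \<le> 6 * spike y"
proof -
  have z: "z \<noteq> 0" using assms by auto
  have y: "y < 1" using assms by auto
  define x where "x = y powr (- 1 / 2)"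
  have x: "x > 0" "spike y = x" using assms(1) y by (auto simp: x_def spike_def)
  have lx: "ln x = - ln y / 2" using assms(1) by (simp add: x_def ln_powr)
  have "ln x \<le> x - 1" by (rule ln_le_minus_one[OF x(1)])
  then have ly: "- ln y \<le> 2 * x - 2" using lx by linarith
  have "ln y < 0" using assms(1) y by simp
  then have "ln x > 0" using lx by simp
  then have x1: "x > 1" using x(1) by simp
  have "ln y \<le> ln (norm z)" "ln (norm z) < 0" using assms z by auto
  then have "\<bar>ln (norm z)\<bar> \<le> 2 * x - 2" using ly by linarith
  moreover have "\<bar>Im (Ln z)\<bar> \<le> pi" using mpi_less_Im_Ln[OF z] Im_Ln_le_pi[OF z] by linarith
  moreover have "norm (Ln z) \<le> \<bar>Re (Ln z)\<bar> + \<bar>Im (Ln z)\<bar>" by (rule cmod_le)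
  ultimately have "norm (Ln z) \<le> 2 * x - 2 + pi" using z by simp
  \<comment> \<open>\<open>\<pi> < 4\<close> bounds the imaginary part of the logarithm by \<open>4 x\<close>.\<close>
  also have "\<dots> \<le> 6 * x" using x1 pi_less_4 by linarith
  finally show ?thesis using x by simp
qed

text \<open>
  The distance of a ray from \<open>- a\<close>, seen by projecting to the direction that bisects the angle
  between the ray and the positive axis.
\<close>

lemma norm_ray_plus_ge:
  assumes "\<rho> \<ge> 0" "\<bar>\<theta>\<bar> \<le> pi" "a > 0"
  shows "norm (of_real \<rho> * exp (\<i> * of_real \<theta>) + of_real a) \<ge> a * cos (\<theta> / 2)"
proof -
  let ?e = "exp (- (\<i> * of_real (\<theta> / 2)))"
  let ?h = "exp (\<i> * of_real (\<theta> / 2))"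
  have "exp (\<i> * of_real \<theta>) = ?h * ?h" "?h * ?e = 1" by (simp_all flip: exp_add)
  then have "(of_real \<rho> * exp (\<i> * of_real \<theta>) + of_real a) * ?e = of_real \<rho> * ?h * (?h * ?e) + of_real a * ?e"
    by (simp only:) (simp only: algebra_simps)
  also have "\<dots> = of_real \<rho> * ?h + of_real a * ?e" using \<open>?h * ?e = 1\<close> by simp
  finally have "(of_real \<rho> * exp (\<i> * of_real \<theta>) + of_real a) * ?e = of_real \<rho> * ?h + of_real a * ?e" .
  moreover have "Re (of_real \<rho> * ?h + of_real a * ?e) = (\<rho> + a) * cos (\<theta> / 2)"
    by (simp add: Re_exp algebra_simps)
  ultimately have "Re ((of_real \<rho> * exp (\<i> * of_real \<theta>) + of_real a) * ?e) = (\<rho> + a) * cos (\<theta> / 2)"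
    by (simp only:)
  moreover have "norm ((of_real \<rho> * exp (\<i> * of_real \<theta>) + of_real a) * ?e) =
      norm (of_real \<rho> * exp (\<i> * of_real \<theta>) + of_real a)"
    by (simp add: norm_mult)
  ultimately have "(\<rho> + a) * cos (\<theta> / 2) \<le> norm (of_real \<rho> * exp (\<i> * of_real \<theta>) + of_real a)"
    using complex_Re_le_cmod by metis
  moreover have "cos (\<theta> / 2) \<ge> 0" using assms(2) by (intro cos_ge_zero) auto
  ultimately show ?thesis using assms(1) by (auto simp: algebra_simps intro: order_trans[rotated])
qed

lemma ray_in_cut_plane:
  assumes "\<rho> \<ge> 0" "\<bar>\<theta>\<bar> < pi" "a > 0"
  shows "of_real \<rho> * exp (\<i> * of_real \<theta>) \<in> cut_plane a"
proof (cases "\<rho> = 0 \<or> \<theta> = 0")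
  case True
  then show ?thesis using assms by (auto simp: cut_plane_iff)
next
  case False
  have "sin \<theta> \<noteq> 0"
    using False assms(2) sin_gt_zero[of \<theta>] sin_gt_zero[of "- \<theta>"] by (cases "\<theta> > 0") auto
  then show ?thesis using False by (simp add: cut_plane_iff Im_exp)
qed

locale H_data =
  fixes a :: real and T :: complex and F :: "complex \<Rightarrow> complex"
  assumes a: "a > 0" and F: "F \<in> H_space a T"
begin

lemma F_hol: "F holomorphic_on cut_plane a" using F by (simp add: H_space_def)

lemma F_cont: "continuous_on A f \<Longrightarrow> f ` A \<subseteq> cut_plane a \<Longrightarrow> continuous_on A (\<lambda>x. F (f x))"
  using continuous_on_compose2[OF holomorphic_on_imp_continuous_on[OF F_hol]] by blast

lemmas sector_iff = mem_sector_iff[OF a]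

lemma exp_in_cut_plane: "\<bar>Im w\<bar> < pi \<Longrightarrow> exp w \<in> cut_plane a"
proof -
  assume "\<bar>Im w\<bar> < pi"
  then have "of_real (exp (Re w)) * exp (\<i> * of_real (Im w)) \<in> cut_plane a"
    using a by (intro ray_in_cut_plane) auto
  moreover have "exp w = of_real (exp (Re w)) * exp (\<i> * of_real (Im w))"
    by (simp only: exp_eq_polar[of w] cis_conv_exp)
  ultimately show ?thesis by (simp only:)
qed

text \<open>
  The sectorial condition for the sector \<open>\<bar>arg t\<bar> < 2 \<pi>\<close>, which contains the closed cut plane in
  \<open>\<bar>t\<bar> > a\<close>.  Thus \<open>F\<close> is bounded up to both banks of the cut, except near \<open>- a\<close>.
\<close>

lemma log_branch_exists:
  obtains G where "G holomorphic_on sector a (- (2 * pi)) (2 * pi)"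
    "minimal_type_on (sector a (- (2 * pi)) (2 * pi)) G"
    "\<And>w. ln a < Re w \<Longrightarrow> \<bar>Im w\<bar> < pi \<Longrightarrow> G w = F (exp w)"
proof -
  define w0 where "w0 = complex_of_real (ln (2 * a))"
  define p where "p = complex_of_real (2 * a)"
  have e0: "exp w0 = p" using a by (simp add: w0_def p_def exp_of_real)
  have lna: "ln a < Re w0" using a by (simp add: w0_def)
  have "path (\<lambda>_::real. p)" by (simp add: path_def)
  then have adm: "admissible_path a (\<lambda>_. p)"
    using a by (auto simp: admissible_path_def path_image_def pathstart_def cut_plane_iff p_def complex_eq_iff)
  have "w0 \<in> sector a (- (2 * pi)) (2 * pi)" using lna by (simp add: sector_iff w0_def)
  then obtain g G where g: "continuation_along (\<lambda>_. p) F g"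
    and G: "G holomorphic_on sector a (- (2 * pi)) (2 * pi)"
      "\<forall>\<^sub>F z in nhds w0. G z = g 1 (exp z)" "minimal_type_on (sector a (- (2 * pi)) (2 * pi)) G"
  proof -
    have "\<forall>\<gamma> \<alpha> \<beta> w. admissible_path a \<gamma> \<and> w \<in> sector a \<alpha> \<beta> \<and> exp w = pathfinish \<gamma> \<longrightarrow>
        (\<exists>g G. continuation_along \<gamma> F g \<and> G holomorphic_on sector a \<alpha> \<beta> \<and>
               (\<forall>\<^sub>F z in nhds w. G z = g 1 (exp z)) \<and> minimal_type_on (sector a \<alpha> \<beta>) G)"
      using F unfolding H_space_def mem_Collect_eq by (elim conjE)
    from this[THEN spec, THEN spec, THEN spec, THEN spec, THEN mp, of "\<lambda>_. p" w0 "- (2 * pi)" "2 * pi"] show ?thesis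
      using adm e0 \<open>w0 \<in> _\<close> that by (auto simp: pathfinish_def)
  qed
  have ic: "isCont exp w0" by (intro continuous_intros)
  have "filterlim exp (nhds (exp w0)) (nhds w0)"
    using ic by (simp add: isCont_def tendsto_at_iff_tendsto_nhds)
  then have lim: "filterlim exp (nhds p) (nhds w0)" unfolding e0 .
  have "\<forall>\<^sub>F z in nhds w0. g 1 (exp z) = F (exp z)"
    using continuation_along_const[OF g] lim unfolding filterlim_iff by blast
  with G(2) have "\<forall>\<^sub>F z in nhds w0. G z = F (exp z)" by eventually_elim simp
  then obtain e where e: "e > 0" "\<And>z. dist z w0 < e \<Longrightarrow> G z = F (exp z)"
    unfolding eventually_nhds_metric by blast
  have "G w = F (exp w)" if w: "ln a < Re w" "\<bar>Im w\<bar> < pi" for w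
  proof (rule holomorphic_eq_from_line[where f = G and g = "\<lambda>w. F (exp w)" and S = "sector a (- pi) pi" and ?z0.0 = w0 and e = e])
    have sec: "sector a (- pi) pi = {w. ln a < Re w} \<inter> (Im_strip (- pi) pi)"
      by (auto simp: sector_iff)
    show "G holomorphic_on sector a (- pi) pi"
      by (rule holomorphic_on_subset[OF G(1)]) (use pi_gt_zero in \<open>auto simp: sector_iff\<close>)
    have "F \<circ> exp holomorphic_on sector a (- pi) pi"
      by (rule holomorphic_on_compose_gen[OF _ F_hol])
        (auto intro!: holomorphic_intros exp_in_cut_plane simp: sector_iff)
    then show "(\<lambda>w. F (exp w)) holomorphic_on sector a (- pi) pi" by (simp add: comp_def)
    show "open (sector a (- pi) pi)" unfolding sec by (intro open_Int open_halfspace_Re_gt open_Im_strip)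
    show "connected (sector a (- pi) pi)" unfolding sec
      by (intro convex_connected convex_Int convex_halfspace_Re_gt convex_Im_strip)
  qed (use w e lna in \<open>auto simp: sector_iff w0_def abs_less_iff\<close>)
  with G show thesis using that by blast
qed

text \<open>
  For large \<open>\<bar>t\<bar>\<close> this is the minimal type.  The rest of the set, cut plane and banks included,
  is covered by two compact sets, one in the logarithmic plane and one in the plane.
\<close>

lemma F_bound_away:
  assumes \<delta>: "\<delta> > 0" and \<epsilon>: "\<epsilon> > 0"
  shows "\<exists>K\<ge>0. \<forall>t\<in>cut_plane a. \<delta> \<le> norm (t + of_real a) \<longrightarrow> norm (F t) \<le> K * exp (\<epsilon> * norm t)"
proof -
  obtain G where G: "G holomorphic_on sector a (- (2 * pi)) (2 * pi)"
    "minimal_type_on (sector a (- (2 * pi)) (2 * pi)) G"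
    "\<And>w. ln a < Re w \<Longrightarrow> \<bar>Im w\<bar> < pi \<Longrightarrow> G w = F (exp w)" by (rule log_branch_exists) (rule that, assumption+)
  obtain K1 R1 where 1: "\<And>w. w \<in> sector a (- (2 * pi)) (2 * pi) \<Longrightarrow> R1 \<le> norm (exp w) \<Longrightarrow>
      norm (G w) \<le> K1 * exp (\<epsilon> * norm (exp w))" using G(2) \<epsilon> unfolding minimal_type_on_def by blast
  define Bx where "Bx = cbox (Complex (ln (a + \<delta> / 2)) (- pi)) (Complex (ln R1) pi)"
  have la: "ln a < ln (a + \<delta> / 2)" using a \<delta> by simp
  have "Bx \<subseteq> sector a (- (2 * pi)) (2 * pi)"
  proof
    fix w assume "w \<in> Bx"
    then show "w \<in> sector a (- (2 * pi)) (2 * pi)"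
      using la pi_gt_zero unfolding Bx_def sector_iff in_cbox_complex_iff complex.sel atLeastAtMost_iff by linarith
  qed
  then have "bounded (G ` Bx)"
    using holomorphic_on_imp_continuous_on[OF G(1)]
    by (intro compact_imp_bounded compact_continuous_image) (auto intro: continuous_on_subset simp: Bx_def)
  then obtain C1 where "\<forall>y\<in>G ` Bx. norm y \<le> C1" unfolding bounded_iff by (elim exE)
  then have C1: "norm (G w) \<le> C1" if "w \<in> Bx" for w using that by simp
  define D where "D = cball (0::complex) (a + \<delta> / 2) - ball (- of_real a) \<delta>"
  have "compact D" unfolding D_def by (intro compact_diff) auto
  moreover have Dsub: "D \<subseteq> cut_plane a"
  proof
    fix t assume t: "t \<in> D"
    show "t \<in> cut_plane a"
    proof (rule ccontr)
      assume "t \<notin> cut_plane a"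
      then have "Im t = 0" "Re t \<le> - a" by (auto simp: cut_plane_iff)
      then have "norm t = - Re t" "norm (- of_real a - t) = - a - Re t"
        using a by (auto simp: cmod_def abs_if)
      then show False using t \<delta> by (auto simp: D_def dist_norm)
    qed
  qed
  ultimately have "bounded (F ` D)"
    using holomorphic_on_imp_continuous_on[OF F_hol]
    by (intro compact_imp_bounded compact_continuous_image) (auto intro: continuous_on_subset)
  then obtain C2 where "\<forall>y\<in>F ` D. norm y \<le> C2" unfolding bounded_iff by (elim exE)
  then have C2: "norm (F t) \<le> C2" if "t \<in> D" for t using that by simp
  define K where "K = max 0 (max K1 (max C1 C2))"
  have K: "K \<ge> 0" "K1 \<le> K" "C1 \<le> K" "C2 \<le> K" by (auto simp: K_def)
  have "norm (F t) \<le> K * exp (\<epsilon> * norm t)" if t: "t \<in> cut_plane a" "\<delta> \<le> norm (t + of_real a)" for t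
  proof -
    have e1: "C \<le> K * exp (\<epsilon> * norm t)" if "C \<le> K" for C
      using that \<epsilon> K(1) mult_left_mono[of 1 "exp (\<epsilon> * norm t)" K] by simp
    show ?thesis
    proof (cases "norm t \<le> a + \<delta> / 2")
      case True
      then have "t \<in> D" using t by (auto simp: D_def dist_norm norm_minus_commute add.commute
            simp flip: norm_minus_cancel[of "t + of_real a"])
      then show ?thesis using C2 e1[OF K(4)] by (meson order_trans)
    next
      case False
      then have nt: "norm t > a + \<delta> / 2" by simp
      then have nz: "t \<noteq> 0" using a \<delta> by auto
      define w where "w = Ln t"
      have w: "exp w = t" "Re w = ln (norm t)" using nz by (auto simp: w_def)
      have "Im w \<noteq> pi"
      proof
        assume "Im w = pi"
        then have "Im t = 0" "Re t = - norm t" using w by (metis Im_exp sin_pi mult_zero_right)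
            (metis Re_exp cos_pi w(1,2) \<open>Im w = pi\<close> exp_ln nz zero_less_norm_iff mult_minus1_right)
        then show False using t(1) nt \<delta> by (auto simp: cut_plane_iff)
      qed
      then have im: "\<bar>Im w\<bar> < pi" using mpi_less_Im_Ln[OF nz] Im_Ln_le_pi[OF nz] by (auto simp: w_def)
      have re: "ln (a + \<delta> / 2) < Re w" unfolding w(2)
        by (rule ln_less_cancel_iff[THEN iffD2]) (use nt a \<delta> nz in auto)
      have FG: "F t = G w" using G(3)[of w] re la im w(1) by simp
      show ?thesis
      proof (cases "R1 \<le> norm t")
        case True
        have "w \<in> sector a (- (2 * pi)) (2 * pi)" using re la im by (auto simp: sector_iff)
        from 1[OF this] True have "norm (G w) \<le> K1 * exp (\<epsilon> * norm t)" by (simp add: w(1) del: norm_exp_eq_Re)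
        also have "\<dots> \<le> K * exp (\<epsilon> * norm t)" using K(2) by (intro mult_right_mono) auto
        finally show ?thesis by (simp add: FG)
      next
        case False
        then have "Re w \<le> ln R1" using nz unfolding w(2) by (intro ln_mono) auto
        then have "w \<in> Bx" using re im by (auto simp: Bx_def in_cbox_complex_iff)
        then show ?thesis using C1 e1[OF K(3)] FG by (metis order_trans)
      qed
    qed
  qed
  then show ?thesis using K(1) by blast
qed

lemma F_near_singularity:
  obtains \<delta> C where "0 < \<delta>" "\<delta> \<le> 1" "C \<ge> 0"
    "\<And>t. t \<in> cut_plane a \<Longrightarrow> norm (t + of_real a) < \<delta> \<Longrightarrow> norm (F t) \<le> C * norm (Ln (t + of_real a))"
proof -
  have "F \<in> O[at (- of_real a) within (cut_plane a \<inter> ball (- of_real a) a)](\<lambda>t. Ln (t + of_real a))"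
    using F by (simp add: H_space_def)
  then obtain c where c: "c > 0"
    "\<forall>\<^sub>F t in at (- of_real a) within (cut_plane a \<inter> ball (- of_real a) a). norm (F t) \<le> c * norm (Ln (t + of_real a))"
    by (rule landau_o.bigE)
  then obtain d where d: "d > 0" "\<And>t. t \<in> cut_plane a \<inter> ball (- of_real a) a \<Longrightarrow> t \<noteq> - of_real a \<Longrightarrow>
      dist t (- of_real a) < d \<Longrightarrow> norm (F t) \<le> c * norm (Ln (t + of_real a))"
    unfolding eventually_at by blast
  show thesis
  proof (rule that[of "min 1 (min a d)" c])
    fix t assume t: "t \<in> cut_plane a" "norm (t + of_real a) < min 1 (min a d)"
    have dt: "dist t (- of_real a) = norm (t + of_real a)" by (simp add: dist_norm)
    have "t \<noteq> - of_real a" using t(1) by (auto simp: cut_plane_iff)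
    moreover have "t \<in> ball (- of_real a) a" using t(2) dt by (simp add: dist_commute)
    ultimately show "norm (F t) \<le> c * norm (Ln (t + of_real a))"
      using d(2)[of t] t dt by auto
  qed (use a c d in auto)
qed

lemma F_dominated:
  assumes \<epsilon>: "\<epsilon> > 0"
  obtains K C where "K \<ge> 0" "C \<ge> 0"
    "\<And>t. t \<in> cut_plane a \<Longrightarrow> norm t \<noteq> a \<Longrightarrow> norm (F t) \<le> K * exp (\<epsilon> * norm t) + C * spike (norm t - a)"
proof -
  obtain \<delta> C where \<delta>: "0 < \<delta>" "\<delta> \<le> 1" "C \<ge> 0"
    "\<And>t. t \<in> cut_plane a \<Longrightarrow> norm (t + of_real a) < \<delta> \<Longrightarrow> norm (F t) \<le> C * norm (Ln (t + of_real a))"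
    by (rule F_near_singularity) (rule that, assumption+)
  obtain K where K: "K \<ge> 0" "\<And>t. t \<in> cut_plane a \<Longrightarrow> \<delta> \<le> norm (t + of_real a) \<Longrightarrow>
      norm (F t) \<le> K * exp (\<epsilon> * norm t)" using F_bound_away[OF \<delta>(1) \<epsilon>] by blast
  show thesis
  proof (rule that[of K "6 * C"])
    fix t assume t: "t \<in> cut_plane a" "norm t \<noteq> a"
    show "norm (F t) \<le> K * exp (\<epsilon> * norm t) + (6 * C) * spike (norm t - a)"
    proof (cases "\<delta> \<le> norm (t + of_real a)")
      case True
      then show ?thesis using K(2)[OF t(1)] \<delta>(3) spike_nonneg[of "norm t - a"] by (simp add: add_increasing2)
    next
      case False
      have "\<bar>norm t - a\<bar> \<le> norm (t + of_real a)"
        using norm_triangle_ineq3[of t "- of_real a"] a by simp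
      then have "norm (Ln (t + of_real a)) \<le> 6 * spike \<bar>norm t - a\<bar>"
        using False \<delta>(2) t(2) by (intro norm_Ln_le_spike) auto
      then have L: "norm (Ln (t + of_real a)) \<le> 6 * spike (norm t - a)" by (simp add: spike_def)
      have "norm (F t) \<le> C * norm (Ln (t + of_real a))" using \<delta>(4)[OF t(1)] False by simp
      also have "\<dots> \<le> C * (6 * spike (norm t - a))" using L \<delta>(3) by (rule mult_left_mono)
      finally show ?thesis using K(1) by (simp add: add_increasing mult_ac)
    qed
  qed (use K \<delta> in auto)
qed

text \<open>The integrand of \<open>e\<^sup>-\<^sup>x F(x / \<zeta>)\<close> over the ray \<open>arg x = \<phi>\<close>, with \<open>\<zeta> = e\<^sup>w\<close>.\<close>

definition rot :: "real \<Rightarrow> complex \<Rightarrow> real \<Rightarrow> complex" where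
  "rot \<phi> w x = exp (\<i> * of_real \<phi>) * exp (- of_real x * exp (\<i> * of_real \<phi>)) *
     F (of_real x * exp (\<i> * of_real \<phi> - w))"

definition Q :: "real \<Rightarrow> complex \<Rightarrow> complex" where
  "Q \<phi> w = (LBINT x:{0..}. rot \<phi> w x)"

lemma rot_point: "of_real x * exp (\<i> * of_real \<phi> - w) =
    of_real (x * exp (- Re w)) * exp (\<i> * of_real (\<phi> - Im w))"
proof -
  have e: "\<i> * of_real \<phi> - w = of_real (- Re w) + \<i> * of_real (\<phi> - Im w)" by (simp add: complex_eq_iff)
  show ?thesis unfolding e by (simp only: exp_add exp_of_real of_real_mult mult.assoc)
qed

lemma rot_in_cut_plane:
  assumes "x \<ge> 0" "\<bar>Im w - \<phi>\<bar> < pi"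
  shows "of_real x * exp (\<i> * of_real \<phi> - w) \<in> cut_plane a"
  unfolding rot_point by (rule ray_in_cut_plane) (use assms a in auto)

lemma rot_bound:
  assumes \<phi>: "\<bar>\<phi>\<bar> < pi / 2" and \<theta>: "\<theta> < pi"
  shows "\<exists>K\<ge>0. \<forall>w x. x \<ge> 0 \<and> \<bar>Im w - \<phi>\<bar> \<le> \<theta> \<and> r \<le> Re w \<longrightarrow>
    norm (rot \<phi> w x) \<le> K * exp (- (cos \<phi> / 2) * x)"
proof (cases "\<theta> \<ge> 0")
  case True
  have c: "cos \<phi> > 0" using \<phi> by (intro cos_gt_zero_pi) auto
  define \<delta> where "\<delta> = a * cos (\<theta> / 2)"
  have "cos (\<theta> / 2) > 0" using True \<theta> by (intro cos_gt_zero_pi) auto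
  then have \<delta>: "\<delta> > 0" using a by (simp add: \<delta>_def)
  define \<epsilon> where "\<epsilon> = cos \<phi> / 2 * exp r"
  have \<epsilon>: "\<epsilon> > 0" using c by (simp add: \<epsilon>_def)
  obtain K where K: "K \<ge> 0" "\<And>t. t \<in> cut_plane a \<Longrightarrow> \<delta> \<le> norm (t + of_real a) \<Longrightarrow>
      norm (F t) \<le> K * exp (\<epsilon> * norm t)" using F_bound_away[OF \<delta> \<epsilon>] by blast
  have "norm (rot \<phi> w x) \<le> K * exp (- (cos \<phi> / 2) * x)"
    if w: "x \<ge> 0" "\<bar>Im w - \<phi>\<bar> \<le> \<theta>" "r \<le> Re w" for w x
  proof -
    define t where "t = of_real x * exp (\<i> * of_real \<phi> - w)"
    have tp: "t = of_real (x * exp (- Re w)) * exp (\<i> * of_real (\<phi> - Im w))"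
      unfolding t_def by (rule rot_point)
    have tc: "t \<in> cut_plane a" unfolding t_def by (rule rot_in_cut_plane) (use w \<theta> in auto)
    have "a * cos ((\<phi> - Im w) / 2) \<le> norm (t + of_real a)"
      unfolding tp by (rule norm_ray_plus_ge) (use w \<theta> a in auto)
    moreover have "cos (\<theta> / 2) \<le> cos (\<bar>\<phi> - Im w\<bar> / 2)"
      using w \<theta> by (intro cos_monotone_0_pi_le) auto
    then have "cos (\<theta> / 2) \<le> cos ((\<phi> - Im w) / 2)"
      using cos_abs_real[of "(\<phi> - Im w) / 2"] by (simp only: abs_divide abs_numeral)
    then have "\<delta> \<le> a * cos ((\<phi> - Im w) / 2)" unfolding \<delta>_def using a by (intro mult_left_mono) auto
    ultimately have d: "\<delta> \<le> norm (t + of_real a)" by linarith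
    have "norm t = x * exp (- Re w)" unfolding tp norm_mult norm_of_real using w(1) by simp
    also have "\<dots> \<le> x * exp (- r)" using w by (intro mult_left_mono) auto
    finally have "\<epsilon> * norm t \<le> \<epsilon> * (x * exp (- r))" using \<epsilon> by (intro mult_left_mono) auto
    also have "\<dots> = cos \<phi> / 2 * x" by (simp add: \<epsilon>_def exp_minus field_simps)
    finally have e: "exp (\<epsilon> * norm t) \<le> exp (cos \<phi> / 2 * x)" by simp
    have "norm (F t) \<le> K * exp (\<epsilon> * norm t)" by (rule K(2)[OF tc d])
    also have "\<dots> \<le> K * exp (cos \<phi> / 2 * x)" using e K(1) by (rule mult_left_mono)
    finally have Ft: "norm (F t) \<le> K * exp (cos \<phi> / 2 * x)" .
    have "norm (rot \<phi> w x) = exp (- x * cos \<phi>) * norm (F t)"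
      by (simp add: rot_def norm_mult Re_exp flip: t_def)
    also have "\<dots> \<le> exp (- x * cos \<phi>) * (K * exp (cos \<phi> / 2 * x))" using Ft by (rule mult_left_mono) simp
    also have "\<dots> = K * exp (- (cos \<phi> / 2) * x)" by (simp add: field_simps flip: exp_add)
    finally show ?thesis .
  qed
  then show ?thesis using K(1) by blast
qed (auto intro: exI[of _ 0])

lemma rot_measurable:
  assumes "\<bar>Im w - \<phi>\<bar> < pi"
  shows "set_borel_measurable lborel {0..} (rot \<phi> w)"
proof -
  have "continuous_on {0..} (\<lambda>x. rot \<phi> w x)"
    unfolding rot_def by (intro continuous_intros F_cont) (use rot_in_cut_plane assms in auto)
  then show ?thesis unfolding set_borel_measurable_def
    by (auto intro: borel_measurable_continuous_on_indicator)
qed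

lemma decay_integrable:
  assumes "\<bar>\<phi>\<bar> < pi / 2"
  shows "set_integrable lborel {0..} (\<lambda>x. K * exp (- (cos \<phi> / 2) * x))"
proof -
  have "cos \<phi> > 0" using assms by (intro cos_gt_zero_pi) auto
  then show ?thesis by (intro set_integrable_mult_right set_integrable_exp_atLeast) simp
qed

lemma rot_integrable:
  assumes "\<bar>\<phi>\<bar> < pi / 2" "\<bar>Im w - \<phi>\<bar> < pi"
  shows "set_integrable lborel {0..} (rot \<phi> w)"
proof -
  obtain K where K: "\<And>v x. x \<ge> 0 \<Longrightarrow> \<bar>Im v - \<phi>\<bar> \<le> \<bar>Im w - \<phi>\<bar> \<Longrightarrow> Re w \<le> Re v \<Longrightarrow>
      norm (rot \<phi> v x) \<le> K * exp (- (cos \<phi> / 2) * x)" using rot_bound[OF assms, of "Re w"] by blast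
  show ?thesis
    by (rule set_integrable_dominated[OF decay_integrable[OF assms(1), of K] rot_measurable[OF assms(2)]])
      (use K[of _ w] in auto)
qed

lemma Q_bound:
  assumes \<phi>: "\<bar>\<phi>\<bar> < pi / 2" and \<theta>: "\<theta> < pi"
  shows "\<exists>C. \<forall>w. \<bar>Im w - \<phi>\<bar> \<le> \<theta> \<and> r \<le> Re w \<longrightarrow> norm (Q \<phi> w) \<le> C"
proof -
  obtain K where K: "\<And>w x. x \<ge> 0 \<Longrightarrow> \<bar>Im w - \<phi>\<bar> \<le> \<theta> \<Longrightarrow> r \<le> Re w \<Longrightarrow>
      norm (rot \<phi> w x) \<le> K * exp (- (cos \<phi> / 2) * x)" using rot_bound[OF assms, of r] by blast
  have "norm (Q \<phi> w) \<le> (LBINT x:{0..}. K * exp (- (cos \<phi> / 2) * x))"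
    if w: "\<bar>Im w - \<phi>\<bar> \<le> \<theta>" "r \<le> Re w" for w
    unfolding Q_def set_lebesgue_integral_def
  proof (rule order_trans[OF integral_norm_bound], rule integral_mono)
    show "integrable lborel (\<lambda>x. norm (indicator {0..} x *\<^sub>R rot \<phi> w x))"
      using rot_integrable[OF \<phi>, of w] w \<theta> unfolding set_integrable_def by (intro integrable_norm) auto
    show "integrable lborel (\<lambda>x. indicator {0..} x *\<^sub>R (K * exp (- (cos \<phi> / 2) * x)))"
      using decay_integrable[OF \<phi>, of K] unfolding set_integrable_def .
    show "norm (indicator {0..} x *\<^sub>R rot \<phi> w x) \<le> indicator {0..} x *\<^sub>R (K * exp (- (cos \<phi> / 2) * x))" for x :: real
      using K[of x w] w by (auto simp: indicator_def)
  qed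
  then show ?thesis by blast
qed

lemma Q_holomorphic:
  assumes \<phi>: "\<bar>\<phi>\<bar> < pi / 2"
  shows "Q \<phi> holomorphic_on (Im_strip (\<phi> - pi) (\<phi> + pi))" (is "_ holomorphic_on ?S")
proof -
  have "(\<lambda>w. integral\<^sup>L lborel (\<lambda>x. indicator {0..} x *\<^sub>R rot \<phi> w x)) holomorphic_on ?S"
  proof (rule holomorphic_on_integral[OF open_Im_strip])
    fix w assume w: "w \<in> ?S"
    then have wi: "\<bar>Im w - \<phi>\<bar> < pi" by auto
    show "(\<lambda>x. indicator {0..} x *\<^sub>R rot \<phi> w x) \<in> borel_measurable lborel"
      using rot_measurable[OF wi] by (simp add: set_borel_measurable_def)
    define e where "e = min 1 ((pi - \<bar>Im w - \<phi>\<bar>) / 2)"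
    have e: "e > 0" "e \<le> 1" using wi by (auto simp: e_def)
    have e3: "e \<le> (pi - \<bar>Im w - \<phi>\<bar>) / 2" unfolding e_def by (rule min.cobounded2)
    define \<theta> where "\<theta> = \<bar>Im w - \<phi>\<bar> + e"
    have \<theta>: "\<theta> < pi" 
    proof -
      have "m + (pi - m) / 2 < pi" if "m < pi" for m :: real using that by (simp add: field_simps)
      from this[OF wi] e3 show ?thesis unfolding \<theta>_def by linarith
    qed
    obtain K where K: "\<And>v x. x \<ge> 0 \<Longrightarrow> \<bar>Im v - \<phi>\<bar> \<le> \<theta> \<Longrightarrow> Re w - 1 \<le> Re v \<Longrightarrow>
        norm (rot \<phi> v x) \<le> K * exp (- (cos \<phi> / 2) * x)" using rot_bound[OF \<phi> \<theta>, of "Re w - 1"] by blast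
    have "norm (indicator {0..} x *\<^sub>R rot \<phi> v x) \<le> indicator {0..} x *\<^sub>R (K * exp (- (cos \<phi> / 2) * x))"
      if "dist w v < e" for v and x :: real
    proof -
      have "\<bar>Im w - Im v\<bar> < e" "\<bar>Re w - Re v\<bar> < e"
        using abs_Im_le_cmod[of "w - v"] abs_Re_le_cmod[of "w - v"] that by (auto simp: dist_norm)
      then have "\<bar>Im v - \<phi>\<bar> \<le> \<theta>" "Re w - 1 \<le> Re v" using e by (auto simp: \<theta>_def)
      then show ?thesis using K[of x v] by (auto simp: indicator_def)
    qed
    moreover have "integrable lborel (\<lambda>x. indicator {0..} x *\<^sub>R (K * exp (- (cos \<phi> / 2) * x)))"
      using decay_integrable[OF \<phi>, of K] unfolding set_integrable_def .
    ultimately show "\<exists>e>0. \<exists>D. integrable lborel D \<and> (\<forall>v\<in>?S. dist w v < e \<longrightarrow>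
        (\<forall>x\<in>space lborel. norm (indicator {0..} x *\<^sub>R rot \<phi> v x) \<le> D x))"
      using e(1) by (intro exI[of _ e] conjI exI[of _ "\<lambda>x. indicator {0..} x *\<^sub>R (K * exp (- (cos \<phi> / 2) * x))"]) auto
  next
    fix x :: real
    have "F \<circ> (\<lambda>w. of_real x * exp (\<i> * of_real \<phi> - w)) holomorphic_on ?S" if "x \<ge> 0"
      by (rule holomorphic_on_compose_gen[OF _ F_hol]) (use that in \<open>auto intro!: holomorphic_intros rot_in_cut_plane\<close>)
    then show "(\<lambda>w. indicator {0..} x *\<^sub>R rot \<phi> w x) holomorphic_on ?S"
      unfolding rot_def comp_def by (cases "x \<ge> 0") (auto intro!: holomorphic_intros)
  qed
  then show ?thesis by (simp add: Q_def[abs_def] set_lebesgue_integral_def)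
qed

definition Lap :: "complex \<Rightarrow> complex" where
  "Lap w = exp w * (LBINT t:{0..}. exp (- exp w * of_real t) * F (of_real t))"

lemma F_halfline:
  shows "set_borel_measurable lborel {0..} (\<lambda>t. F (of_real t))"
    "\<epsilon> > 0 \<Longrightarrow> \<exists>K. \<forall>t\<ge>0. norm (F (of_real t)) \<le> K * exp (\<epsilon> * t)"
proof -
  have g: "\<exists>K R. \<forall>t\<in>cut_plane a. R \<le> norm t \<longrightarrow> norm (F t) \<le> K * exp (\<epsilon> * norm t)" if \<epsilon>: "\<epsilon> > 0" for \<epsilon>
  proof -
    obtain K where K: "\<And>t. t \<in> cut_plane a \<Longrightarrow> 1 \<le> norm (t + of_real a) \<Longrightarrow> norm (F t) \<le> K * exp (\<epsilon> * norm t)"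
      using F_bound_away[OF zero_less_one \<epsilon>] by blast
    have "norm (F t) \<le> K * exp (\<epsilon> * norm t)" if "t \<in> cut_plane a" "a + 1 \<le> norm t" for t
      using K[OF that(1)] norm_triangle_ineq2[of t "- of_real a"] that(2) a by simp
    then show ?thesis by blast
  qed
  show "set_borel_measurable lborel {0..} (\<lambda>t. F (of_real t))"
    by (rule halfline_growth(1)[OF a F_hol g])
  show "\<exists>K. \<forall>t\<ge>0. norm (F (of_real t)) \<le> K * exp (\<epsilon> * t)" if "\<epsilon> > 0"
    by (rule halfline_growth(2)[OF a F_hol g that])
qed

lemma Lap_holomorphic: "Lap holomorphic_on (Im_strip (- (pi / 2)) (pi / 2))"
  unfolding Lap_def[abs_def] by (rule laplace_transform_holomorphic[OF F_halfline])

text \<open>Substituting \<open>x = \<bar>\<zeta>\<bar> t\<close>: on this line \<open>x / \<zeta>\<close> runs through the positive axis.\<close>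

lemma Q_on_line:
  assumes "Im w = \<phi>"
  shows "Q \<phi> w = Lap w"
proof -
  define c where "c = exp (Re w)"
  have c: "c > 0" by (simp add: c_def)
  have ew: "exp w = of_real c * exp (\<i> * of_real \<phi>)"
    using assms by (simp only: exp_eq_polar[of w] c_def cis_conv_exp)
  have pt: "exp (\<i> * of_real \<phi> - w) = of_real (1 / c)"
  proof -
    have e: "\<i> * of_real \<phi> - w = of_real (- Re w)" using assms by (simp add: complex_eq_iff)
    show ?thesis unfolding e exp_of_real c_def by (simp add: exp_minus field_simps)
  qed
  have "Q \<phi> w = \<bar>c\<bar> *\<^sub>R (LBINT t. indicator {0..} (0 + c * t) *\<^sub>R rot \<phi> w (0 + c * t))"
    unfolding Q_def set_lebesgue_integral_def by (rule lborel_integral_real_affine) (use c in simp)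
  also have "(LBINT t. indicator {0..} (0 + c * t) *\<^sub>R rot \<phi> w (0 + c * t)) =
      (LBINT t. exp (\<i> * of_real \<phi>) * (indicator {0..} t *\<^sub>R (exp (- exp w * of_real t) * F (of_real t))))"
    by (rule Bochner_Integration.integral_cong)
      (use c in \<open>auto simp: rot_def pt ew indicator_def zero_le_mult_iff mult_ac\<close>)
  also have "\<dots> = exp (\<i> * of_real \<phi>) * (LBINT t:{0..}. exp (- exp w * of_real t) * F (of_real t))"
    unfolding set_lebesgue_integral_def by (rule integral_mult_right_zero)
  finally show ?thesis using c unfolding Lap_def ew by (simp add: scaleR_conv_of_real mult.assoc)
qed

lemma Q_eq_Lap:
  assumes \<phi>: "\<bar>\<phi>\<bar> < pi / 2" and w: "\<bar>Im w\<bar> < pi / 2"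
  shows "Q \<phi> w = Lap w"
proof (rule holomorphic_eq_from_line[where f = "Q \<phi>" and g = Lap and e = 1
      and S = "Im_strip (- (pi / 2)) (pi / 2)" and ?z0.0 = "\<i> * of_real \<phi>"])
  show "Q \<phi> holomorphic_on (Im_strip (- (pi / 2)) (pi / 2))"
    by (rule holomorphic_on_subset[OF Q_holomorphic[OF \<phi>]]) (use \<phi> in auto)
  show "open (Im_strip (- (pi / 2)) (pi / 2))" by (rule open_Im_strip)
  show "connected (Im_strip (- (pi / 2)) (pi / 2))" by (rule connected_Im_strip)
  show "w \<in> (Im_strip (- (pi / 2)) (pi / 2))" using w by auto
  show "\<i> * of_real \<phi> \<in> (Im_strip (- (pi / 2)) (pi / 2))" using \<phi> by auto
  show "Q \<phi> w = Lap w" if "Im w = Im (\<i> * of_real \<phi>)" for w using that by (intro Q_on_line) simp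
qed (use Lap_holomorphic in auto)

lemma Q_eq_Q:
  assumes \<phi>: "\<bar>\<phi>\<bar> < pi / 2" "\<bar>\<phi>'\<bar> < pi / 2" and w: "\<bar>Im w - \<phi>\<bar> < pi" "\<bar>Im w - \<phi>'\<bar> < pi"
  shows "Q \<phi> w = Q \<phi>' w"
proof (rule holomorphic_eq_from_line[where f = "Q \<phi>" and g = "Q \<phi>'" and e = 1
      and S = "Im_strip (max \<phi> \<phi>' - pi) (min \<phi> \<phi>' + pi)" and ?z0.0 = 0])
  show "Q \<phi> holomorphic_on (Im_strip (max \<phi> \<phi>' - pi) (min \<phi> \<phi>' + pi))"
    by (rule holomorphic_on_subset[OF Q_holomorphic[OF \<phi>(1)]]) auto
  show "Q \<phi>' holomorphic_on (Im_strip (max \<phi> \<phi>' - pi) (min \<phi> \<phi>' + pi))"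
    by (rule holomorphic_on_subset[OF Q_holomorphic[OF \<phi>(2)]]) auto
  show "open (Im_strip (max \<phi> \<phi>' - pi) (min \<phi> \<phi>' + pi))" by (rule open_Im_strip)
  show "connected (Im_strip (max \<phi> \<phi>' - pi) (min \<phi> \<phi>' + pi))" by (rule connected_Im_strip)
  show "w \<in> (Im_strip (max \<phi> \<phi>' - pi) (min \<phi> \<phi>' + pi))" using w by auto
  show "0 \<in> (Im_strip (max \<phi> \<phi>' - pi) (min \<phi> \<phi>' + pi))" using \<phi> by auto
  show "Q \<phi> w = Q \<phi>' w" if "Im w = Im 0" for w
    using that Q_eq_Lap[OF \<phi>(1), of w] Q_eq_Lap[OF \<phi>(2), of w] by simp
qed auto

text \<open>
  The rays \<open>arg x = \<plusminus>\<pi>/4\<close> together reach \<open>\<bar>arg \<zeta>\<bar> < 5\<pi>/4\<close>, an open neighbourhood of the closed strip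
  \<open>\<bar>arg \<zeta>\<bar> \<le> \<pi>\<close> on which the functional equation takes place.
\<close>

definition p :: "complex \<Rightarrow> complex" where
  "p w = (if Im w \<ge> 0 then Q (pi / 4) w else Q (- (pi / 4)) w)"

lemma p_eq_Q:
  assumes "\<bar>\<phi>\<bar> \<le> pi / 4" "\<bar>Im w - \<phi>\<bar> < pi"
  shows "p w = Q \<phi> w"
proof -
  have "\<bar>\<phi>\<bar> < pi / 2" using assms(1) pi_gt_zero by linarith
  then show ?thesis
    using Q_eq_Q[of "pi / 4" \<phi> w] Q_eq_Q[of "- (pi / 4)" \<phi> w] assms pi_gt_zero
    unfolding p_def by (cases "Im w \<ge> 0") (simp_all add: abs_if split: if_splits)
qed

lemma p_holomorphic: "p holomorphic_on (Im_strip (- (5 * pi / 4)) (5 * pi / 4))"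
proof -
  have "p holomorphic_on (Im_strip (\<phi> - pi) (\<phi> + pi))" if \<phi>: "\<bar>\<phi>\<bar> = pi / 4" for \<phi>
  proof (rule holomorphic_transform)
    show "Q \<phi> holomorphic_on (Im_strip (\<phi> - pi) (\<phi> + pi))"
      by (rule Q_holomorphic) (use \<phi> pi_gt_zero in linarith)
    show "Q \<phi> w = p w" if "w \<in> (Im_strip (\<phi> - pi) (\<phi> + pi))" for w
      by (rule p_eq_Q[symmetric]) (use \<phi> that in auto)
  qed
  from this[of "pi / 4"] this[of "- (pi / 4)"]
  have "p holomorphic_on (Im_strip (pi / 4 - pi) (pi / 4 + pi)) \<union>
      (Im_strip (- (pi / 4) - pi) (- (pi / 4) + pi))"
    by (intro holomorphic_on_Un open_Im_strip) auto
  then show ?thesis by (rule holomorphic_on_subset) (use pi_gt_zero in auto)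
qed

text \<open>
  The ray \<open>arg x = 0\<close> is used, with \<open>arg \<zeta>\<close> increasing to \<open>\<pi>\<close> and decreasing to \<open>- \<pi>\<close>.  Then \<open>t = x / \<zeta>\<close> tends to the
  lower and to the upper bank.  For \<open>\<bar>t\<bar> < a\<close> the two limits of \<open>F\<close> cancel, and for \<open>\<bar>t\<bar> > a\<close> they differ by the
  jump \<open>T F(\<bar>t\<bar> - a)\<close>; a shift of \<open>x\<close> by \<open>a \<zeta>\<close> produces the exponential factor.
\<close>

lemma p_jump:
  fixes v :: real
  shows "p (of_real v + pi * \<i>) - p (of_real v - pi * \<i>) =
    T * exp (- (of_real a * exp (of_real v))) * p (of_real v)"
proof -
  define c where "c = exp (- v)"
  have c: "c > 0" by (simp add: c_def)
  define \<theta> where "\<theta> n = pi * (1 - 1 / real (n + 2))" for n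
  have \<theta>: "0 < \<theta> n" "\<theta> n < pi" for n
  proof -
    have "1 / real (n + 2) < 1" "1 / real (n + 2) > 0" by auto
    then show "0 < \<theta> n" "\<theta> n < pi" using pi_gt_zero unfolding \<theta>_def by (auto simp del: of_nat_add)
  qed
  have \<theta>l: "\<theta> \<longlonglongrightarrow> pi"
  proof -
    have "(\<lambda>n. pi * (1 - 1 / real (n + 2))) \<longlonglongrightarrow> pi * (1 - 0)"
      by (intro tendsto_intros LIMSEQ_ignore_initial_segment lim_const_over_n[of 1, simplified])
    then show ?thesis by (simp add: \<theta>_def[abs_def])
  qed
  define t where "t s n x = of_real (x * c) * exp (\<i> * of_real (s * \<theta> n))" for s :: real and n and x :: real
  define f where "f n x = of_real (exp (- x)) * (F (t (-1) n x) - F (t 1 n x))" for n and x :: real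
  \<comment> \<open>Closed at \<open>x c = a\<close>, a null set, so that the shift below lands exactly on \<open>{0..}\<close>.\<close>
  define L where "L x = (if x * c \<ge> a then of_real (exp (- x)) * (T * F (of_real (x * c - a))) else 0)" for x :: real
  have tc: "t s n x \<in> cut_plane a" if "s = 1 \<or> s = -1" "x \<ge> 0" for s n x
    unfolding t_def by (rule ray_in_cut_plane) (use that c \<theta> a in \<open>auto simp: abs_less_iff intro: less_trans[OF _ pi_gt_zero]\<close>)
  have nt: "norm (t s n x) = x * c" if "x \<ge> 0" for s n x
    unfolding t_def norm_mult norm_of_real using that c by simp

  have rot0: "rot 0 (of_real v - of_real (s * \<theta> n) * \<i>) x = of_real (exp (- x)) * F (t s n x)" for s n x
  proof -
    have "\<i> * of_real 0 - (of_real v - of_real (s * \<theta> n) * \<i>) = of_real (- v) + \<i> * of_real (s * \<theta> n)" by simp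
    then have "exp (\<i> * of_real 0 - (of_real v - of_real (s * \<theta> n) * \<i>)) = of_real c * exp (\<i> * of_real (s * \<theta> n))"
      by (simp only: exp_add exp_of_real c_def)
    then have "of_real x * exp (\<i> * of_real 0 - (of_real v - of_real (s * \<theta> n) * \<i>)) = t s n x"
      by (simp add: t_def)
    then show ?thesis unfolding rot_def by (simp flip: exp_of_real)
  qed
  have Q0: "Q 0 (of_real v + of_real (\<theta> n) * \<i>) - Q 0 (of_real v - of_real (\<theta> n) * \<i>) =
      (LBINT x. indicator {0..} x *\<^sub>R f n x)" for n
  proof -
    have i: "set_integrable lborel {0..} (rot 0 (of_real v - of_real (s * \<theta> n) * \<i>))" if "s = 1 \<or> s = -1" for s
      by (rule rot_integrable) (use that \<theta>[of n] in \<open>auto simp: abs_less_iff intro: less_trans[OF _ pi_gt_zero]\<close>)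
    have "Q 0 (of_real v - of_real (- 1 * \<theta> n) * \<i>) - Q 0 (of_real v - of_real (1 * \<theta> n) * \<i>) = (LBINT x:{0..}. f n x)"
      unfolding Q_def
      by (subst set_integral_diff(2)[symmetric, OF i i]) (simp_all only: rot0 f_def[abs_def] right_diff_distrib simp_thms)
    then show ?thesis by (simp add: set_lebesgue_integral_def)
  qed

  have lhs: "(\<lambda>n. LBINT x. indicator {0..} x *\<^sub>R f n x) \<longlonglongrightarrow> p (of_real v + pi * \<i>) - p (of_real v - pi * \<i>)"
  proof -
    have Qp: "Q 0 w = p w" if "\<bar>Im w\<bar> < pi" for w using p_eq_Q[of 0 w] that pi_gt_zero by simp
    have ct: "isCont p w" if "\<bar>Im w\<bar> \<le> pi" for w
    proof -
      have "w \<in> (Im_strip (- (5 * pi / 4)) (5 * pi / 4))"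
        using that pi_gt_zero unfolding mem_Collect_eq by linarith
      then show ?thesis
        using holomorphic_on_imp_continuous_on[OF p_holomorphic] open_Im_strip continuous_on_eq_continuous_at by blast
    qed
    have l: "(\<lambda>n. p (of_real v + of_real (s * \<theta> n) * \<i>)) \<longlonglongrightarrow> p (of_real v + of_real (s * pi) * \<i>)"
      if "\<bar>s\<bar> = 1" for s
      by (rule isCont_tendsto_compose[OF ct]) (use that in \<open>auto simp: abs_mult intro!: tendsto_intros \<theta>l\<close>)
    have "(\<lambda>n. p (of_real v + of_real (\<theta> n) * \<i>) - p (of_real v - of_real (\<theta> n) * \<i>))
        \<longlonglongrightarrow> p (of_real v + pi * \<i>) - p (of_real v - pi * \<i>)"
      using tendsto_diff[OF l[of 1] l[of "-1"]] by simp
    moreover have "p (of_real v + of_real (\<theta> n) * \<i>) - p (of_real v - of_real (\<theta> n) * \<i>) =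
        (LBINT x. indicator {0..} x *\<^sub>R f n x)" for n
      unfolding Q0[symmetric] using \<theta>[of n] by (simp add: Qp abs_less_iff)
    ultimately show ?thesis by simp
  qed

  obtain K C where KC: "K \<ge> 0" "C \<ge> 0"
    "\<And>t. t \<in> cut_plane a \<Longrightarrow> norm t \<noteq> a \<Longrightarrow> norm (F t) \<le> K * exp (1 / (2 * c) * norm t) + C * spike (norm t - a)"
    by (rule F_dominated[of "1 / (2 * c)"]) (use c in simp, rule that, assumption+)
  \<comment> \<open>The rate \<open>1 / (2 c)\<close> turns \<open>\<bar>t\<bar> = x c\<close> into \<open>x / 2\<close>, half of the decay of the kernel.\<close>
  define W where "W x = indicator {0..} x *\<^sub>R (2 * K * exp (- (1 / 2) * x)) + 2 * C * spike (- a + c * x)" for x :: real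
  have fW: "norm (indicator {0..} x *\<^sub>R f n x) \<le> W x" if "x * c \<noteq> a" for n x
  proof (cases "x \<ge> 0")
    case True
    have b: "norm (F (t s n x)) \<le> K * exp (x / 2) + C * spike (- a + c * x)" if "s = 1 \<or> s = -1" for s
      using KC(3)[OF tc[OF that True, of n]] \<open>x * c \<noteq> a\<close> c by (simp add: nt[OF True] algebra_simps)
    have "norm (F (t (-1) n x) - F (t 1 n x)) \<le> 2 * (K * exp (x / 2) + C * spike (- a + c * x))"
      using norm_triangle_ineq4[of "F (t (-1) n x)" "F (t 1 n x)"] b[of 1] b[of "-1"] by simp
    then have "norm (f n x) \<le> exp (- x) * (2 * (K * exp (x / 2) + C * spike (- a + c * x)))"
      unfolding f_def norm_mult by (simp add: mult_left_mono)
    also have "\<dots> = 2 * K * (exp (- x) * exp (x / 2)) + exp (- x) * (2 * C * spike (- a + c * x))"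
      by (simp add: algebra_simps)
    also have "exp (- x) * exp (x / 2) = exp (- (1 / 2) * x)" by (simp flip: exp_add)
    also have "exp (- x) * (2 * C * spike (- a + c * x)) \<le> 1 * (2 * C * spike (- a + c * x))"
      using True KC(2) spike_nonneg by (intro mult_right_mono) auto
    finally show ?thesis using True by (simp add: W_def)
  next
    case False
    then show ?thesis using KC(2) spike_nonneg by (simp add: W_def)
  qed
  have Wi: "integrable lborel W"
  proof -
    have "integrable lborel (\<lambda>x. indicator {0..} x *\<^sub>R (2 * K * exp (- (1 / 2) * x)))"
      using set_integrable_mult_right[of "2 * K" lborel "{0..}" "\<lambda>x. exp (- (1 / 2) * x)"]
        set_integrable_exp_atLeast[of "1 / 2" 0] by (simp add: set_integrable_def)
    moreover have "integrable lborel (\<lambda>x. 2 * C * spike (- a + c * x))"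
      using lborel_integrable_real_affine[OF spike_integrable, of c "- a"] c by (intro integrable_mult_right) simp
    ultimately show ?thesis unfolding W_def by (rule Bochner_Integration.integrable_add)
  qed

  have pt: "(\<lambda>n. indicator {0..} x *\<^sub>R f n x) \<longlonglongrightarrow> indicator {0..} x *\<^sub>R L x" if x: "x * c \<noteq> a" for x
  proof (cases "x \<ge> 0")
    case True
    have tl: "(\<lambda>n. t s n x) \<longlonglongrightarrow> of_real (- (x * c))" if s: "s = 1 \<or> s = -1" for s
    proof -
      have "(\<lambda>n. t s n x) \<longlonglongrightarrow> of_real (x * c) * exp (\<i> * of_real (s * pi))"
        unfolding t_def by (intro tendsto_intros \<theta>l)
      moreover have "exp (\<i> * of_real (s * pi)) = -1" using s exp_minus[of "\<i> * of_real pi"] by (auto simp: mult.commute)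
      ultimately show ?thesis by simp
    qed
    show ?thesis
    proof (cases "x * c < a")
      case True
      have "of_real (- (x * c)) \<in> cut_plane a" using True by (simp add: cut_plane_iff)
      then have "isCont F (of_real (- (x * c)))"
        using holomorphic_on_imp_continuous_on[OF F_hol] open_cut_plane continuous_on_eq_continuous_at by blast
      then have Fl: "(\<lambda>n. F (t s n x)) \<longlonglongrightarrow> F (of_real (- (x * c)))" if "s = 1 \<or> s = -1" for s
        using isCont_tendsto_compose tl[OF that] by blast
      have "(\<lambda>n. of_real (exp (- x)) * (F (t (-1) n x) - F (t 1 n x))) \<longlonglongrightarrow>
          of_real (exp (- x)) * (F (of_real (- (x * c))) - F (of_real (- (x * c))))"
        by (intro tendsto_intros Fl) auto
      then have "f' \<longlonglongrightarrow> 0" if "f' = (\<lambda>n. f n x)" for f' using that by (simp add: f_def)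
      then show ?thesis using True by (simp add: L_def tendsto_scaleR[OF tendsto_const, of _ 0, simplified])
    next
      case False
      define s where "s = x * c - a"
      have s: "s > 0" using False x by (simp add: s_def)
      have ps: "complex_of_real (- a - s) = of_real (- (x * c))" by (simp add: s_def)
      obtain u l where ul: "(F \<longlongrightarrow> u) (at (of_real (- a - s)) within {t. Im t > 0})"
          "(F \<longlongrightarrow> l) (at (of_real (- a - s)) within {t. Im t < 0})" "u = l - T * F (of_real s)"
        using F s unfolding H_space_def by blast
      have xc: "x * c > 0" using s a by (simp add: s_def)
      have sgn: "sin (\<theta> n) > 0" for n using \<theta> by (intro sin_gt_zero) auto
      then have sgn0: "sin (\<theta> n) \<noteq> 0" for n by (metis less_irrefl)
      have Imt: "Im (t s n x) = x * c * sin (s * \<theta> n)" for s n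
        by (simp add: t_def Im_exp)
      have "filterlim (\<lambda>n. t (-1) n x) (at (of_real (- a - s)) within {t. Im t < 0}) sequentially"
        unfolding ps filterlim_at
        using tl[of "-1"] xc sgn by (auto intro!: always_eventually simp: Imt sgn0 mult_less_0_iff complex_eq_iff)
      from filterlim_compose[OF ul(2) this] have 1: "(\<lambda>n. F (t (-1) n x)) \<longlonglongrightarrow> l" .
      have "filterlim (\<lambda>n. t 1 n x) (at (of_real (- a - s)) within {t. Im t > 0}) sequentially"
        unfolding ps filterlim_at
        using tl[of 1] xc sgn by (auto intro!: always_eventually simp: Imt sgn0 complex_eq_iff)
      from filterlim_compose[OF ul(1) this] have 2: "(\<lambda>n. F (t 1 n x)) \<longlonglongrightarrow> u" .
      have "(\<lambda>n. f n x) \<longlonglongrightarrow> of_real (exp (- x)) * (l - u)"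
        unfolding f_def by (intro tendsto_intros 1 2)
      also have "of_real (exp (- x)) * (l - u) = L x" using False ul(3) by (simp add: L_def s_def)
      finally show ?thesis by (intro tendsto_intros)
    qed
  qed simp

  have Lm: "(\<lambda>x. indicator {0..} x *\<^sub>R L x) \<in> borel_measurable lborel"
  proof -
    have "continuous_on {a / c..} (\<lambda>x. of_real (exp (- x)) * (T * F (of_real (x * c - a))))"
    proof (intro continuous_intros F_cont)
      show "(\<lambda>x. complex_of_real (x * c - a)) ` {a / c..} \<subseteq> cut_plane a"
        using c a by (auto simp: cut_plane_iff field_simps)
    qed
    then have "(\<lambda>x. indicator {a / c..} x *\<^sub>R (of_real (exp (- x)) * (T * F (of_real (x * c - a))))) \<in> borel_measurable borel"
      by (intro borel_measurable_continuous_on_indicator) auto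
    moreover have "indicator {0..} x *\<^sub>R L x = indicator {a / c..} x *\<^sub>R (of_real (exp (- x)) * (T * F (of_real (x * c - a))))" for x
    proof -
      have "a / c \<le> x \<longleftrightarrow> a \<le> x * c" using c by (simp add: pos_divide_le_eq)
      moreover have "x \<ge> 0" if "a \<le> x * c" using that a c by (metis less_le_trans less_imp_le zero_less_mult_pos2)
      ultimately show ?thesis by (auto simp: L_def indicator_def)
    qed
    ultimately show ?thesis by simp
  qed
  have ne: "AE x in lborel. x * c \<noteq> a"
  proof -
    have "AE x in lborel. x \<noteq> a / c" by (rule AE_lborel_singleton)
    then show ?thesis by eventually_elim (use c in \<open>auto simp: field_simps\<close>)
  qed
  have fm: "(\<lambda>x. indicator {0..} x *\<^sub>R f n x) \<in> borel_measurable lborel" for n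
  proof -
    have "continuous_on {0..} (\<lambda>x. F (t s n x))" if "s = 1 \<or> s = -1" for s
    proof (rule F_cont)
      show "continuous_on {0..} (t s n)" unfolding t_def[abs_def] by (intro continuous_intros)
    qed (use tc[OF that] in auto)
    then have "continuous_on {0..} (f n)" unfolding f_def[abs_def] by (intro continuous_intros) auto
    then show ?thesis using borel_measurable_continuous_on_indicator[of "{0..}" "f n"] by simp
  qed
  have "(\<lambda>n. LBINT x. indicator {0..} x *\<^sub>R f n x) \<longlonglongrightarrow> (LBINT x. indicator {0..} x *\<^sub>R L x)"
  proof (rule integral_dominated_convergence[OF Lm fm Wi])
    show "AE x in lborel. (\<lambda>n. indicator {0..} x *\<^sub>R f n x) \<longlonglongrightarrow> indicator {0..} x *\<^sub>R L x"
      using ne by eventually_elim (rule pt)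
    show "AE x in lborel. norm (indicator {0..} x *\<^sub>R f n x) \<le> W x" for n
      using ne by eventually_elim (rule fW)
  qed
  from LIMSEQ_unique[OF lhs this]
  have "p (of_real v + pi * \<i>) - p (of_real v - pi * \<i>) = (LBINT x. indicator {0..} x *\<^sub>R L x)" .
  also have "\<dots> = \<bar>1\<bar> *\<^sub>R (LBINT y. indicator {0..} (a / c + 1 * y) *\<^sub>R L (a / c + 1 * y))"
    by (rule lborel_integral_real_affine) simp
  also have "\<dots> = (LBINT y. (T * of_real (exp (- (a / c)))) * (indicator {0..} y *\<^sub>R rot 0 (of_real v) y))"
    unfolding abs_one scaleR_one
  proof (rule Bochner_Integration.integral_cong[OF refl])
    fix y :: real
    have e: "(a / c + 1 * y) * c = a + y * c" using c by (simp add: field_simps)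
    have r: "rot 0 (of_real v) y = of_real (exp (- y)) * F (of_real (y * c))"
      unfolding rot_def by (simp add: c_def flip: exp_of_real)
    have "a \<le> a + y * c \<longleftrightarrow> y \<ge> 0" using c by (simp add: zero_le_mult_iff)
    moreover have "a / c \<ge> 0" using a c by simp
    ultimately show "indicator {0..} (a / c + 1 * y) *\<^sub>R L (a / c + 1 * y) =
        (T * of_real (exp (- (a / c)))) * (indicator {0..} y *\<^sub>R rot 0 (of_real v) y)"
      unfolding L_def e r by (auto simp: indicator_def exp_add exp_diff exp_minus field_simps)
  qed
  also have "\<dots> = (T * of_real (exp (- (a / c)))) * Q 0 (of_real v)"
    unfolding Q_def set_lebesgue_integral_def by (rule integral_mult_right_zero)
  also have "Q 0 (of_real v) = p (of_real v)" using p_eq_Q[of 0 "of_real v"] pi_gt_zero by simp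
  also have "complex_of_real (exp (- (a / c))) = exp (- (of_real a * exp (of_real v)))"
    by (simp add: c_def exp_minus divide_inverse flip: exp_of_real)
  finally show ?thesis .
qed

end

section \<open>Entire extension, injectivity and the theorem\<close>

text \<open>
  The recurrence, read as a formula for its highest or for its lowest value, extends a solution
  by one strip of width \<open>\<pi>\<close> on either side.
\<close>

lemma extension_step:
  fixes k q :: "complex \<Rightarrow> complex" and c m :: real
  assumes c: "c > 0" and m: "m \<ge> 1" and k: "k holomorphic_on UNIV"
    and q: "q holomorphic_on (Im_strip (- (m * pi + c)) (m * pi + c))"
    and rec: "\<And>v::real. q (of_real v + pi * \<i>) = q (of_real v - pi * \<i>) + k (of_real v) * q (of_real v)"
  shows "\<exists>q'. q' holomorphic_on (Im_strip (- ((m + 1) * pi + c)) ((m + 1) * pi + c)) \<and>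
    (\<forall>w. \<bar>Im w\<bar> < m * pi + c \<longrightarrow> q' w = q w)"
proof -
  define d where "d = m * pi"
  have d: "d \<ge> pi" using m by (simp add: d_def)
  have kc: "(\<lambda>w. k (f w)) holomorphic_on S" if "f holomorphic_on S" for f S
    using holomorphic_on_compose_gen[OF that k] by (simp add: comp_def)
  have qc: "(\<lambda>w. q (w + z)) holomorphic_on S" if "\<And>w. w \<in> S \<Longrightarrow> - (d + c) < Im w + Im z \<and> Im w + Im z < d + c" for z S
  proof -
    have "q \<circ> (\<lambda>w. w + z) holomorphic_on S"
      by (rule holomorphic_on_compose_gen[OF _ q]) (use that in \<open>auto intro!: holomorphic_intros simp: d_def\<close>)
    then show ?thesis by (simp add: comp_def)
  qed
  have fe: "q (w + pi * \<i>) = q (w + - (pi * \<i>)) + k w * q (w + 0)" if w: "\<bar>Im w\<bar> < d - pi + c" for w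
  proof (rule holomorphic_eq_from_line[where f = "\<lambda>w. q (w + pi * \<i>)"
        and g = "\<lambda>w. q (w + - (pi * \<i>)) + k w * q (w + 0)" and e = 1
        and S = "Im_strip (- (d - pi + c)) (d - pi + c)" and ?z0.0 = 0])
    show "(\<lambda>w. q (w + pi * \<i>)) holomorphic_on (Im_strip (- (d - pi + c)) (d - pi + c))"
      by (rule qc) ((auto; use pi_gt_zero in linarith)+)
    show "(\<lambda>w. q (w + - (pi * \<i>)) + k w * q (w + 0)) holomorphic_on (Im_strip (- (d - pi + c)) (d - pi + c))"
      by (intro holomorphic_intros qc holomorphic_on_subset[OF k]) ((auto; use pi_gt_zero in linarith)+)
    fix w assume "Im w = Im 0"
    then have "w = of_real (Re w)" by (simp add: complex_eq_iff)
    then show "q (w + pi * \<i>) = q (w + - (pi * \<i>)) + k w * q (w + 0)"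
      using rec[of "Re w"] by simp
  next
    show "open (Im_strip (- (d - pi + c)) (d - pi + c))" by (rule open_Im_strip)
    show "connected (Im_strip (- (d - pi + c)) (d - pi + c))" by (rule connected_Im_strip)
  qed (use w c d in auto)
  define up where "up w = q (w + - (2 * pi * \<i>)) + k (w - pi * \<i>) * q (w + - (pi * \<i>))" for w
  define dn where "dn w = q (w + 2 * pi * \<i>) - k (w + pi * \<i>) * q (w + pi * \<i>)" for w
  define q' where "q' w = (if \<bar>Im w\<bar> < d + c then q w else if Im w > 0 then up w else dn w)" for w
  let ?S = "Im_strip (- (d + c)) (d + c)"
  let ?U = "Im_strip (2 * pi - (d + c)) (d + pi + c)"
  let ?D = "Im_strip (- (d + pi + c)) (d + c - 2 * pi)"
  have "q' holomorphic_on ?S"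
    by (rule holomorphic_transform[OF q[folded d_def]]) (auto simp: q'_def)
  moreover have "q' holomorphic_on ?U"
  proof (rule holomorphic_transform)
    show "up holomorphic_on ?U" unfolding up_def[abs_def]
      by (intro holomorphic_intros qc kc) ((auto; use pi_gt_zero in linarith)+)
    fix w assume w: "w \<in> ?U"
    show "up w = q' w"
    proof (cases "\<bar>Im w\<bar> < d + c")
      case True
      have "\<bar>Im (w - pi * \<i>)\<bar> < d - pi + c"
        using True w unfolding mem_Collect_eq by simp linarith
      from fe[OF this] show ?thesis using True by (simp add: q'_def up_def algebra_simps)
    next
      case False
      then have "Im w > 0" using w pi_gt_zero unfolding mem_Collect_eq by linarith
      then show ?thesis using False by (simp add: q'_def)
    qed
  qed
  moreover have "q' holomorphic_on ?D"
  proof (rule holomorphic_transform)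
    show "dn holomorphic_on ?D" unfolding dn_def[abs_def]
      by (intro holomorphic_intros qc kc) ((auto; use pi_gt_zero in linarith)+)
    fix w assume w: "w \<in> ?D"
    show "dn w = q' w"
    proof (cases "\<bar>Im w\<bar> < d + c")
      case True
      have "\<bar>Im (w + pi * \<i>)\<bar> < d - pi + c"
        using True w unfolding mem_Collect_eq by simp linarith
      from fe[OF this] show ?thesis using True by (simp add: q'_def dn_def algebra_simps)
    next
      case False
      then have "\<not> Im w > 0" using w pi_gt_zero unfolding mem_Collect_eq by linarith
      then show ?thesis using False by (simp add: q'_def)
    qed
  qed
  ultimately have h: "q' holomorphic_on (?S \<union> ?U) \<union> ?D"
    by (intro holomorphic_on_Un open_Un open_Im_strip)
  have "q' holomorphic_on (Im_strip (- ((m + 1) * pi + c)) ((m + 1) * pi + c))"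
  proof (rule holomorphic_on_subset[OF h], rule subsetI)
    fix w assume "w \<in> (Im_strip (- ((m + 1) * pi + c)) ((m + 1) * pi + c))"
    then have "- (d + pi + c) < Im w" "Im w < d + pi + c" by (auto simp: d_def algebra_simps)
    moreover have "\<bar>Im w\<bar> < d + c \<or> Im w \<ge> d + c \<or> Im w \<le> - (d + c)" by linarith
    ultimately have "(- (d + c) < Im w \<and> Im w < d + c) \<or> (2 * pi - (d + c) < Im w \<and> Im w < d + pi + c) \<or>
        (- (d + pi + c) < Im w \<and> Im w < d + c - 2 * pi)" using d c pi_gt_zero by linarith
    then show "w \<in> (?S \<union> ?U) \<union> ?D" by simp
  qed
  moreover have "\<forall>w. \<bar>Im w\<bar> < m * pi + c \<longrightarrow> q' w = q w" by (simp add: q'_def d_def)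
  ultimately show ?thesis by blast
qed

lemma extension_to_entire:
  fixes k p :: "complex \<Rightarrow> complex" and c :: real
  assumes c: "c > 0" and k: "k holomorphic_on UNIV"
    and p: "p holomorphic_on (Im_strip (- (pi + c)) (pi + c))"
    and rec: "\<And>v::real. p (of_real v + pi * \<i>) = p (of_real v - pi * \<i>) + k (of_real v) * p (of_real v)"
  shows "\<exists>P. P holomorphic_on UNIV \<and> (\<forall>w. \<bar>Im w\<bar> < pi + c \<longrightarrow> P w = p w)"
proof -
  define S where "S n = (Im_strip (- ((real n + 1) * pi + c)) ((real n + 1) * pi + c))" for n
  have S_iff: "w \<in> S n \<longleftrightarrow> \<bar>Im w\<bar> < (real n + 1) * pi + c" for w n
    unfolding S_def mem_Collect_eq by linarith
  have "\<exists>q. q holomorphic_on S n \<and> (\<forall>w. \<bar>Im w\<bar> < pi + c \<longrightarrow> q w = p w)" for n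
  proof (induction n)
    case 0
    show ?case using p by (intro exI[of _ p]) (simp add: S_def)
  next
    case (Suc n)
    then obtain q where q: "q holomorphic_on S n" "\<And>w. \<bar>Im w\<bar> < pi + c \<Longrightarrow> q w = p w" by blast
    have "q (of_real v + pi * \<i>) = q (of_real v - pi * \<i>) + k (of_real v) * q (of_real v)" for v :: real
      using rec[of v] c pi_gt_zero by (simp add: q(2) add_pos_pos)
    from extension_step[OF c _ k q(1)[unfolded S_def] this]
    obtain q' where q': "q' holomorphic_on (Im_strip (- ((real n + 1 + 1) * pi + c)) ((real n + 1 + 1) * pi + c))"
      "\<And>w. \<bar>Im w\<bar> < (real n + 1) * pi + c \<Longrightarrow> q' w = q w" by auto
    have "q' w = p w" if "\<bar>Im w\<bar> < pi + c" for w
    proof -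
      have "pi \<le> (real n + 1) * pi" by simp
      then have "\<bar>Im w\<bar> < (real n + 1) * pi + c" using that by linarith
      then show ?thesis using q'(2)[of w] q(2)[OF that] by simp
    qed
    then show ?case using q'(1) by (intro exI[of _ q']) (simp add: S_def add.commute)
  qed
  then have "\<exists>q. \<forall>n. q n holomorphic_on S n \<and> (\<forall>w. \<bar>Im w\<bar> < pi + c \<longrightarrow> q n w = p w)"
    by (intro choice allI)
  then obtain q where q: "\<And>n. q n holomorphic_on S n" "\<And>n w. \<bar>Im w\<bar> < pi + c \<Longrightarrow> q n w = p w" by blast
  have oc: "open (S n)" "connected (S n)" for n
    unfolding S_def by (rule open_Im_strip, rule connected_Im_strip)
  have mono: "S m \<subseteq> S n" if "m \<le> n" for m n
  proof
    fix w assume "w \<in> S m"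
    moreover have "(real m + 1) * pi \<le> (real n + 1) * pi" using that by simp
    ultimately show "w \<in> S n" unfolding S_iff by linarith
  qed
  have le: "q m w = q n w" if "w \<in> S m" "m \<le> n" for m n w
  proof (rule holomorphic_eq_from_line[where S = "S m" and ?z0.0 = 0 and e = 1 and f = "q m" and g = "q n"])
    show "q n holomorphic_on S m" by (rule holomorphic_on_subset[OF q(1) mono[OF that(2)]])
    show "q m w = q n w" if "Im w = Im 0" for w
      using that q(2)[of w] c pi_gt_zero by (simp add: add_pos_pos)
    have "0 \<le> (real m + 1) * pi" by simp
    then have "0 < (real m + 1) * pi + c" using c by linarith
    then show "0 \<in> S m" unfolding S_iff by simp
    show "w \<in> S m" by (rule that(1))
  qed (rule q(1) oc zero_less_one)+
  have eq: "q m w = q n w" if "w \<in> S m" "w \<in> S n" for m n w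
  proof (cases "m \<le> n")
    case True
    show ?thesis by (rule le[OF that(1) True])
  next
    case False
    then have "n \<le> m" by simp
    from le[OF that(2) this] show ?thesis by (rule sym)
  qed
  define N where "N w = nat \<lceil>\<bar>Im w\<bar> / pi\<rceil>" for w
  have NS: "w \<in> S (N w)" for w
  proof -
    have "\<bar>Im w\<bar> / pi \<le> real (N w)" unfolding N_def by (rule real_nat_ceiling_ge)
    then have "\<bar>Im w\<bar> \<le> real (N w) * pi" by (simp add: pos_divide_le_eq)
    then show ?thesis unfolding S_iff using c pi_gt_zero unfolding distrib_right by linarith
  qed
  define P where "P w = q (N w) w" for w
  have Pq: "P w = q n w" if "w \<in> S n" for w n
    unfolding P_def by (rule eq[OF NS that])
  have "P holomorphic_on (\<Union>n. S n)"
  proof (rule holomorphic_on_UN_open)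
    show "P holomorphic_on S n" for n
      by (rule holomorphic_transform[OF q(1)]) (simp add: Pq)
  qed (rule oc)
  moreover have "(\<Union>n. S n) = UNIV" using NS by blast
  moreover have "P w = p w" if "\<bar>Im w\<bar> < pi + c" for w
    using Pq[of w 0] q(2)[OF that] that by (simp add: S_iff)
  ultimately show ?thesis by auto
qed

context H_data
begin

lemma laplace_in_S: "\<exists>P\<in>S_space a T. is_laplace F P"
proof -
  define k where "k w = T * exp (- (of_real a * exp w))" for w
  have kh: "k holomorphic_on UNIV" unfolding k_def[abs_def] by (intro holomorphic_intros)
  have eq5: "pi + pi / 4 = 5 * pi / 4" by simp
  have "\<exists>P. P holomorphic_on UNIV \<and> (\<forall>w. \<bar>Im w\<bar> < pi + pi / 4 \<longrightarrow> P w = p w)"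
  proof (rule extension_to_entire[OF _ kh])
    show "p holomorphic_on (Im_strip (- (pi + pi / 4)) (pi + pi / 4))"
      unfolding eq5 by (rule p_holomorphic)
    show "p (of_real v + pi * \<i>) = p (of_real v - pi * \<i>) + k (of_real v) * p (of_real v)" for v
      using p_jump[of v] by (simp add: k_def algebra_simps)
  qed simp
  then obtain P where P: "P holomorphic_on UNIV" "\<And>w. \<bar>Im w\<bar> < pi + pi / 4 \<Longrightarrow> P w = p w" by blast
  have Pc: "(\<lambda>w. P (f w)) holomorphic_on A" if "f holomorphic_on A" for f A
    using holomorphic_on_compose_gen[OF that P(1)] by (simp add: comp_def)
  have fe: "P (w + pi * \<i>) = P (w - pi * \<i>) + T * exp (- a * exp w) * P w" for w :: complex
  proof -
    have "P (w + pi * \<i>) = P (w - pi * \<i>) + k w * P w"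
    proof (rule holomorphic_eq_from_line[where f = "\<lambda>w. P (w + pi * \<i>)" and g = "\<lambda>w. P (w - pi * \<i>) + k w * P w"
          and e = 1 and S = UNIV and ?z0.0 = 0])
      fix w :: complex assume "Im w = Im 0"
      then have w: "w = of_real (Re w)" by (simp add: complex_eq_iff)
      have "\<bar>pi\<bar> < pi + pi / 4" "\<bar>0\<bar> < pi + pi / 4" using pi_gt_zero by linarith+
      then have "P (of_real (Re w) + pi * \<i>) = P (of_real (Re w) - pi * \<i>) + k (of_real (Re w)) * P (of_real (Re w))"
        using p_jump[of "Re w"] by (simp add: P(2) k_def algebra_simps)
      then show "P (w + pi * \<i>) = P (w - pi * \<i>) + k w * P w" using w by simp
    qed (auto intro!: holomorphic_intros Pc P(1) kh)
    then show ?thesis by (simp add: k_def)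
  qed
  have PQ: "P w = Q \<phi> w" if "\<bar>Im w\<bar> \<le> pi" "\<bar>\<phi>\<bar> \<le> pi / 4" "\<bar>Im w - \<phi>\<bar> < pi" for w \<phi>
  proof -
    have "\<bar>Im w\<bar> < pi + pi / 4" using that(1) pi_gt_zero by linarith
    then show ?thesis using P(2)[of w] p_eq_Q[OF that(2,3)] by simp
  qed

  define B where "B r = {norm (P w) | w. \<bar>Im w\<bar> \<le> pi \<and> norm (exp w) \<ge> r}" for r :: real
  have bdd: "bdd_above (B r)" if r: "r > 0" for r
  proof -
    have h: "\<bar>pi / 4\<bar> < pi / 2" "\<bar>- (pi / 4)\<bar> < pi / 2" "3 * pi / 4 < pi" using pi_gt_zero by linarith+
    obtain C1 where C1: "\<And>w. \<bar>Im w - pi / 4\<bar> \<le> 3 * pi / 4 \<Longrightarrow> ln r \<le> Re w \<Longrightarrow> norm (Q (pi / 4) w) \<le> C1"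
      using Q_bound[OF h(1,3), of "ln r"] by blast
    obtain C2 where C2: "\<And>w. \<bar>Im w - - (pi / 4)\<bar> \<le> 3 * pi / 4 \<Longrightarrow> ln r \<le> Re w \<Longrightarrow> norm (Q (- (pi / 4)) w) \<le> C2"
      using Q_bound[OF h(2,3), of "ln r"] by blast
    have "norm (P w) \<le> max C1 C2" if w: "\<bar>Im w\<bar> \<le> pi" "norm (exp w) \<ge> r" for w
    proof -
      have "ln r \<le> ln (exp (Re w))" using w(2) r by (intro ln_mono) auto
      then have re: "ln r \<le> Re w" by simp
      show ?thesis
      proof (cases "Im w \<ge> 0")
        case True
        have i: "\<bar>Im w - pi / 4\<bar> \<le> 3 * pi / 4" using True w(1) pi_gt_zero by linarith
        have "P w = Q (pi / 4) w" using w(1) i h(3) pi_gt_zero by (intro PQ) linarith+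
        then show ?thesis using C1[OF i re] by simp
      next
        case False
        have i: "\<bar>Im w - - (pi / 4)\<bar> \<le> 3 * pi / 4" using False w(1) pi_gt_zero by linarith
        have "P w = Q (- (pi / 4)) w" using w(1) i h(3) pi_gt_zero by (intro PQ) linarith+
        then show ?thesis using C2[OF i re] by simp
      qed
    qed
    then show ?thesis unfolding B_def by (intro bdd_aboveI[of _ "max C1 C2"]) auto
  qed
  have ne: "norm (P (of_real (ln r))) \<in> B r" if "r > 0" for r
    using that unfolding B_def by (auto intro!: exI[of _ "of_real (ln r)"])
  define M where "M r = 1 + Sup (B r)" for r
  have "M r > 0" if "r > 0" for r
    using cSup_upper[OF ne[OF that] bdd[OF that]] norm_ge_zero[of "P (of_real (ln r))"]
    unfolding M_def by linarith
  moreover have "antimono_on {0<..} M"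
  proof (rule monotone_onI)
    fix r s :: real assume rs: "r \<in> {0<..}" "s \<in> {0<..}" "r \<le> s"
    then have "B s \<subseteq> B r" unfolding B_def by auto
    then have "Sup (B s) \<le> Sup (B r)" using rs ne[of s] bdd[of r] by (intro cSup_subset_mono) auto
    then show "M s \<le> M r" by (simp add: M_def)
  qed
  moreover have "norm (P w) \<le> M r" if "r > 0" "\<bar>Im w\<bar> \<le> pi" "norm (exp w) \<ge> r" for r w
  proof -
    have "norm (P w) \<in> B r" using that unfolding B_def by auto
    from cSup_upper[OF this bdd[OF that(1)]] show ?thesis by (simp add: M_def)
  qed
  ultimately have "\<exists>M :: real \<Rightarrow> real. (\<forall>r>0. M r > 0) \<and> antimono_on {0<..} M \<and>
      (\<forall>r>0. \<forall>w. \<bar>Im w\<bar> \<le> pi \<and> norm (exp w) \<ge> r \<longrightarrow> norm (P w) \<le> M r)" by blast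
  then have "P \<in> S_space a T" unfolding S_space_def using P(1) fe[unfolded of_real_minus] by blast
  moreover have "is_laplace F P"
  proof -
    have "P w = exp w * (LBINT t:{0..}. exp (- exp w * of_real t) * F (of_real t))" if w: "\<bar>Im w\<bar> < pi / 2" for w
    proof -
      have "P w = Q 0 w" by (rule PQ) (use w pi_gt_zero in linarith)+
      also have "\<dots> = Lap w" by (rule Q_eq_Lap) (use w in auto)
      finally show ?thesis by (simp add: Lap_def)
    qed
    then show ?thesis unfolding is_laplace_def
      using P(1) set_integrable_laplace[OF F_halfline] by blast
  qed
  ultimately show ?thesis by blast
qed

end

text \<open>
  The function \<open>\<Phi> z\<close>, the integral of \<open>e\<^sup>z\<^sup>(\<^sup>A\<^sup>-\<^sup>t\<^sup>) f(t)\<close> over \<open>[0, A]\<close>, is entire.  It is clearly bounded for \<open>Re z \<le> 1\<close>.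
  For \<open>Re z \<ge> 1\<close> it is bounded because the hypothesis turns it into minus the integral over
  \<open>(A, \<infinity>)\<close>, where the exponential is small.  By Liouville's theorem \<open>\<Phi>\<close> is constant, and it tends
  to \<open>0\<close> along the negative axis, so its value at \<open>0\<close> vanishes.
\<close>

lemma truncated_laplace_integrals_vanish:
  fixes f :: "real \<Rightarrow> complex"
  assumes f: "continuous_on {0..} f"
    and int: "\<And>z. Re z > 0 \<Longrightarrow> set_integrable lborel {0..} (\<lambda>t. exp (- z * of_real t) * f t)"
    and zero: "\<And>z. Re z > 0 \<Longrightarrow> (LBINT t:{0..}. exp (- z * of_real t) * f t) = 0"
    and A: "A \<ge> 0"
  shows "(LBINT t:{0..A}. f t) = 0"
proof -
  have fA: "continuous_on {0..A} f" by (rule continuous_on_subset[OF f]) auto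
  then have "bounded (f ` {0..A})" by (intro compact_imp_bounded compact_continuous_image) auto
  then obtain C where "\<forall>y\<in>f ` {0..A}. norm y \<le> C" unfolding bounded_iff by (elim exE)
  then have C: "norm (f t) \<le> C" if "t \<in> {0..A}" for t using that by simp
  have C0: "C \<ge> 0" using order_trans[OF norm_ge_zero C[of 0]] A by simp
  define g where "g z t = exp (z * of_real (A - t)) * f t" for z and t :: real
  define \<Phi> where "\<Phi> z = (LBINT t:{0..A}. g z t)" for z
  have gi: "set_integrable lborel {0..A} (g z)" for z
    unfolding g_def by (intro borel_integrable_atLeastAtMost' continuous_intros fA)
  have ci: "integrable lborel (\<lambda>t. indicator {0..A} t *\<^sub>R (K * C))" for K :: real
    using borel_integrable_atLeastAtMost'[of 0 A "\<lambda>_. K * C"] by (simp add: set_integrable_def)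
  have gb: "norm (indicator {0..A} t *\<^sub>R g z t) \<le> indicator {0..A} t *\<^sub>R (exp (R * A) * C)"
    if "Re z \<le> R" "R \<ge> 0" for z t R
  proof (cases "t \<in> {0..A}")
    case True
    have "Re z * (A - t) \<le> R * (A - t)" using True that by (intro mult_right_mono) auto
    also have "\<dots> \<le> R * A" using True that by (intro mult_left_mono) auto
    finally have "norm (exp (z * of_real (A - t))) \<le> exp (R * A)" by simp
    then have "norm (g z t) \<le> exp (R * A) * C"
      unfolding g_def norm_mult using C[OF True] by (intro mult_mono) auto
    then show ?thesis using True by simp
  qed simp
  have "\<Phi> holomorphic_on UNIV"
  proof -
    have "(\<lambda>z. integral\<^sup>L lborel (\<lambda>t. indicator {0..A} t *\<^sub>R g z t)) holomorphic_on UNIV"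
    proof (rule holomorphic_on_integral)
      show "(\<lambda>t. indicator {0..A} t *\<^sub>R g z t) \<in> borel_measurable lborel" for z
        using gi[of z] by (simp add: set_integrable_def)
      show "\<exists>e>0. \<exists>D. integrable lborel D \<and> (\<forall>y\<in>UNIV. dist z y < e \<longrightarrow>
          (\<forall>t\<in>space lborel. norm (indicator {0..A} t *\<^sub>R g y t) \<le> D t))" for z
      proof (intro exI[of _ 1] conjI exI[of _ "\<lambda>t. indicator {0..A} t *\<^sub>R (exp ((norm z + 1) * A) * C)"] ballI impI)
        fix y and t :: real assume "dist z y < 1"
        then have "Re y \<le> norm z + 1"
          using complex_Re_le_cmod[of y] norm_triangle_ineq[of z "y - z"] by (simp add: dist_norm norm_minus_commute)
        then show "norm (indicator {0..A} t *\<^sub>R g y t) \<le> indicator {0..A} t *\<^sub>R (exp ((norm z + 1) * A) * C)"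
          by (rule gb) simp
      next
        show "integrable lborel (\<lambda>t. indicator {0..A} t *\<^sub>R (exp ((norm z + 1) * A) * C))" by (rule ci)
      qed simp_all
      show "(\<lambda>z. indicator {0..A} t *\<^sub>R g z t) holomorphic_on UNIV" for t
        unfolding g_def by (intro holomorphic_intros)
    qed (rule open_UNIV)
    then show ?thesis by (simp add: \<Phi>_def[abs_def] set_lebesgue_integral_def)
  qed
  moreover have "bounded (range \<Phi>)"
  proof -
    have tail: "set_integrable lborel {A<..} (\<lambda>t. exp (- z * of_real t) * f t)" if "Re z > 0" for z
      by (rule set_integrable_subset[OF int[OF that]]) (use A in auto)
    define C1 where "C1 = exp A * (LBINT t:{A<..}. norm (exp (- 1 * of_real t) * f t))"
    have i1: "set_integrable lborel {A<..} (\<lambda>t. norm (exp (- 1 * of_real t) * f t))"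
      by (rule set_integrable_norm[OF tail]) simp
    have 1: "norm (\<Phi> z) \<le> C1" if z: "Re z \<ge> 1" for z
    proof -
      have z0: "Re z > 0" using z by simp
      have fin: "set_integrable lborel {0..A} (\<lambda>t. exp (- z * of_real t) * f t)"
        by (rule set_integrable_subset[OF int[OF z0]]) auto
      have "(LBINT t:{0..A} \<union> {A<..}. exp (- z * of_real t) * f t) =
          (LBINT t:{0..A}. exp (- z * of_real t) * f t) + (LBINT t:{A<..}. exp (- z * of_real t) * f t)"
        by (rule set_integral_Un[OF _ fin tail[OF z0]]) auto
      moreover have "{0..A} \<union> {A<..} = {0..}" using A by auto
      ultimately have split: "(LBINT t:{0..A}. exp (- z * of_real t) * f t) = - (LBINT t:{A<..}. exp (- z * of_real t) * f t)"
        using zero[OF z0] by (simp add: add_eq_0_iff)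
      have "\<Phi> z = exp (z * of_real A) * (LBINT t:{0..A}. exp (- z * of_real t) * f t)"
        unfolding \<Phi>_def g_def set_integral_mult_right[symmetric]
        by (rule set_lebesgue_integral_cong) (simp_all add: algebra_simps flip: exp_add)
      also have "\<dots> = - (LBINT t:{A<..}. exp (z * of_real A) * (exp (- z * of_real t) * f t))"
        unfolding split by simp
      also have "norm \<dots> \<le> (LBINT t:{A<..}. norm (exp (z * of_real A) * (exp (- z * of_real t) * f t)))"
        unfolding norm_minus_cancel
        by (rule set_integral_norm_bound) (intro set_integrable_mult_right tail[OF z0])
      also have "\<dots> \<le> (LBINT t:{A<..}. exp A * norm (exp (- 1 * of_real t) * f t))"
      proof (rule set_integral_mono)
        show "set_integrable lborel {A<..} (\<lambda>t. norm (exp (z * of_real A) * (exp (- z * of_real t) * f t)))"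
          by (intro set_integrable_norm set_integrable_mult_right tail[OF z0])
        show "set_integrable lborel {A<..} (\<lambda>t. exp A * norm (exp (- 1 * of_real t) * f t))"
          by (intro set_integrable_mult_right i1)
        fix t assume "t \<in> {A<..}"
        then have "Re z * (A - t) \<le> 1 * (A - t)" using z by (intro mult_right_mono_neg) auto
        then have "exp (Re z * A - Re z * t) \<le> exp (A - t)" by (simp add: algebra_simps)
        then have "exp (Re z * A - Re z * t) * norm (f t) \<le> exp (A - t) * norm (f t)" by (rule mult_right_mono) simp
        then show "norm (exp (z * of_real A) * (exp (- z * of_real t) * f t)) \<le> exp A * norm (exp (- 1 * of_real t) * f t)"
          unfolding norm_mult norm_exp_eq_Re by (simp add: exp_diff exp_minus divide_inverse mult.assoc)
      qed
      also have "\<dots> = C1" by (simp add: C1_def)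
      finally show ?thesis .
    qed
    define C2 where "C2 = (LBINT t. indicator {0..A} t *\<^sub>R (exp (1 * A) * C))"
    have 2: "norm (\<Phi> z) \<le> C2" if z: "Re z \<le> 1" for z
      unfolding \<Phi>_def set_lebesgue_integral_def C2_def
    proof (rule order_trans[OF integral_norm_bound], rule integral_mono)
      show "integrable lborel (\<lambda>t. norm (indicator {0..A} t *\<^sub>R g z t))"
        using gi[of z] unfolding set_integrable_def by (rule integrable_norm)
      show "norm (indicator {0..A} t *\<^sub>R g z t) \<le> indicator {0..A} t *\<^sub>R (exp (1 * A) * C)" for t
        by (rule gb[OF z]) simp
    qed (rule ci)
    have "norm (\<Phi> z) \<le> max C1 C2" for z using 1[of z] 2[of z] by linarith
    then show ?thesis unfolding bounded_iff by blast
  qed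
  ultimately have "\<Phi> constant_on UNIV" by (rule Liouville_theorem)
  then obtain c where c: "\<And>z. \<Phi> z = c" unfolding constant_on_def by auto
  have "(\<lambda>n. \<Phi> (- of_nat n)) \<longlonglongrightarrow> (LBINT t::real. 0)"
    unfolding \<Phi>_def set_lebesgue_integral_def
  proof (rule integral_dominated_convergence[where w = "\<lambda>t. indicator {0..A} t *\<^sub>R (exp (0 * A) * C)"])
    show "AE t in lborel. norm (indicator {0..A} t *\<^sub>R g (- of_nat n) t) \<le> indicator {0..A} t *\<^sub>R (exp (0 * A) * C)" for n
      by (rule AE_I2, rule gb) simp_all
    have "AE t in lborel. t \<noteq> A" by (rule AE_lborel_singleton)
    then show "AE t in lborel. (\<lambda>n. indicator {0..A} t *\<^sub>R g (- of_nat n) t) \<longlonglongrightarrow> 0"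
    proof eventually_elim
      case (elim t)
      show ?case
      proof (cases "t \<in> {0..A}")
        case True
        then have "A - t > 0" using elim by auto
        then have "norm (exp (- complex_of_real (A - t))) < 1" by simp
        then have "(\<lambda>n. exp (- complex_of_real (A - t)) ^ n * f t) \<longlonglongrightarrow> 0 * f t"
          by (intro tendsto_intros LIMSEQ_power_zero)
        moreover have "exp (- complex_of_real (A - t)) ^ n = exp (- of_nat n * of_real (A - t))" for n
          by (simp only: exp_of_nat_mult[symmetric] mult_minus_left mult_minus_right)
        ultimately show ?thesis using True by (simp add: g_def)
      qed simp
    qed
  qed (use gi ci in \<open>auto simp: set_integrable_def\<close>)
  then have "c = 0" using c by (simp add: LIMSEQ_const_iff)
  then show ?thesis using c[of 0] by (simp add: \<Phi>_def g_def)
qed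

lemma laplace_transform_injective:
  fixes f :: "real \<Rightarrow> complex"
  assumes f: "continuous_on {0..} f"
    and int: "\<And>z. Re z > 0 \<Longrightarrow> set_integrable lborel {0..} (\<lambda>t. exp (- z * of_real t) * f t)"
    and zero: "\<And>z. Re z > 0 \<Longrightarrow> (LBINT t:{0..}. exp (- z * of_real t) * f t) = 0"
    and x: "x \<ge> 0"
  shows "f x = 0"
proof -
  have fc: "continuous_on {0..x + 1} f" by (rule continuous_on_subset[OF f]) auto
  have "integral {0..u} f = 0" if "u \<in> {0..x + 1}" for u
  proof -
    have "continuous_on {0..u} f" by (rule continuous_on_subset[OF f]) auto
    then have "(LBINT t:{0..u}. f t) = integral {0..u} f"
      by (rule set_borel_integral_eq_integral(2)[OF borel_integrable_atLeastAtMost'])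
    then show ?thesis using truncated_laplace_integrals_vanish[OF f int zero, of u] that by simp
  qed
  note z = this
  have d: "((\<lambda>u. integral {0..u} f) has_vector_derivative f x) (at x within {0..x + 1})"
    by (rule integral_has_vector_derivative[OF fc]) (use x in auto)
  have "((\<lambda>u. 0) has_vector_derivative f x) (at x within {0..x + 1})"
    by (rule has_vector_derivative_transform[OF _ _ d]) (use x z in auto)
  from vector_derivative_unique_within_closed_interval[OF _ _ this[folded cbox_interval]
      has_vector_derivative_const[of 0 "at x within cbox 0 (x + 1)"]]
  show ?thesis using x by simp
qed

lemma connected_cut_plane:
  assumes "a > 0"
  shows "connected (cut_plane a)"
proof (rule starlike_imp_connected)
  have "closed_segment 0 z \<subseteq> cut_plane a" if z: "z \<in> cut_plane a" for z
  proof
    fix v assume "v \<in> closed_segment 0 z"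
    then obtain u where u: "0 \<le> u" "u \<le> 1" "v = u *\<^sub>R z" by (auto simp: closed_segment_def)
    show "v \<in> cut_plane a"
    proof (cases "u = 0 \<or> Im z \<noteq> 0")
      case True
      then show ?thesis using u assms by (auto simp: cut_plane_iff)
    next
      case False
      then have "Re z > - a" using z by (simp add: cut_plane_iff)
      moreover have "u * - a \<ge> - a" using u assms mult_left_le_one_le[of a u] by simp
      moreover have "u * Re z > u * - a" using \<open>Re z > - a\<close> u False by (intro mult_strict_left_mono) auto
      ultimately show ?thesis using u by (simp add: cut_plane_iff)
    qed
  qed
  moreover have "0 \<in> cut_plane a" using assms by (simp add: cut_plane_iff)
  ultimately show "starlike (cut_plane a)" unfolding starlike_def by blast
qed

lemma laplace_op_inj:
  assumes a: "a > 0" and F: "F \<in> H_space a T" "F' \<in> H_space a T" and P: "is_laplace F P" "is_laplace F' P"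
  shows "F = F'"
proof -
  define D where "D t = F t + (- 1) * F' t" for t
  have D: "D \<in> H_space a T" unfolding D_def[abs_def] by (rule H_space_add_scale[OF F])
  have Dh: "D holomorphic_on cut_plane a" using D by (simp add: H_space_def)
  have z: "set_integrable lborel {0..} (\<lambda>t. exp (- z * of_real t) * D (of_real t)) \<and>
      (LBINT t:{0..}. exp (- z * of_real t) * D (of_real t)) = 0" if z: "Re z > 0" for z
  proof -
    have nz: "z \<noteq> 0" using z by auto
    have "\<bar>Im (Ln z)\<bar> < pi / 2" using z Re_Ln_pos_lt[OF nz] by simp
    note l = P(1)[unfolded is_laplace_def, THEN conjunct2, THEN spec, THEN mp, OF this, unfolded exp_Ln[OF nz]]
      P(2)[unfolded is_laplace_def, THEN conjunct2, THEN spec, THEN mp, OF this, unfolded exp_Ln[OF nz]]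
    note i = l(1)[THEN conjunct1] l(2)[THEN conjunct1]
    have e: "z * (LBINT t:{0..}. exp (- z * of_real t) * F (of_real t)) =
        z * (LBINT t:{0..}. exp (- z * of_real t) * F' (of_real t))"
      using l(1)[THEN conjunct2] l(2)[THEN conjunct2] by (rule subst)
    have d: "exp (- z * of_real t) * D (of_real t) =
        exp (- z * of_real t) * F (of_real t) - exp (- z * of_real t) * F' (of_real t)" for t
      by (simp add: D_def algebra_simps)
    show ?thesis unfolding d using set_integral_diff[OF i] e nz by simp
  qed
  have c: "continuous_on {0..} (\<lambda>t. D (of_real t))"
    by (rule continuous_on_compose2[OF holomorphic_on_imp_continuous_on[OF Dh]])
      (use a in \<open>auto intro!: continuous_intros simp: cut_plane_iff\<close>)
  have D0: "D (of_real t) = 0" if "t \<ge> 0" for t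
    by (rule laplace_transform_injective[OF c _ _ that]) (use z in auto)
  have "D t = 0" for t
  proof (cases "t \<in> cut_plane a")
    case True
    show ?thesis
    proof (rule holomorphic_eq_from_line[where f = D and g = "\<lambda>_. 0" and S = "cut_plane a" and ?z0.0 = 1 and e = 1])
      fix w assume w: "Im w = Im 1" "dist w 1 < 1"
      then have "w = of_real (Re w)" by (simp add: complex_eq_iff)
      moreover have "Re w \<ge> 0" using abs_Re_le_cmod[of "w - 1"] w(2) by (simp add: dist_norm)
      ultimately show "D w = 0" using D0 by metis
    qed (use True a Dh open_cut_plane connected_cut_plane in \<open>auto simp: cut_plane_iff\<close>)
  next
    case False
    then show ?thesis using D by (simp add: H_space_def)
  qed
  then show ?thesis by (auto simp: D_def fun_eq_iff)
qed

theorem mainTheorem1: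
  fixes a :: real and T :: complex
  assumes "a > 0"
  shows "(\<forall>F\<in>H_space a T. is_laplace F (laplace_op F)) \<and>
         bij_betw laplace_op (H_space a T) (S_space a T)"
proof -
  have H: "is_laplace F (laplace_op F) \<and> laplace_op F \<in> S_space a T" if "F \<in> H_space a T" for F
  proof -
    interpret H_data a T F using assms that by unfold_locales
    obtain P where "P \<in> S_space a T" "is_laplace F P" using laplace_in_S by blast
    then show ?thesis using laplace_op_eq[of F P] by simp
  qed
  have "inj_on laplace_op (H_space a T)"
  proof (rule inj_onI)
    fix F F' assume "F \<in> H_space a T" "F' \<in> H_space a T" "laplace_op F = laplace_op F'"
    then show "F = F'" using H[of F] H[of F'] laplace_op_inj[OF assms, of F T F' "laplace_op F"] by simp
  qed
  moreover have "laplace_op ` H_space a T = S_space a T"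
  proof
    show "laplace_op ` H_space a T \<subseteq> S_space a T" using H by blast
    show "S_space a T \<subseteq> laplace_op ` H_space a T"
    proof
      fix P assume "P \<in> S_space a T"
      then interpret borel_data a T P using assms by unfold_locales
      show "P \<in> laplace_op ` H_space a T"
        using F_in_H laplace_op_eq[OF is_laplace_F] by (metis image_eqI)
    qed
  qed
  ultimately show ?thesis using H by (simp add: bij_betw_def)
qed

end
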